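(* Let $F_{12}:=(6,\{02,03,04,15\})$. Then $\lambda_{F_{12}}=40/243$. Furthermore, the $F_{12}$-problem is perfectly $B$-stable with $B:=(3,\{00,12\})$, and the unique (up to automorphisms of $B$) maximiser of $p(F_{12},B(\boldsymbol x))$ over $\boldsymbol x\in\mathbb S_3$ is $\boldsymbol x=(1/3,1/3,1/3)$.
   Context: All graphs are finite and simple. $(m,E)$ denotes the graph or pattern with vertex set $\{0,\dots,m-1\}$ and edge set $E$; $ij$ abbreviates $\{i,j\}$ ($ii$ is a loop). For graphs $F,G$ with $\kappa\le n$ vertices, $p(F,G)$ is the number of $\kappa$-subsets of $V(G)$ inducing a subgraph isomorphic to $F$, divided by $\binom n\kappa$; $p(F,n)$ is the maximum of $p(F,G)$ over $n$-vertex graphs $G$; $\lambda_F=\lim_{n\to\infty}p(F,n)$ (the limit exists). A pattern is a graph in which loops are allowed; its automorphisms are the bijections of the vertex set preserving edges, non-edges, loops and non-loops. For a pattern $B$ on $\{0,\dots,m-1\}$ and disjoint (possibly empty) sets $V_0,\dots,V_{m-1}$, the blowup $B(V_0,\dots,V_{m-1})$ is the simple graph on $\bigcup V_i$ in which distinct $x\in V_i$, $y\in V_j$ are adjacent iff $\{i,j\}\in E(B)$ (so $V_i$ is a clique if $i$ has a loop and independent otherwise); $B()$ is the family of all blowups. $\mathbb S_m=\{\boldsymbol x\in\mathbb R^m:x_i\ge0,\sum x_i=1\}$, and $p(F,B(\boldsymbol x))$ is the limit as $n\to\infty$ of $p(F,B(V_0,\dots,V_{m-1}))$ with $|V_i|=(x_i+o(1))n$.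 $\delta_{\mathrm{edit}}(G,B())$ is the minimum number of vertex pairs whose adjacency must be changed to turn $G$ into a graph isomorphic to a blowup of $B$ (of the same order). The $F$-problem is perfectly $B$-stable if there is $C>0$ such that every graph $G$ with $n\ge C$ vertices satisfies $\delta_{\mathrm{edit}}(G,B())\le C\,(p(F,n)-p(F,G))\,n^2$. *)

theory Defs
  imports Complex_Main "HOL-Library.Disjoint_Sets"
begin

text \<open>
  A pattern is a pair of a vertex set and an edge set. An edge is the set of its endpoints,
  so a loop at \<open>x\<close> is the singleton \<open>{x, x} = {x}\<close>.
\<close>

type_synonym 'a pattern = "'a set \<times> 'a set set"

abbreviation verts :: "'a pattern \<Rightarrow> 'a set" where "verts \<equiv> fst"
abbreviation edges :: "'a pattern \<Rightarrow> 'a set set" where "edges \<equiv> snd"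

definition is_pattern :: "'a pattern \<Rightarrow> bool" where
  "is_pattern P \<longleftrightarrow>
     finite (verts P) \<and> edges P \<subseteq> {{x, y} | x y. x \<in> verts P \<and> y \<in> verts P}"

definition is_graph :: "'a pattern \<Rightarrow> bool" where
  "is_graph G \<longleftrightarrow> is_pattern G \<and> (\<forall>x. {x, x} \<notin> edges G)"

text \<open>Taking \<open>x = y\<close> below shows that loops and non-loops are preserved, too.\<close>

definition isomorphism :: "('a \<Rightarrow> 'b) \<Rightarrow> 'a pattern \<Rightarrow> 'b pattern \<Rightarrow> bool" where
  "isomorphism f P Q \<longleftrightarrow> bij_betw f (verts P) (verts Q) \<and>
     (\<forall>x \<in> verts P. \<forall>y \<in> verts P. {x, y} \<in> edges P \<longleftrightarrow> {f x, f y} \<in> edges Q)"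

definition isomorphic :: "'a pattern \<Rightarrow> 'b pattern \<Rightarrow> bool" where
  "isomorphic P Q \<longleftrightarrow> (\<exists>f. isomorphism f P Q)"

definition automorphism :: "('a \<Rightarrow> 'a) \<Rightarrow> 'a pattern \<Rightarrow> bool" where
  "automorphism f P \<longleftrightarrow> isomorphism f P P"

definition induced :: "'a pattern \<Rightarrow> 'a set \<Rightarrow> 'a pattern" where
  "induced G S = (S, {e \<in> edges G. e \<subseteq> S})"

definition induced_density :: "'a pattern \<Rightarrow> 'b pattern \<Rightarrow> real" where
  "induced_density F G =
     real (card {S. S \<subseteq> verts G \<and> card S = card (verts F) \<and> isomorphic F (induced G S)})
       / real (card (verts G) choose card (verts F))"

text \<open>
  Up to isomorphism every finite graph lives on a set of natural numbers, so here and below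
  quantification over all graphs is quantification over graphs of this kind.
  The set of densities is finite, so the maximum is a true one.
\<close>

definition max_density :: "'a pattern \<Rightarrow> nat \<Rightarrow> real" where
  "max_density F n = Max {induced_density F G | G :: nat pattern. is_graph G \<and> card (verts G) = n}"

definition inducibility :: "'a pattern \<Rightarrow> real" where
  "inducibility F = lim (\<lambda>n. max_density F n)"

definition blowup :: "'a pattern \<Rightarrow> ('a \<Rightarrow> 'b set) \<Rightarrow> 'b pattern" where
  "blowup B V =
     (\<Union>i \<in> verts B. V i,
      {{x, y} | x y. x \<noteq> y \<and>
         (\<exists>i \<in> verts B. \<exists>j \<in> verts B. x \<in> V i \<and> y \<in> V j \<and> {i, j} \<in> edges B)})"

definition blowup_parts :: "'a pattern \<Rightarrow> ('a \<Rightarrow> 'b set) \<Rightarrow> bool" where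
  "blowup_parts B V \<longleftrightarrow> disjoint_family_on V (verts B) \<and> (\<forall>i \<in> verts B. finite (V i))"

definition blowups :: "'a pattern \<Rightarrow> nat pattern set" where
  "blowups B = {blowup B V | V. blowup_parts B V}"

definition std_simplex :: "'a set \<Rightarrow> ('a \<Rightarrow> real) set" where
  "std_simplex I = {x. (\<forall>i \<in> I. 0 \<le> x i) \<and> (\<Sum>i \<in> I. x i) = 1}"

text \<open>
  The common limit of the densities along all sequences of blowups
  whose \<open>i\<close>-th part has size \<open>(x i + o(1)) n\<close>.
\<close>

definition blowup_density :: "'a pattern \<Rightarrow> 'b pattern \<Rightarrow> ('b \<Rightarrow> real) \<Rightarrow> real" where
  "blowup_density F B x =
     (THE L. \<forall>V :: nat \<Rightarrow> 'b \<Rightarrow> nat set.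
        (\<forall>n. blowup_parts B (V n)) \<longrightarrow>
        (\<forall>i \<in> verts B. (\<lambda>n. real (card (V n i)) / real n) \<longlonglongrightarrow> x i) \<longrightarrow>
        (\<lambda>n. induced_density F (blowup B (V n))) \<longlonglongrightarrow> L)"

definition density_maximiser :: "'a pattern \<Rightarrow> 'b pattern \<Rightarrow> ('b \<Rightarrow> real) \<Rightarrow> bool" where
  "density_maximiser F B x \<longleftrightarrow> x \<in> std_simplex (verts B) \<and>
     (\<forall>y \<in> std_simplex (verts B). blowup_density F B y \<le> blowup_density F B x)"

definition edit_distance :: "nat pattern \<Rightarrow> 'a pattern \<Rightarrow> nat" where
  "edit_distance G B =
     (LEAST d. \<exists>H. is_graph H \<and> verts H = verts G \<and> (\<exists>H' \<in> blowups B. isomorphic H H') \<and>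
        d = card ((edges G - edges H) \<union> (edges H - edges G)))"

definition perfectly_stable :: "'a pattern \<Rightarrow> 'b pattern \<Rightarrow> bool" where
  "perfectly_stable F B \<longleftrightarrow>
     (\<exists>C > 0. \<forall>G :: nat pattern. is_graph G \<longrightarrow> C \<le> real (card (verts G)) \<longrightarrow>
        real (edit_distance G B) \<le>
          C * (max_density F (card (verts G)) - induced_density F G) * (real (card (verts G)))\<^sup>2)"

definition F12 :: "nat pattern" where
  "F12 = ({0..<6}, {{0, 2}, {0, 3}, {0, 4}, {1, 5}})"

definition B12 :: "nat pattern" where
  "B12 = ({0..<3}, {{0, 0}, {1, 2}})"

end

theory Submission
  imports Defs "HOL-Combinatorics.Multiset_Permutations"
begin

text \<open>
  The graph \<open>F12\<close> is the disjoint union of a star with three leaves and an edge. A blowup of \<open>B12\<close>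
  is the disjoint union of a clique (part 0) and a complete bipartite graph (parts 1 and 2), and its
  copies of \<open>F12\<close> take two vertices from the clique, one from one side of the bipartite graph and
  three from the other. So there are about \<open>f n^6\<close> of them with \<open>f = x^2 b c (b^2 + c^2) / 12\<close>,
  where \<open>x\<close>, \<open>b\<close>, \<open>c\<close> are the relative sizes of the parts. As
  \<open>8 b c (b^2 + c^2) = (b + c)^4 - (b - c)^4\<close>, this is largest for \<open>x = b = c = 1/3\<close> only, with
  value \<open>1/4374 = 40/(243 * 720)\<close> (\<open>simplex_bound\<close>).

  The upper bound is a flag algebra computation. Fix an ordered pair of roots in a graph \<open>G\<close> and
  count, with integer weights, the pairs of further vertices according to their adjacencies to the
  roots and to each other. The square of this count is nonnegative, and so is any positive
  combination of such squares, added up over all roots. Up to terms with repeated vertices, the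
  result is a sum over six-vertex subsets, and the weights are chosen so that each copy of \<open>F12\<close>
  contributes at most \<open>40/243 - 1\<close>, and every other subset at most \<open>40/243\<close>, in suitable units
  (\<open>config_sum_list_bound\<close>, \<open>config_sum_list_copy\<close>). This last claim is a finite computation: every
  graph on five vertices is isomorphic to one of 34 representatives, and all one-vertex extensions
  of these are evaluated. Subsets that do not induce a blowup of \<open>B12\<close> turn out to have some slack,
  so that \<open>flag_bound\<close> not only bounds the number of copies but also says that in a nearly optimal
  graph almost all six-vertex subsets induce blowups.

  Stability starts from this slack. A copy of \<open>F12\<close> contains a path on three vertices together with
  an isolated vertex, and these four vertices can be labelled by the vertices of \<open>B12\<close> in
  essentially one way. If adding two vertices \<open>a\<close>, \<open>b\<close> always gave a blowup, the adjacencies to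
  these four vertices would determine a partition into three parts that explains all adjacencies.
  Averaging over the choice of the four vertices gives a partition with few pairs of the wrong
  adjacency (\<open>exists_close_labelling\<close>), and then the optimisation above forces the parts to have
  sizes close to \<open>n/3\<close>.

  Take a partition with the least number of wrong pairs. A vertex on many wrong pairs would be on
  many wrong pairs whichever part it were moved to. It is therefore on noticeably fewer copies than
  the \<open>n^5/729\<close> or so that pass through a vertex of the blowup (\<open>vertex_form_gap\<close>), so making all
  its adjacencies right gains a multiple of \<open>n^5\<close> copies. Once these vertices are repaired, each
  remaining wrong pair is expensive: the blowup has a multiple of \<open>n^4\<close> copies through it, and all
  of them are lost, because no labelling of \<open>F12\<close> by the vertices of \<open>B12\<close> misses exactly one
  adjacency (\<open>is_copy_vs_labelling\<close>). By the same token a copy that is no copy in the blowup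
  contains two wrong pairs, and there are few such sets as no vertex is on many wrong pairs.
  Altogether the number of copies falls short of that in the blowup by a multiple of the number of
  wrong pairs times \<open>n^4\<close> (\<open>wrong_pairs_le_deficit\<close>), which is perfect stability.
\<close>

section \<open>A certificate made of sums of squares\<close>

text \<open>
  The position of an unordered pair of vertices relative to two unordered roots. The digits count
  the roots adjacent to each of the two vertices; if both see one root, it may be the same root or
  not.
\<close>

datatype shape = S00 | S01 | S02 | S11s | S11o | S12 | S22

text \<open>
  Here and below, \<open>p0\<close>, \<open>p1\<close> tell whether the first vertex of a pair is adjacent to the first and
  the second root, and \<open>q0\<close>, \<open>q1\<close> do the same for the second vertex.
\<close>

definition root_shape :: "bool \<Rightarrow> bool \<Rightarrow> bool \<Rightarrow> bool \<Rightarrow> shape" where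
  "root_shape p0 p1 q0 q1 =
     (if p0 = p1 then
        if q0 = q1 then if p0 = q0 then if p0 then S22 else S00 else S02
        else if p0 then S12 else S01
      else if q0 = q1 then if q0 then S12 else S01
      else if p0 = q0 then S11s else S11o)"

text \<open>
  Exchanging the two roots changes only the pairs of the shapes \<open>S01\<close>, \<open>S11s\<close> and \<open>S12\<close>, and this
  bit tells the two versions of such a pair apart.
\<close>

definition orientation :: "bool \<Rightarrow> bool \<Rightarrow> bool \<Rightarrow> bool \<Rightarrow> bool" where
  "orientation p0 p1 q0 q1 \<longleftrightarrow> (if p0 = p1 then q1 else p1)"

text \<open>
  The certificate. There is one family of squares for adjacent and one for non-adjacent roots, and
  each family splits into vectors that are invariant under exchanging the roots and vectors that
  change sign. The Boolean argument says whether the two vertices of the pair are adjacent; the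
  entry at position \<open>k\<close> of a list is the coefficient of such a pair in the \<open>k\<close>-th vector. The
  numbers come from a semidefinite program. Since the bound is attained by balanced blowups of
  \<open>B12\<close>, every square must vanish on them in the limit; the vectors are small integer vectors in the
  orthogonal complement of the profiles that occur there.
\<close>

fun sym_nonedge :: "shape \<Rightarrow> bool \<Rightarrow> int list" where
  "sym_nonedge S00 False = [-2, 6, 6, 2, 0, 0, 0, 0]" |
  "sym_nonedge S00 True = [-6, -38, -22, 8, 0, -1, 0, 0]" |
  "sym_nonedge S01 False = [2, 0, 13, 4, 2, 0, 1, 3]" |
  "sym_nonedge S01 True = [-4, -6, -21, -4, -3, 0, -1, -5]" |
  "sym_nonedge S02 False = [0, -4, -8, 0, 0, 1, 0, 0]" |
  "sym_nonedge S02 True = [8, 6, 0, -9, 0, 0, 0, 0]" |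
  "sym_nonedge S11s False = [-10, -4, 14, 16, 2, 0, 1, 2]" |
  "sym_nonedge S11s True = [-4, -10, -14, 2, 0, 0, -1, 0]" |
  "sym_nonedge S11o False = [10, 10, 5, -10, 0, 0, 0, 1]" |
  "sym_nonedge S11o True = [-1, -1, -1, 1, 0, 0, 0, 0]" |
  "sym_nonedge S12 False = [-2, 1, 4, 4, 1, 0, 0, 0]" |
  "sym_nonedge S12 True = [0, -4, -6, -1, 0, 0, 0, 0]" |
  "sym_nonedge S22 False = [-4, 16, 20, 4, 0, -1, 0, 0]" |
  "sym_nonedge S22 True = [-2, -10, -10, 6, 0, 0, 0, 0]"

fun sym_edge :: "shape \<Rightarrow> bool \<Rightarrow> int list" where
  "sym_edge S00 False = [13, -21, -13, -4, 2, 4, 1]" |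
  "sym_edge S00 True = [-30, 4, 26, -12, -2, -4, -2]" |
  "sym_edge S01 False = [5, -1, -4, 2, 0, 0, 0]" |
  "sym_edge S01 True = [-1, -4, 3, 1, 0, 0, 0]" |
  "sym_edge S02 False = [9, 10, -7, 10, 0, 0, 0]" |
  "sym_edge S02 True = [-2, 8, 10, 3, 0, 0, 0]" |
  "sym_edge S11s False = [10, -9, -9, 2, 1, 1, 1]" |
  "sym_edge S11s True = [1, 0, 0, -2, 1, 0, 0]" |
  "sym_edge S11o False = [1, 8, 3, 0, 0, 0, 0]" |
  "sym_edge S11o True = [-5, 9, 4, 0, 0, 1, 0]" |
  "sym_edge S12 False = [-5, 1, 6, -4, 0, 0, 0]" |
  "sym_edge S12 True = [-6, 3, 8, -2, 0, 0, 0]" |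
  "sym_edge S22 False = [-7, -9, 4, -3, 0, 0, 0]" |
  "sym_edge S22 True = [-2, -6, 2, -8, 0, 0, 2]"

fun anti_nonedge :: "shape \<Rightarrow> bool \<Rightarrow> int list" where
  "anti_nonedge S01 False = [4, 6]" |
  "anti_nonedge S01 True = [3, 6]" |
  "anti_nonedge S11s False = [-4, -6]" |
  "anti_nonedge S11s True = [-6, -6]" |
  "anti_nonedge S12 False = [5, 5]" |
  "anti_nonedge S12 True = [2, 5]" |
  "anti_nonedge _ _ = [0, 0]"

fun anti_edge :: "shape \<Rightarrow> bool \<Rightarrow> int list" where
  "anti_edge S01 False = [4]" |
  "anti_edge S01 True = [10]" |
  "anti_edge S11s False = [-4]" |
  "anti_edge S11s True = [-1]" |
  "anti_edge S12 False = [-2]" |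
  "anti_edge S12 True = [-8]" |
  "anti_edge _ _ = [0]"

fun sym_weights :: "bool \<Rightarrow> int list" where
  "sym_weights False = [1703, 216, 73, 216, 594, 2576, 924, 83]" |
  "sym_weights True = [590, 318, 110, 58, 914, 52, 30]"

fun anti_weights :: "bool \<Rightarrow> int list" where
  "anti_weights False = [1384, 312]" |
  "anti_weights True = [379]"

fun weighted_dot :: "int list \<Rightarrow> int list \<Rightarrow> int list \<Rightarrow> int" where
  "weighted_dot (w # ws) (x # xs) (y # ys) = w * x * y + weighted_dot ws xs ys" |
  "weighted_dot _ _ _ = 0"

definition sym_vec :: "bool \<Rightarrow> bool \<Rightarrow> bool \<Rightarrow> bool \<Rightarrow> bool \<Rightarrow> bool \<Rightarrow> int list" where
  "sym_vec e p0 p1 q0 q1 f =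
     (if e then sym_edge (root_shape p0 p1 q0 q1) f else sym_nonedge (root_shape p0 p1 q0 q1) f)"

definition anti_vec :: "bool \<Rightarrow> bool \<Rightarrow> bool \<Rightarrow> bool \<Rightarrow> bool \<Rightarrow> bool \<Rightarrow> int list" where
  "anti_vec e p0 p1 q0 q1 f =
     (let v = if e then anti_edge (root_shape p0 p1 q0 q1) f else anti_nonedge (root_shape p0 p1 q0 q1) f
      in if orientation p0 p1 q0 q1 then v else map uminus v)"

text \<open>
  The value of the quadratic forms on two pairs with common roots. The first argument is the
  adjacency of the roots, then follow the adjacencies of the first pair to the roots and to each
  other, then those of the second pair.
\<close>

definition config_form :: "bool \<Rightarrow> bool \<Rightarrow> bool \<Rightarrow> bool \<Rightarrow> bool \<Rightarrow> bool \<Rightarrow> bool \<Rightarrow> bool \<Rightarrow> bool \<Rightarrow> bool \<Rightarrow> bool \<Rightarrow> int"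
  where "config_form e p0 p1 q0 q1 f r0 r1 s0 s1 h =
    weighted_dot (sym_weights e) (sym_vec e p0 p1 q0 q1 f) (sym_vec e r0 r1 s0 s1 h) +
    weighted_dot (anti_weights e) (anti_vec e p0 p1 q0 q1 f) (anti_vec e r0 r1 s0 s1 h)"

definition config :: "('a \<Rightarrow> 'a \<Rightarrow> bool) \<Rightarrow> 'a \<Rightarrow> 'a \<Rightarrow> 'a \<Rightarrow> 'a \<Rightarrow> 'a \<Rightarrow> 'a \<Rightarrow> int" where
  "config E x y a b c d =
     config_form (E x y) (E x a) (E y a) (E x b) (E y b) (E a b) (E x c) (E y c) (E x d) (E y d) (E c d)"

lemma weighted_dot_uminus [simp]: "weighted_dot ws (map uminus xs) (map uminus ys) = weighted_dot ws xs ys"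
  by (induction ws xs ys rule: weighted_dot.induct) auto

lemma weighted_dot_commute: "weighted_dot ws xs ys = weighted_dot ws ys xs"
  by (induction ws xs ys rule: weighted_dot.induct) auto

lemma shape_swap_roots: "root_shape p1 p0 q1 q0 = root_shape p0 p1 q0 q1"
  by (auto simp: root_shape_def)

lemma shape_swap_pair: "root_shape q0 q1 p0 p1 = root_shape p0 p1 q0 q1"
  by (auto simp: root_shape_def)

lemma sym_vec_swap:
  "sym_vec e p1 p0 q1 q0 f = sym_vec e p0 p1 q0 q1 f"
  "sym_vec e q0 q1 p0 p1 f = sym_vec e p0 p1 q0 q1 f"
  by (simp_all only: sym_vec_def shape_swap_roots[of p1 p0] shape_swap_pair[of q0 q1])

lemma uminus_uminus_list [simp]: "map (uminus \<circ> uminus) (xs :: int list) = xs"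
  by (induction xs) auto

lemma anti_vec_swap_roots: "anti_vec e p1 p0 q1 q0 f = map uminus (anti_vec e p0 p1 q0 q1 f)"
  by (cases e; cases f; cases p0; cases p1; cases q0; cases q1)
     (simp_all add: anti_vec_def orientation_def root_shape_def)

lemma anti_vec_swap_pair: "anti_vec e q0 q1 p0 p1 f = anti_vec e p0 p1 q0 q1 f"
  by (cases e; cases f; cases p0; cases p1; cases q0; cases q1)
     (simp_all add: anti_vec_def orientation_def root_shape_def)

text \<open>
  The terms of the form do not depend on how the roots, the two pairs, and the vertices of a pair
  are ordered. So the 720 orders of six vertices give only 45 different terms.
\<close>

context
  fixes E :: "'a \<Rightarrow> 'a \<Rightarrow> bool"
  assumes sym: "\<And>x y. E x y = E y x"
begin

lemma config_swap_roots: "config E y x a b c d = config E x y a b c d"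
  unfolding config_def config_form_def
  by (simp add: sym[of y x] sym_vec_swap(1)[of _ "E x a" "E y a"] sym_vec_swap(1)[of _ "E x c" "E y c"]
      anti_vec_swap_roots[of _ "E x a" "E y a"] anti_vec_swap_roots[of _ "E x c" "E y c"])

lemma config_swap_fst: "config E x y b a c d = config E x y a b c d"
  unfolding config_def config_form_def
  by (simp add: sym[of b a] sym_vec_swap(2)[of _ "E x b"] anti_vec_swap_pair[of _ "E x b"])

lemma config_swap_snd: "config E x y a b d c = config E x y a b c d"
  unfolding config_def config_form_def
  by (simp add: sym[of d c] sym_vec_swap(2)[of _ "E x d"] anti_vec_swap_pair[of _ "E x d"])

lemma config_swap_pairs: "config E x y c d a b = config E x y a b c d"
  unfolding config_def config_form_def by (simp add: weighted_dot_commute)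

end

text \<open>
  The sum over the 45 ways to choose two roots among six vertices and to split the others into two
  pairs.
\<close>

definition config_sum :: "('a \<Rightarrow> 'a \<Rightarrow> bool) \<Rightarrow> 'a \<Rightarrow> 'a \<Rightarrow> 'a \<Rightarrow> 'a \<Rightarrow> 'a \<Rightarrow> 'a \<Rightarrow> int" where
  "config_sum E a b c d e f =
     config E a b c d e f +
     config E a b c e d f +
     config E a b c f d e +
     config E a c b d e f +
     config E a c b e d f +
     config E a c b f d e +
     config E a d b c e f +
     config E a d b e c f +
     config E a d b f c e +
     config E a e b c d f +
     config E a e b d c f +
     config E a e b f c d +
     config E a f b c d e +
     config E a f b d c e +
     config E a f b e c d +
     config E b c a d e f +
     config E b c a e d f +
     config E b c a f d e +
     config E b d a c e f +
     config E b d a e c f +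
     config E b d a f c e +
     config E b e a c d f +
     config E b e a d c f +
     config E b e a f c d +
     config E b f a c d e +
     config E b f a d c e +
     config E b f a e c d +
     config E c d a b e f +
     config E c d a e b f +
     config E c d a f b e +
     config E c e a b d f +
     config E c e a d b f +
     config E c e a f b d +
     config E c f a b d e +
     config E c f a d b e +
     config E c f a e b d +
     config E d e a b c f +
     config E d e a c b f +
     config E d e a f b c +
     config E d f a b c e +
     config E d f a c b e +
     config E d f a e b c +
     config E e f a b c d +
     config E e f a c b d +
     config E e f a d b c"

lemma config_sum_swaps:
  assumes sym: "\<And>x y. E x y = E y x"
  shows "config_sum E b a c d e f = config_sum E a b c d e f"
    "config_sum E a c b d e f = config_sum E a b c d e f"
    "config_sum E a b d c e f = config_sum E a b c d e f"
    "config_sum E a b c e d f = config_sum E a b c d e f"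
    "config_sum E a b c d f e = config_sum E a b c d e f"
  unfolding config_sum_def
  by (simp_all only: config_swap_roots[of E, OF sym] config_swap_fst[of E, OF sym] config_swap_snd[of E, OF sym]
      config_swap_pairs[of E, OF sym] add.commute add.assoc add.left_commute)

section \<open>Checking the certificate on all graphs with six vertices\<close>

text \<open>
  A graph on a list of vertices is written as the list of rows below the diagonal of its adjacency
  matrix, so that it can be evaluated.
\<close>

fun rows_from :: "('a \<Rightarrow> 'a \<Rightarrow> bool) \<Rightarrow> 'a list \<Rightarrow> 'a list \<Rightarrow> bool list list" where
  "rows_from E us [] = []" |
  "rows_from E us (y # ys) = map (\<lambda>u. E u y) us # rows_from E (us @ [y]) ys"

definition rows :: "('a \<Rightarrow> 'a \<Rightarrow> bool) \<Rightarrow> 'a list \<Rightarrow> bool list list" where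
  "rows E xs = (case xs of [] \<Rightarrow> [] | x # xs' \<Rightarrow> rows_from E [x] xs')"

definition config_total :: "bool list list \<Rightarrow> int" where
  "config_total rs = (case rs of
       [[b01], [b02, b12], [b03, b13, b23], [b04, b14, b24, b34], [b05, b15, b25, b35, b45]] \<Rightarrow>
         config_form b01 b02 b12 b03 b13 b23 b04 b14 b05 b15 b45 +
         config_form b01 b02 b12 b04 b14 b24 b03 b13 b05 b15 b35 +
         config_form b01 b02 b12 b05 b15 b25 b03 b13 b04 b14 b34 +
         config_form b02 b01 b12 b03 b23 b13 b04 b24 b05 b25 b45 +
         config_form b02 b01 b12 b04 b24 b14 b03 b23 b05 b25 b35 +
         config_form b02 b01 b12 b05 b25 b15 b03 b23 b04 b24 b34 +
         config_form b03 b01 b13 b02 b23 b12 b04 b34 b05 b35 b45 +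
         config_form b03 b01 b13 b04 b34 b14 b02 b23 b05 b35 b25 +
         config_form b03 b01 b13 b05 b35 b15 b02 b23 b04 b34 b24 +
         config_form b04 b01 b14 b02 b24 b12 b03 b34 b05 b45 b35 +
         config_form b04 b01 b14 b03 b34 b13 b02 b24 b05 b45 b25 +
         config_form b04 b01 b14 b05 b45 b15 b02 b24 b03 b34 b23 +
         config_form b05 b01 b15 b02 b25 b12 b03 b35 b04 b45 b34 +
         config_form b05 b01 b15 b03 b35 b13 b02 b25 b04 b45 b24 +
         config_form b05 b01 b15 b04 b45 b14 b02 b25 b03 b35 b23 +
         config_form b12 b01 b02 b13 b23 b03 b14 b24 b15 b25 b45 +
         config_form b12 b01 b02 b14 b24 b04 b13 b23 b15 b25 b35 +
         config_form b12 b01 b02 b15 b25 b05 b13 b23 b14 b24 b34 +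
         config_form b13 b01 b03 b12 b23 b02 b14 b34 b15 b35 b45 +
         config_form b13 b01 b03 b14 b34 b04 b12 b23 b15 b35 b25 +
         config_form b13 b01 b03 b15 b35 b05 b12 b23 b14 b34 b24 +
         config_form b14 b01 b04 b12 b24 b02 b13 b34 b15 b45 b35 +
         config_form b14 b01 b04 b13 b34 b03 b12 b24 b15 b45 b25 +
         config_form b14 b01 b04 b15 b45 b05 b12 b24 b13 b34 b23 +
         config_form b15 b01 b05 b12 b25 b02 b13 b35 b14 b45 b34 +
         config_form b15 b01 b05 b13 b35 b03 b12 b25 b14 b45 b24 +
         config_form b15 b01 b05 b14 b45 b04 b12 b25 b13 b35 b23 +
         config_form b23 b02 b03 b12 b13 b01 b24 b34 b25 b35 b45 +
         config_form b23 b02 b03 b24 b34 b04 b12 b13 b25 b35 b15 +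
         config_form b23 b02 b03 b25 b35 b05 b12 b13 b24 b34 b14 +
         config_form b24 b02 b04 b12 b14 b01 b23 b34 b25 b45 b35 +
         config_form b24 b02 b04 b23 b34 b03 b12 b14 b25 b45 b15 +
         config_form b24 b02 b04 b25 b45 b05 b12 b14 b23 b34 b13 +
         config_form b25 b02 b05 b12 b15 b01 b23 b35 b24 b45 b34 +
         config_form b25 b02 b05 b23 b35 b03 b12 b15 b24 b45 b14 +
         config_form b25 b02 b05 b24 b45 b04 b12 b15 b23 b35 b13 +
         config_form b34 b03 b04 b13 b14 b01 b23 b24 b35 b45 b25 +
         config_form b34 b03 b04 b23 b24 b02 b13 b14 b35 b45 b15 +
         config_form b34 b03 b04 b35 b45 b05 b13 b14 b23 b24 b12 +
         config_form b35 b03 b05 b13 b15 b01 b23 b25 b34 b45 b24 +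
         config_form b35 b03 b05 b23 b25 b02 b13 b15 b34 b45 b14 +
         config_form b35 b03 b05 b34 b45 b04 b13 b15 b23 b25 b12 +
         config_form b45 b04 b05 b14 b15 b01 b24 b25 b34 b35 b23 +
         config_form b45 b04 b05 b24 b25 b02 b14 b15 b34 b35 b13 +
         config_form b45 b04 b05 b34 b35 b03 b14 b15 b24 b25 b12
     | _ \<Rightarrow> 0)"

lemma config_sum_eq_total:
  assumes sym: "\<And>x y. E x y = E y x"
  shows "config_sum E a b c d e f = config_total (rows E [a, b, c, d, e, f])"
  unfolding config_sum_def config_def config_total_def rows_def
  by (simp only: rows_from.simps list.case list.map append.simps
      sym[of b a] sym[of c a] sym[of c b] sym[of d a] sym[of d b] sym[of d c]
      sym[of e a] sym[of e b] sym[of e c] sym[of e d]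
      sym[of f a] sym[of f b] sym[of f c] sym[of f d] sym[of f e])

definition B12_adj :: "nat \<Rightarrow> nat \<Rightarrow> bool" where
  "B12_adj i j \<longleftrightarrow> i = 0 \<and> j = 0 \<or> i = 1 \<and> j = 2 \<or> i = 2 \<and> j = 1"

text \<open>
  Can a labelling \<open>ls\<close> of the first vertices be extended to the vertices that belong to the given
  rows, such that the adjacencies are those of a blowup?
\<close>

fun extends :: "nat list \<Rightarrow> bool list list \<Rightarrow> bool" where
  "extends ls [] = True" |
  "extends ls (r # rs) =
     list_ex (\<lambda>l. list_all2 (\<lambda>k b. b = B12_adj k l) ls r \<and> extends (ls @ [l]) rs) [0, 1, 2]"

text \<open>
  The number 813600 is \<open>40/243\<close> in the units of the certificate. Being at most 813599 means that
  there is some slack; only blowups may do without.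
\<close>

definition within_bound :: "int \<Rightarrow> bool list list \<Rightarrow> bool" where
  "within_bound t rs \<longleftrightarrow>
     t \<le> 813599 \<or> t \<le> 813600 \<and> list_ex (\<lambda>l. extends [l] rs) [0, 1, 2]"

fun bool_lists :: "nat \<Rightarrow> bool list list" where
  "bool_lists 0 = [[]]" |
  "bool_lists (Suc n) = map ((#) False) (bool_lists n) @ map ((#) True) (bool_lists n)"

definition one_vertex_extensions :: "nat \<Rightarrow> bool list list list \<Rightarrow> bool list list list" where
  "one_vertex_extensions n rss = concat (map (\<lambda>rs. map (\<lambda>r. rs @ [r]) (bool_lists n)) rss)"

text \<open>
  The graphs on four and on five vertices up to isomorphism.
\<close>

definition reps4 :: "bool list list list" where
  "reps4 =
    [[[False], [False, False], [False, False, False]],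
     [[True], [False, False], [False, False, False]],
     [[True], [True, False], [False, False, False]],
     [[True], [True, False], [True, False, False]],
     [[True], [True, True], [False, False, False]],
     [[False], [False, True], [True, False, False]],
     [[True], [False, True], [True, False, False]],
     [[True], [True, True], [True, False, False]],
     [[False], [True, True], [True, True, False]],
     [[True], [True, True], [True, True, False]],
     [[True], [True, True], [True, True, True]]]"

definition reps5 :: "bool list list list" where
  "reps5 =
    [[[False], [False, False], [False, False, False], [False, False, False, False]],
     [[True], [False, False], [False, False, False], [False, False, False, False]],
     [[True], [True, False], [False, False, False], [False, False, False, False]],
     [[True], [True, False], [True, False, False], [False, False, False, False]],
     [[True], [True, False], [True, False, False], [True, False, False, False]],
     [[True], [True, True], [False, False, False], [False, False, False, False]],
     [[False], [False, True], [True, False, False], [False, False, False, False]],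
     [[True], [False, True], [True, False, False], [False, False, False, False]],
     [[True], [True, True], [True, False, False], [False, False, False, False]],
     [[False], [False, True], [True, False, False], [True, False, False, False]],
     [[True], [False, True], [True, False, False], [True, False, False, False]],
     [[True], [True, True], [True, False, False], [True, False, False, False]],
     [[False], [True, True], [True, True, False], [False, False, False, False]],
     [[True], [True, True], [True, True, False], [False, False, False, False]],
     [[False], [True, True], [False, True, False], [True, False, False, False]],
     [[True], [True, True], [False, True, False], [True, False, False, False]],
     [[False], [True, True], [True, True, False], [True, False, False, False]],
     [[True], [True, True], [True, True, False], [True, False, False, False]],
     [[False], [True, True], [True, True, False], [True, True, False, False]],
     [[True], [True, True], [True, True, False], [True, True, False, False]],
     [[True], [True, True], [True, True, True], [False, False, False, False]],
     [[False], [False, True], [False, True, True], [True, False, False, False]],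
     [[True], [False, True], [False, True, True], [True, False, False, False]],
     [[True], [True, True], [False, True, True], [True, False, False, False]],
     [[True], [True, True], [True, True, True], [True, False, False, False]],
     [[True], [True, False], [True, False, True], [True, True, False, False]],
     [[False], [False, True], [True, False, True], [True, True, False, False]],
     [[True], [False, True], [True, False, True], [True, True, False, False]],
     [[True], [True, True], [True, False, True], [True, True, False, False]],
     [[False], [True, True], [True, True, True], [True, True, False, False]],
     [[True], [True, True], [True, True, True], [True, True, False, False]],
     [[True], [True, False], [True, True, True], [True, True, True, False]],
     [[True], [True, True], [True, True, True], [True, True, True, False]],
     [[True], [True, True], [True, True, True], [True, True, True, True]]]"

text \<open>
  To avoid evaluating the form for all \<open>2^15\<close> graphs on six labelled vertices, only extensions of
  representatives are considered. For each graph that arises by adding a vertex to a three-vertex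
  graph or to one of \<open>reps4\<close>, an order of the vertices is given that turns it into a representative.
\<close>

definition relabellings4 :: "nat list list" where
  "relabellings4 =
    [[0,1,2,3], [2,3,0,1], [1,3,0,2], [3,1,2,0], [0,3,1,2], [3,0,2,1], [3,0,1,2], [3,0,1,2], [1,2,0,3], [2,1,3,0],
     [1,2,3,0], [1,2,3,0], [0,1,2,3], [2,3,0,1], [1,3,0,2], [3,1,2,0], [0,2,1,3], [2,0,3,1], [0,1,3,2], [2,3,1,0],
     [0,2,3,1], [0,2,3,1], [0,3,1,2], [3,0,2,1], [2,0,1,3], [2,0,1,3], [1,2,0,3], [2,1,3,0], [0,2,1,3], [2,0,3,1],
     [0,1,2,3], [2,3,0,1], [0,1,2,3], [0,2,3,1], [1,0,3,2], [1,3,2,0], [0,1,3,2], [0,3,2,1], [0,1,3,2], [3,0,1,2],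
     [1,0,2,3], [1,2,3,0], [1,0,2,3], [1,2,3,0], [0,1,2,3], [0,2,1,3], [1,0,3,2], [1,3,0,2], [0,1,2,3], [0,2,3,1],
     [0,1,3,2], [0,3,1,2], [0,1,2,3], [0,2,3,1], [0,1,3,2], [0,3,1,2], [0,1,2,3], [2,0,1,3], [1,0,2,3], [1,2,0,3],
     [0,1,2,3], [0,2,1,3], [0,1,2,3], [0,1,2,3]]"

definition relabellings5 :: "nat list list" where
  "relabellings5 =
    [[0,1,2,3,4], [3,4,0,1,2], [2,4,0,1,3], [4,2,3,0,1], [1,4,0,2,3], [4,1,3,0,2], [4,1,2,0,3], [4,1,2,3,0], [0,4,1,2,3],
     [4,0,3,1,2], [4,0,2,1,3], [4,0,2,3,1], [4,0,1,2,3], [4,0,1,3,2], [4,0,1,2,3], [4,0,1,2,3], [0,1,2,3,4], [0,3,4,1,2],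
     [0,2,4,1,3], [4,0,1,2,3], [1,0,4,2,3], [1,4,3,0,2], [1,4,2,0,3], [4,1,0,2,3], [0,1,4,2,3], [0,4,3,1,2], [0,4,2,1,3],
     [4,0,1,2,3], [0,1,4,2,3], [4,0,1,3,2], [4,0,1,2,3], [4,0,1,2,3], [0,1,2,3,4], [0,3,4,1,2], [0,2,4,1,3], [0,4,2,3,1],
     [0,1,4,2,3], [0,4,1,3,2], [0,4,1,2,3], [4,0,1,2,3], [0,1,2,4,3], [0,4,3,1,2], [0,2,4,1,3], [0,4,2,3,1], [0,1,4,2,3],
     [0,4,1,3,2], [0,4,1,2,3], [4,0,1,2,3], [0,1,2,3,4], [0,3,4,1,2], [0,2,4,1,3], [0,4,2,3,1], [0,1,4,2,3], [0,4,1,3,2],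
     [0,4,1,2,3], [0,4,1,2,3], [0,1,2,3,4], [0,3,4,1,2], [0,2,4,1,3], [0,4,2,3,1], [0,1,4,2,3], [0,4,1,3,2], [0,4,1,2,3],
     [0,4,1,2,3], [0,1,2,3,4], [3,0,1,2,4], [2,0,1,4,3], [4,2,0,1,3], [1,0,2,4,3], [4,1,0,2,3], [1,2,0,4,3], [4,1,2,0,3],
     [0,1,2,4,3], [4,0,1,2,3], [0,2,1,4,3], [4,0,2,1,3], [0,1,2,4,3], [4,0,1,2,3], [0,1,2,4,3], [4,0,1,2,3], [0,1,2,3,4],
     [3,1,2,0,4], [2,0,3,1,4], [2,3,4,0,1], [1,0,3,2,4], [1,3,4,0,2], [0,1,2,4,3], [3,4,1,2,0], [0,1,2,3,4], [1,0,3,4,2],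
     [0,2,4,1,3], [2,4,0,3,1], [0,1,4,2,3], [1,4,0,3,2], [0,4,1,2,3], [4,0,1,2,3], [0,1,2,3,4], [1,3,0,4,2], [0,2,1,4,3],
     [0,2,4,3,1], [1,0,3,2,4], [1,3,0,4,2], [0,1,2,4,3], [1,4,3,0,2], [0,1,2,3,4], [1,0,3,4,2], [0,2,1,4,3], [0,4,2,1,3],
     [0,1,4,2,3], [1,0,4,3,2], [0,1,4,2,3], [4,0,1,2,3], [0,1,2,3,4], [3,0,1,2,4], [0,2,1,4,3], [0,2,4,3,1], [0,1,2,4,3],
     [0,1,4,3,2], [0,1,2,4,3], [0,4,1,2,3], [0,1,2,3,4], [0,1,3,4,2], [0,2,1,4,3], [0,2,4,3,1], [0,1,2,4,3], [0,1,4,3,2],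
     [0,1,2,4,3], [0,4,1,2,3], [0,1,2,3,4], [3,2,0,1,4], [2,3,0,1,4], [2,3,0,1,4], [1,0,2,3,4], [1,3,0,2,4], [1,2,0,3,4],
     [2,3,1,4,0], [0,1,2,3,4], [0,3,1,2,4], [0,2,1,3,4], [2,3,0,4,1], [0,1,2,3,4], [0,1,3,4,2], [0,1,2,4,3], [4,0,1,2,3],
     [0,1,2,3,4], [3,0,1,2,4], [2,0,1,3,4], [2,3,0,1,4], [1,0,2,3,4], [1,0,3,4,2], [1,0,2,4,3], [1,0,4,2,3], [0,1,2,3,4],
     [0,1,3,4,2], [0,1,2,4,3], [0,1,4,2,3], [0,1,2,3,4], [0,1,3,4,2], [0,1,2,4,3], [0,1,4,2,3], [0,1,2,3,4], [3,0,1,2,4],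
     [2,0,1,3,4], [2,3,0,1,4], [1,0,2,3,4], [1,3,0,2,4], [1,2,0,3,4], [1,2,3,0,4], [0,1,2,3,4], [0,3,1,2,4], [0,2,1,3,4],
     [0,2,3,1,4], [0,1,2,3,4], [0,1,3,2,4], [0,1,2,3,4], [0,1,2,3,4]]"

definition rows_adj :: "bool list list \<Rightarrow> nat \<Rightarrow> nat \<Rightarrow> bool" where
  "rows_adj rs i j = (if i < j then rs ! (j - 1) ! i else rs ! (i - 1) ! j)"

definition relabels_into :: "nat \<Rightarrow> bool list list list \<Rightarrow> bool list list \<Rightarrow> nat list \<Rightarrow> bool" where
  "relabels_into n reps rs p \<longleftrightarrow>
     length p = n \<and> distinct p \<and> list_all (\<lambda>i. i < n) p \<and> rows (rows_adj rs) p \<in> set reps"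

lemma relabellings_into_reps4:
  "list_all2 (relabels_into 4 reps4)
     (one_vertex_extensions 3 (one_vertex_extensions 2 (one_vertex_extensions 1 [[]]))) relabellings4"
  by code_simp

lemma relabellings_into_reps5: "list_all2 (relabels_into 5 reps5) (one_vertex_extensions 4 reps4) relabellings5"
  by code_simp

definition extensions_within_bound :: "bool list list \<Rightarrow> bool" where
  "extensions_within_bound rs \<longleftrightarrow>
     list_all (\<lambda>r. within_bound (config_total (rs @ [r])) (rs @ [r])) (bool_lists 5)"

lemma config_total_bound_take: "list_all extensions_within_bound (take 17 reps5)"
  by code_simp

lemma config_total_bound_drop: "list_all extensions_within_bound (drop 17 reps5)"
  by code_simp

lemma config_total_bound_reps: "list_all extensions_within_bound reps5"
  using config_total_bound_take config_total_bound_drop list_all_append append_take_drop_id by metis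

lemma B12_adj_commute: "B12_adj i j = B12_adj j i"
  by (auto simp: B12_adj_def)

definition labelling :: "('a \<Rightarrow> 'a \<Rightarrow> bool) \<Rightarrow> ('a \<Rightarrow> nat) \<Rightarrow> 'a set \<Rightarrow> bool" where
  "labelling E p X \<longleftrightarrow>
     (\<forall>x\<in>X. p x < 3) \<and> (\<forall>x\<in>X. \<forall>y\<in>X. x \<noteq> y \<longrightarrow> E x y = B12_adj (p x) (p y))"

definition induces_blowup :: "('a \<Rightarrow> 'a \<Rightarrow> bool) \<Rightarrow> 'a set \<Rightarrow> bool" where
  "induces_blowup E X \<longleftrightarrow> (\<exists>p. labelling E p X)"

text \<open>
  Where the search for a labelling fails, the bound with slack is verified. So the whole check rests
  on the soundness of the search.
\<close>

lemma extends_imp_induces_blowup: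
  assumes sym: "\<And>x y. E x y = E y x"
  shows "\<lbrakk>extends (map p us) (rows_from E us ys); distinct (us @ ys); labelling E p (set us)\<rbrakk>
    \<Longrightarrow> induces_blowup E (set us \<union> set ys)"
proof (induction ys arbitrary: us p)
  case Nil
  then show ?case by (auto simp: induces_blowup_def)
next
  case (Cons y ys)
  from Cons.prems(1) obtain l where l: "l \<in> {0, 1, 2}"
    and row: "list_all2 (\<lambda>k b. b = B12_adj k l) (map p us) (map (\<lambda>u. E u y) us)"
    and ext: "extends (map p us @ [l]) (rows_from E (us @ [y]) ys)"
    by (auto simp: list_ex_iff)
  let ?p = "p(y := l)"
  have y: "y \<notin> set us" using Cons.prems(2) by auto
  have row': "\<forall>u\<in>set us. E u y = B12_adj (p u) l"
    using row by (auto simp: list_all2_conv_all_nth in_set_conv_nth)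
  have lab: "labelling E ?p (set (us @ [y]))"
    unfolding labelling_def
  proof (intro conjI ballI impI)
    fix u v assume uv: "u \<in> set (us @ [y])" "v \<in> set (us @ [y])" "u \<noteq> v"
    then consider "u \<in> set us" "v \<in> set us" | "u \<in> set us" "v = y" | "u = y" "v \<in> set us"
      by auto
    then show "E u v = B12_adj (?p u) (?p v)"
    proof cases
      case 1
      then show ?thesis using Cons.prems(3) y uv(3) by (auto simp: labelling_def)
    next
      case 2
      then show ?thesis using row' y by auto
    next
      case 3
      then have "E u v = B12_adj (p v) l" using row' sym[of y v] by simp
      then show ?thesis using 3 y B12_adj_commute[of l "p v"] by auto
    qed
  qed (use Cons.prems(3) l in \<open>auto simp: labelling_def\<close>)
  have "map ?p (us @ [y]) = map p us @ [l]" using y by auto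
  then have "extends (map ?p (us @ [y])) (rows_from E (us @ [y]) ys)" using ext by (simp only:)
  then have "induces_blowup E (set (us @ [y]) \<union> set ys)"
    by (rule Cons.IH[OF _ _ lab]) (use Cons.prems(2) in auto)
  moreover have "set (us @ [y]) \<union> set ys = set us \<union> set (y # ys)" by auto
  ultimately show ?case by (simp only:)
qed

lemma rows_from_eq:
  "rows_from E us ys =
     map (\<lambda>j. map (\<lambda>i. E ((us @ ys) ! i) ((us @ ys) ! j)) [0..<j]) [length us..<length us + length ys]"
proof (induction ys arbitrary: us)
  case (Cons y ys)
  have 1: "[length us..<length us + length (y # ys)] =
        length us # [length (us @ [y])..<length (us @ [y]) + length ys]"
    by (simp add: upt_conv_Cons del: upt_Suc)
  have 2: "map (\<lambda>i. E ((us @ y # ys) ! i) y) [0..<length us] = map (\<lambda>u. E u y) us"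
    by (rule nth_equalityI) (auto simp: nth_append)
  show ?case
    unfolding rows_from.simps Cons.IH 1 list.map by (simp add: 2 del: upt_Suc)
qed simp

lemma rows_eq:
  "rows E xs = map (\<lambda>j. map (\<lambda>i. E (xs ! i) (xs ! j)) [0..<j]) [1..<length xs]"
  by (cases xs) (simp_all add: rows_def rows_from_eq del: upt_Suc)

lemma rows_map: "rows E (map f xs) = rows (\<lambda>i j. E (f i) (f j)) xs"
  by (auto simp: rows_eq)

lemma rows_cong:
  assumes "\<And>x y. x \<in> set xs \<Longrightarrow> y \<in> set xs \<Longrightarrow> x \<noteq> y \<Longrightarrow> E x y = E' x y" "distinct xs"
  shows "rows E xs = rows E' xs"
  using assms by (auto simp: rows_eq nth_eq_iff_index_eq)

lemma rows_from_snoc: "rows_from E us (ys @ [z]) = rows_from E us ys @ [map (\<lambda>u. E u z) (us @ ys)]"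
  by (induction ys arbitrary: us) simp_all

lemma rows_snoc: "xs \<noteq> [] \<Longrightarrow> rows E (xs @ [z]) = rows E xs @ [map (\<lambda>u. E u z) xs]"
  by (cases xs) (simp_all add: rows_def rows_from_snoc)

lemma rows_adj_rows:
  assumes sym: "\<And>x y. E x y = E y x" and "i < length xs" "j < length xs" "i \<noteq> j"
  shows "rows_adj (rows E xs) i j = E (xs ! i) (xs ! j)"
  using assms(2-) sym[of "xs ! i" "xs ! j"]
  by (cases "i < j") (auto simp: rows_adj_def rows_eq)

lemma set_bool_lists: "set (bool_lists n) = {bs. length bs = n}"
proof (induction n)
  case (Suc n)
  have "{bs :: bool list. length bs = Suc n} = (#) False ` {bs. length bs = n} \<union> (#) True ` {bs. length bs = n}"
    by (auto simp: length_Suc_conv image_iff)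
  then show ?case using Suc by simp
qed auto

text \<open>
  One step from representatives on \<open>n\<close> vertices to representatives on \<open>n + 1\<close> vertices.
\<close>

lemma relabel_exists:
  assumes sym: "\<And>x y. E x y = E y x"
    and ps: "list_all2 (relabels_into (Suc n) reps') (one_vertex_extensions n reps) ps"
    and xs: "length xs = n" "n > 0" "rows E xs \<in> set reps"
  obtains ys where "mset ys = mset (xs @ [z])" "rows E ys \<in> set reps'"
proof -
  let ?xs = "xs @ [z]"
  have "rows E ?xs \<in> set (one_vertex_extensions n reps)"
    using xs by (force simp: one_vertex_extensions_def rows_snoc set_bool_lists)
  then obtain p where p: "relabels_into (Suc n) reps' (rows E ?xs) p"
    using ps by (metis in_set_conv_nth list_all2_conv_all_nth)
  define ys where "ys = map ((!) ?xs) p"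
  have p': "distinct p" "length p = Suc n" "\<forall>i\<in>set p. i < Suc n"
    using p by (auto simp: relabels_into_def list_all_iff)
  have "rows E ys = rows (\<lambda>i j. E (?xs ! i) (?xs ! j)) p" by (simp add: ys_def rows_map)
  also have "\<dots> = rows (rows_adj (rows E ?xs)) p"
    using p' xs by (intro rows_cong) (auto simp: rows_adj_rows[OF sym])
  also have "\<dots> \<in> set reps'" using p by (auto simp: relabels_into_def)
  finally have 1: "rows E ys \<in> set reps'" .
  have "set p = set [0..<Suc n]"
    using p' by (intro card_seteq) (auto simp: distinct_card simp del: upt_Suc)
  then have "mset p = mset [0..<Suc n]"
    using p'(1) set_eq_iff_mset_eq_distinct[of p "[0..<Suc n]"] by simp
  then have "mset ys = image_mset ((!) ?xs) (mset [0..<Suc n])"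
    by (simp add: ys_def)
  also have "\<dots> = mset (map ((!) ?xs) [0..<length ?xs])"
    using xs by (metis length_append_singleton mset_map)
  also have "\<dots> = mset ?xs" by (simp only: map_nth)
  finally show thesis using that 1 by blast
qed

definition config_sum_list :: "('a \<Rightarrow> 'a \<Rightarrow> bool) \<Rightarrow> 'a list \<Rightarrow> int" where
  "config_sum_list E xs = config_sum E (xs ! 0) (xs ! 1) (xs ! 2) (xs ! 3) (xs ! 4) (xs ! 5)"

lemma length6E:
  assumes "length xs = 6"
  obtains a b c d e f where "xs = [a, b, c, d, e, f]"
  using assms by (auto simp: numeral_eq_Suc length_Suc_conv)

lemma config_sum_list_eq_total:
  assumes "\<And>x y. E x y = E y x" "length xs = 6"
  shows "config_sum_list E xs = config_total (rows E xs)"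
  using assms(2) by (elim length6E) (simp add: config_sum_list_def config_sum_eq_total[of E, OF assms(1)])

lemma config_sum_list_swap:
  assumes sym: "\<And>x y. E x y = E y x" and "length (us @ x # y # vs) = 6"
  shows "config_sum_list E (us @ x # y # vs) = config_sum_list E (us @ y # x # vs)"
proof -
  obtain a b c d e f where eq: "us @ x # y # vs = [a, b, c, d, e, f]"
    using assms(2) by (elim length6E)
  then consider "us = []" | "us = [a]" | "us = [a, b]" | "us = [a, b, c]" | "us = [a, b, c, d]"
    by (auto simp: append_eq_Cons_conv Cons_eq_append_conv)
  then show ?thesis
    using eq by cases (auto simp: config_sum_list_def config_sum_swaps[of E, OF sym])
qed

text \<open>
  Adjacent transpositions generate all permutations, so invariance has to be checked for these only.
\<close>

lemma mset_invariant:
  assumes swap: "\<And>us x y vs. length (us @ x # y # vs) = n \<Longrightarrow> Q (us @ x # y # vs) = Q (us @ y # x # vs)"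
  shows "length (us @ xs) = n \<Longrightarrow> mset xs = mset ys \<Longrightarrow> Q (us @ xs) = Q (us @ ys)"
proof (induction xs arbitrary: us ys)
  case (Cons x xs)
  then have "x \<in> set ys" by (metis list.set_intros(1) mset_eq_setD)
  then obtain as bs where ys: "ys = as @ x # bs" by (meson split_list)
  have "Q (us @ as @ x # bs) = Q (us @ x # as @ bs)" if "length (us @ as @ x # bs) = n" for as bs
    using that
  proof (induction as arbitrary: bs rule: rev_induct)
    case (snoc a as)
    have "Q (us @ (as @ [a]) @ x # bs) = Q (us @ as @ x # a # bs)"
      using swap[of "us @ as" a x bs] snoc.prems by simp
    also have "\<dots> = Q (us @ x # as @ a # bs)" using snoc.IH[of "a # bs"] snoc.prems by simp
    finally show ?case by simp
  qed simp
  moreover have "length (us @ as @ x # bs) = n"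
    using Cons.prems ys by (metis length_append mset_eq_length)
  ultimately have 1: "Q (us @ ys) = Q (us @ x # as @ bs)" using ys by simp
  have "mset xs = mset (as @ bs)" using Cons.prems(2) ys by simp
  then have "Q ((us @ [x]) @ xs) = Q ((us @ [x]) @ as @ bs)"
    using Cons.prems(1) by (intro Cons.IH) auto
  then show ?case using 1 by simp
qed simp

lemma config_sum_list_mset:
  assumes "\<And>x y. E x y = E y x" "length xs = 6" "mset xs = mset ys"
  shows "config_sum_list E xs = config_sum_list E ys"
  using mset_invariant[of 6 "config_sum_list E" "[]" xs ys] config_sum_list_swap[of E] assms by simp

text \<open>
  The vertices are listed in the order of their names in \<open>F12\<close>: the centre of the star, one end of
  the isolated edge, the three leaves, the other end of the edge.
\<close>

definition F12_rows :: "bool list list" where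
  "F12_rows = [[False], [True, False], [True, False, False], [True, False, False, False],
     [False, True, False, False, False]]"

definition is_copy :: "('a \<Rightarrow> 'a \<Rightarrow> bool) \<Rightarrow> 'a set \<Rightarrow> bool" where
  "is_copy E S \<longleftrightarrow> (\<exists>xs. length xs = 6 \<and> distinct xs \<and> set xs = S \<and> rows E xs = F12_rows)"

text \<open>
  Any six vertices can be reordered, without changing the sum, such that the first five form a
  representative: first reorder four of them, then add a fifth and reorder again. All extensions of
  representatives by a sixth vertex have been checked.
\<close>

lemma config_sum_list_bound:
  assumes sym: "\<And>x y. E x y = E y x" and xs: "length xs = 6" "distinct xs"
  shows "config_sum_list E xs \<le> 813600 - of_bool (\<not> induces_blowup E (set xs))"
proof -
  obtain a b c d e f where xs_eq: "xs = [a, b, c, d, e, f]" using xs(1) by (elim length6E)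
  have r3: "rows E [a, b, c] \<in> set (one_vertex_extensions 2 (one_vertex_extensions 1 [[]]))"
    by (auto simp: rows_def one_vertex_extensions_def numeral_2_eq_2)
  obtain ys4 where ys4: "mset ys4 = mset ([a, b, c] @ [d])" "rows E ys4 \<in> set reps4"
    using relabel_exists[of E 3 reps4, OF sym _ _ _ r3] relabellings_into_reps4 by auto
  have l4: "length ys4 = 4" using mset_eq_length[OF ys4(1)] by simp
  obtain ys5 where ys5: "mset ys5 = mset (ys4 @ [e])" "rows E ys5 \<in> set reps5"
    using relabel_exists[of E 4 reps5, OF sym _ l4 _ ys4(2)] relabellings_into_reps5 by auto
  have l5: "length ys5 = 5" using mset_eq_length[OF ys5(1)] l4 by simp
  let ?zs = "ys5 @ [f]"
  have zs: "mset ?zs = mset xs" using ys5(1) ys4(1) xs_eq by simp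
  have lz: "length ?zs = 6" using l5 by simp
  have dz: "distinct ?zs" and sz: "set ?zs = set xs"
    using mset_eq_imp_distinct_iff[OF zs] mset_eq_setD[OF zs] xs(2) by simp_all
  have rz: "rows E ?zs = rows E ys5 @ [map (\<lambda>u. E u f) ys5]" using l5 by (intro rows_snoc) auto
  have "within_bound (config_total (rows E ?zs)) (rows E ?zs)"
    using config_total_bound_reps ys5(2) l5 unfolding rz extensions_within_bound_def list_all_iff set_bool_lists by auto
  moreover have "config_sum_list E xs = config_total (rows E ?zs)"
    using config_sum_list_mset[of E xs ?zs] config_sum_list_eq_total[of E ?zs] sym xs(1) zs lz by simp
  moreover have "induces_blowup E (set xs)" if "list_ex (\<lambda>l. extends [l] (rows E ?zs)) [0, 1, 2]"
  proof -
    obtain u us where u: "?zs = u # us" by (cases ?zs) auto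
    from that obtain l where l: "l \<in> {0, 1, 2}" "extends [l] (rows_from E [u] us)"
      unfolding u rows_def by (auto simp: list_ex_iff)
    have "induces_blowup E (set [u] \<union> set us)"
      using l dz u by (intro extends_imp_induces_blowup[of E "\<lambda>_. l", OF sym]) (auto simp: labelling_def)
    moreover have "set [u] \<union> set us = set xs" using sz u by auto
    ultimately show ?thesis by (simp only:)
  qed
  ultimately show ?thesis by (auto simp: within_bound_def)
qed

text \<open>
  With 4942620 as unit, a copy contributes \<open>40/243 - 1\<close>, as \<open>813600 / 4942620 = 40/243\<close>.
\<close>

lemma config_total_F12: "config_total F12_rows = 813600 - 4942620"
  by code_simp

lemma config_sum_list_copy:
  assumes sym: "\<And>x y. E x y = E y x" and xs: "length xs = 6" "distinct xs" "is_copy E (set xs)"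
  shows "config_sum_list E xs = 813600 - 4942620"
proof -
  obtain ys where ys: "length ys = 6" "distinct ys" "set ys = set xs" "rows E ys = F12_rows"
    using xs(3) by (auto simp: is_copy_def)
  have "mset ys = mset xs" using ys xs by (simp add: set_eq_iff_mset_eq_distinct)
  then have "config_sum_list E xs = config_sum_list E ys" using config_sum_list_mset[of E ys xs] sym ys(1) by simp
  also have "\<dots> = config_total F12_rows" using config_sum_list_eq_total[of E ys] sym ys by simp
  finally show ?thesis by (simp add: config_total_F12)
qed

section \<open>From six-vertex graphs to large graphs\<close>

text \<open>
  Each coordinate contributes its weight times the square of a sum.
\<close>

lemma weighted_dot_psd:
  assumes "\<forall>w\<in>set ws. 0 \<le> w" "\<And>i. i \<in> I \<Longrightarrow> length (v i) = length ws"
  shows "0 \<le> (\<Sum>i\<in>I. \<Sum>j\<in>I. weighted_dot ws (v i) (v j))"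
  using assms
proof (induction ws arbitrary: v)
  case (Cons w ws)
  have split: "weighted_dot (w # ws) (v i) (v j) = w * (hd (v i) * hd (v j)) + weighted_dot ws (tl (v i)) (tl (v j))"
    if "i \<in> I" "j \<in> I" for i j
    using Cons.prems(2)[OF that(1)] Cons.prems(2)[OF that(2)]
    by (cases "v i"; cases "v j") auto
  have "(\<Sum>i\<in>I. \<Sum>j\<in>I. weighted_dot (w # ws) (v i) (v j)) =
      w * ((\<Sum>i\<in>I. hd (v i)) * (\<Sum>j\<in>I. hd (v j))) + (\<Sum>i\<in>I. \<Sum>j\<in>I. weighted_dot ws (tl (v i)) (tl (v j)))"
  proof -
    have "(\<Sum>i\<in>I. \<Sum>j\<in>I. weighted_dot (w # ws) (v i) (v j)) =
        (\<Sum>i\<in>I. \<Sum>j\<in>I. w * (hd (v i) * hd (v j)) + weighted_dot ws (tl (v i)) (tl (v j)))"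
      by (intro sum.cong refl split)
    moreover have "(\<Sum>i\<in>I. \<Sum>j\<in>I. w * (hd (v i) * hd (v j))) =
        w * ((\<Sum>i\<in>I. hd (v i)) * (\<Sum>j\<in>I. hd (v j)))"
      by (subst sum_product) (simp only: sum_distrib_left)
    ultimately show ?thesis by (simp only: sum.distrib)
  qed
  moreover have "0 \<le> (\<Sum>i\<in>I. \<Sum>j\<in>I. weighted_dot ws (tl (v i)) (tl (v j)))"
    using Cons.prems by (intro Cons.IH) auto
  ultimately show ?case using Cons.prems(1) by simp
qed simp

lemma length_sym_vec: "length (sym_vec e p0 p1 q0 q1 f) = length (sym_weights e)"
  by (cases e; cases f; cases "root_shape p0 p1 q0 q1") (simp_all add: sym_vec_def)

lemma length_anti_vec: "length (anti_vec e p0 p1 q0 q1 f) = length (anti_weights e)"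
  by (cases e; cases f; cases "root_shape p0 p1 q0 q1") (simp_all add: anti_vec_def Let_def)

text \<open>
  For fixed roots, the sum over both pairs is a sum of squares, where repeated vertices are allowed.
\<close>

lemma config_psd: "0 \<le> (\<Sum>a\<in>V. \<Sum>b\<in>V. \<Sum>c\<in>V. \<Sum>d\<in>V. config E x y a b c d)"
proof -
  let ?s = "\<lambda>(a, b). sym_vec (E x y) (E x a) (E y a) (E x b) (E y b) (E a b)"
  let ?t = "\<lambda>(a, b). anti_vec (E x y) (E x a) (E y a) (E x b) (E y b) (E a b)"
  have "0 \<le> (\<Sum>i\<in>V \<times> V. \<Sum>j\<in>V \<times> V. weighted_dot (sym_weights (E x y)) (?s i) (?s j))"
    by (intro weighted_dot_psd) (auto simp: length_sym_vec, cases "E x y", auto)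
  moreover have "0 \<le> (\<Sum>i\<in>V \<times> V. \<Sum>j\<in>V \<times> V. weighted_dot (anti_weights (E x y)) (?t i) (?t j))"
    by (intro weighted_dot_psd) (auto simp: length_anti_vec, cases "E x y", auto)
  ultimately show ?thesis
    by (simp add: config_def config_form_def sum.distrib sum.cartesian_product' split_def)
qed

definition tuples :: "nat \<Rightarrow> 'a set \<Rightarrow> 'a list set" where
  "tuples k V = {xs. set xs \<subseteq> V \<and> length xs = k}"

lemma sum_tuples_Suc: "(\<Sum>xs\<in>tuples (Suc k) V. h xs) = (\<Sum>x\<in>V. \<Sum>xs\<in>tuples k V. h (x # xs))"
proof -
  have "tuples (Suc k) V = (\<lambda>(x, xs). x # xs) ` (V \<times> tuples k V)"
    by (auto simp: tuples_def length_Suc_conv)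
  moreover have "inj_on (\<lambda>(x, xs). x # xs) (V \<times> tuples k V)" by (auto simp: inj_on_def)
  ultimately show ?thesis
    by (simp add: sum.reindex sum.cartesian_product split_def)
qed

lemma tuples_0 [simp]: "tuples 0 V = {[]}"
  by (auto simp: tuples_def)

definition config_list :: "('a \<Rightarrow> 'a \<Rightarrow> bool) \<Rightarrow> 'a list \<Rightarrow> int" where
  "config_list E xs = config E (xs ! 0) (xs ! 1) (xs ! 2) (xs ! 3) (xs ! 4) (xs ! 5)"

lemma sum_config_list_nonneg: "0 \<le> (\<Sum>xs\<in>tuples 6 V. config_list E xs)"
proof -
  have "(\<Sum>xs\<in>tuples 6 V. config_list E xs) =
      (\<Sum>x\<in>V. \<Sum>y\<in>V. \<Sum>a\<in>V. \<Sum>b\<in>V. \<Sum>c\<in>V. \<Sum>d\<in>V. config E x y a b c d)"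
    by (simp add: eval_nat_numeral sum_tuples_Suc config_list_def)
  also have "0 \<le> \<dots>" by (intro sum_nonneg config_psd)
  finally show ?thesis .
qed

definition distinct_tuples :: "'a set \<Rightarrow> 'a list set" where
  "distinct_tuples V = {xs. set xs \<subseteq> V \<and> length xs = 6 \<and> distinct xs}"

lemma finite_tuples: "finite V \<Longrightarrow> finite (tuples k V)" "finite V \<Longrightarrow> finite (distinct_tuples V)"
  unfolding tuples_def distinct_tuples_def
  by (rule finite_lists_length_eq, assumption)
     (rule finite_subset[OF _ finite_lists_length_eq[of V 6]], auto)

lemma reorder_bij:
  assumes "finite V" "distinct p" "set p = {..<6}"
  shows "bij_betw (\<lambda>xs. map ((!) xs) p) (distinct_tuples V) (distinct_tuples V)"
proof -
  have len: "length p = 6" using distinct_card[OF assms(2)] assms(3) by simp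
  have inj: "inj_on (\<lambda>xs. map ((!) xs) p) (distinct_tuples V)"
  proof (rule inj_onI)
    fix xs ys assume *: "xs \<in> distinct_tuples V" "ys \<in> distinct_tuples V" "map ((!) xs) p = map ((!) ys) p"
    then have "\<forall>i\<in>set p. xs ! i = ys ! i" by simp
    then show "xs = ys" using * assms(3) by (intro nth_equalityI) (auto simp: distinct_tuples_def)
  qed
  moreover have "(\<lambda>xs. map ((!) xs) p) ` distinct_tuples V \<subseteq> distinct_tuples V"
  proof safe
    fix xs assume xs: "xs \<in> distinct_tuples V"
    have "inj_on ((!) xs) (set p)" using xs assms(3) by (auto simp: distinct_tuples_def inj_on_nth)
    moreover have "set (map ((!) xs) p) \<subseteq> set xs" using xs assms(3) by (auto simp: distinct_tuples_def)
    ultimately show "map ((!) xs) p \<in> distinct_tuples V"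
      using xs len assms(2) by (auto simp: distinct_tuples_def distinct_map)
  qed
  ultimately show ?thesis
    using endo_inj_surj[OF finite_tuples(2)[OF assms(1)]] by (auto simp: bij_betw_def)
qed

lemma sum_reorder:
  assumes "finite V" "distinct p" "set p = {..<6}"
  shows "(\<Sum>xs\<in>distinct_tuples V. h (map ((!) xs) p)) = (\<Sum>xs\<in>distinct_tuples V. h xs)"
  using sum.reindex_bij_betw[OF reorder_bij[OF assms]] .

lemma sum_config_reorder:
  assumes "finite V" "distinct [i, j, k, l, m, n]" "set [i, j, k, l, m, n] = {..<6}"
  shows "(\<Sum>xs\<in>distinct_tuples V. config E (xs ! i) (xs ! j) (xs ! k) (xs ! l) (xs ! m) (xs ! n)) =
    (\<Sum>xs\<in>distinct_tuples V. config_list E xs)"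
  using sum_reorder[OF assms, of "config_list E"] by (simp add: config_list_def)

text \<open>
  Over all tuples of distinct vertices, each of the 45 terms has the same sum.
\<close>

lemma sum_config_sum_list:
  assumes "finite V"
  shows "(\<Sum>xs\<in>distinct_tuples V. config_sum_list E xs) = 45 * (\<Sum>xs\<in>distinct_tuples V. config_list E xs)"
  unfolding config_sum_list_def config_sum_def sum.distrib
  by (subst sum_config_reorder[OF assms], (auto)[2])+ simp

lemma config_bounded: "\<exists>K. \<forall>(E :: 'a \<Rightarrow> 'a \<Rightarrow> bool) x y a b c d. \<bar>config E x y a b c d\<bar> \<le> K"
proof -
  let ?f = "\<lambda>(e, p0, p1, q0, q1, f, r0, r1, s0, s1, h). \<bar>config_form e p0 p1 q0 q1 f r0 r1 s0 s1 h\<bar>"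
  have "\<bar>config E x y a b c d\<bar> \<le> Max (range ?f)" for E and x y a b c d :: 'a
    unfolding config_def
    by (intro Max_ge finite_imageI finite image_eqI[where x = "(E x y, E x a, E y a, E x b, E y b, E a b,
        E x c, E y c, E x d, E y d, E c d)"]) auto
  then show ?thesis by blast
qed

lemma falling_factorial_bound:
  assumes "6 \<le> n"
  shows "int n ^ 6 - 15 * int n ^ 5 \<le> int (\<Prod>{n - 5..n})"
proof -
  obtain k where n: "n = k + 6" using assms by (metis add.commute le_Suc_ex)
  \<comment> \<open>Setting \<open>n = k + 6\<close> makes all coefficients of the difference nonnegative.\<close>
  have "{n - 5..n} = {k + 1, k + 2, k + 3, k + 4, k + 5, k + 6}" using n by auto
  then have "int (\<Prod>{n - 5..n}) =
      (int k + 1) * (int k + 2) * (int k + 3) * (int k + 4) * (int k + 5) * (int k + 6)"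
    by (simp add: algebra_simps)
  also have "\<dots> = (int k + 6) ^ 6 - 15 * (int k + 6) ^ 5 +
      (85 * int k ^ 4 + 1815 * int k ^ 3 + 14584 * int k ^ 2 + 52308 * int k + 70704)"
    by algebra
  finally show ?thesis unfolding n by simp
qed

text \<open>
  The factor 15 is the number of pairs of positions that may carry the same vertex.
\<close>

lemma card_repeated_tuples:
  assumes "finite V" "6 \<le> card V"
  shows "int (card (tuples 6 V - distinct_tuples V)) \<le> 15 * int (card V) ^ 5"
proof -
  have sub: "distinct_tuples V \<subseteq> tuples 6 V" by (auto simp: distinct_tuples_def tuples_def)
  have "card (tuples 6 V) = card V ^ 6"
    using card_lists_length_eq[OF assms(1)] by (simp add: tuples_def)
  moreover have "card (distinct_tuples V) = \<Prod>{card V - 5..card V}"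
  proof -
    have "distinct_tuples V = {xs. length xs = 6 \<and> distinct xs \<and> set xs \<subseteq> V}"
      by (auto simp: distinct_tuples_def)
    moreover have "card V - 6 + 1 = card V - 5" using assms(2) by simp
    ultimately show ?thesis using card_lists_distinct_length_eq[OF assms(1) assms(2)] by simp
  qed
  ultimately have "int (card (tuples 6 V - distinct_tuples V)) =
      int (card V) ^ 6 - int (\<Prod>{card V - 5..card V})"
    using sub card_mono[OF finite_tuples(1)[OF assms(1)] sub]
    by (simp add: card_Diff_subset finite_tuples(2)[OF assms(1)] of_nat_diff)
  then show ?thesis using falling_factorial_bound[OF assms(2)] by linarith
qed

definition six_sets :: "'a set \<Rightarrow> 'a set set" where
  "six_sets V = {S. S \<subseteq> V \<and> card S = 6}"

lemma finite_six_sets: "finite V \<Longrightarrow> finite (six_sets V)"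
  by (auto simp: six_sets_def)

lemma sum_distinct_tuples:
  assumes "finite V"
  shows "(\<Sum>xs\<in>distinct_tuples V. \<phi> (set xs)) = (720 :: int) * (\<Sum>S\<in>six_sets V. \<phi> S)"
proof -
  have "(\<Sum>xs\<in>distinct_tuples V. \<phi> (set xs)) =
      (\<Sum>S\<in>six_sets V. \<Sum>xs\<in>{xs \<in> distinct_tuples V. set xs = S}. \<phi> (set xs))"
    using assms finite_six_sets[OF assms] finite_tuples(2)[OF assms]
    by (intro sum.group[symmetric]) (auto simp: distinct_tuples_def six_sets_def distinct_card)
  also have "\<dots> = (\<Sum>S\<in>six_sets V. 720 * \<phi> S)"
  proof (intro sum.cong refl)
    fix S assume S: "S \<in> six_sets V"
    then have fin: "finite S" using assms by (auto simp: six_sets_def finite_subset)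
    have "{xs \<in> distinct_tuples V. set xs = S} = permutations_of_set S"
      using S by (auto simp: distinct_tuples_def six_sets_def permutations_of_set_def distinct_card[symmetric])
    then show "(\<Sum>xs\<in>{xs \<in> distinct_tuples V. set xs = S}. \<phi> (set xs)) = 720 * \<phi> S"
      using S fin by (simp add: permutations_of_set_def[symmetric] six_sets_def fact_numeral
          sum.cong[of "permutations_of_set S" _ "\<lambda>xs. \<phi> (set xs)" "\<lambda>_. \<phi> S",
            OF refl permutations_of_setD(1)[THEN arg_cong[of _ _ \<phi>]]])
  qed
  finally show ?thesis by (simp add: sum_distrib_left)
qed

lemma is_copy_imp_induces_blowup:
  assumes sym: "\<And>x y. E x y = E y x" and "is_copy E S"
  shows "induces_blowup E S"
proof -
  obtain xs where xs: "length xs = 6" "distinct xs" "set xs = S" "rows E xs = F12_rows"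
    using assms(2) by (auto simp: is_copy_def)
  obtain u us where u: "xs = u # us" using xs(1) by (cases xs) auto
  have "extends [1] F12_rows" by code_simp
  then have "induces_blowup E (set [u] \<union> set us)"
    using xs u by (intro extends_imp_induces_blowup[of E "\<lambda>_. 1", OF sym]) (auto simp: labelling_def rows_def)
  moreover have "set [u] \<union> set us = S" using xs u by auto
  ultimately show ?thesis by (simp only:)
qed

text \<open>
  Adding up the form over all tuples of six vertices gives a nonnegative number. Tuples with
  repeated vertices contribute at most a multiple of \<open>n^5\<close>, and each set of six vertices occurs in
  720 orders. Comparing with the bounds for six vertices yields the claim, including the slack of
  sets that do not induce a blowup.
\<close>

theorem flag_bound:
  "\<exists>K. \<forall>(V :: 'a set) E. finite V \<longrightarrow> 6 \<le> card V \<longrightarrow> (\<forall>x y. E x y = E y x) \<longrightarrow>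
     real (card {S \<in> six_sets V. is_copy E S}) + real (card {S \<in> six_sets V. \<not> induces_blowup E S}) / 4942620
       \<le> 40 / 243 * real (card V choose 6) + K * real (card V) ^ 5"
proof -
  obtain K where K: "\<And>(E :: 'a \<Rightarrow> 'a \<Rightarrow> bool) x y a b c d. \<bar>config E x y a b c d\<bar> \<le> K"
    using config_bounded[where 'a = 'a] by blast
  have "720 * (4942620 * int (card {S \<in> six_sets V. is_copy E S}) + int (card {S \<in> six_sets V. \<not> induces_blowup E S}))
      \<le> 720 * (813600 * int (card V choose 6)) + 675 * (K * int (card V) ^ 5)"
    if V: "finite V" "6 \<le> card V" and sym: "\<And>x y. E x y = E y x" for V :: "'a set" and E
  proof -
    let ?L = "tuples 6 V" and ?D = "distinct_tuples V"
    have sub: "?D \<subseteq> ?L" by (auto simp: distinct_tuples_def tuples_def)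
    have K0: "0 \<le> K" using K[of E undefined undefined undefined undefined undefined undefined] by linarith
    have "(\<Sum>xs\<in>?L - ?D. config_list E xs) \<le> (\<Sum>xs\<in>?L - ?D. K)"
      using K by (intro sum_mono) (auto simp: config_list_def abs_le_iff)
    also have "\<dots> = K * int (card (?L - ?D))" by simp
    also have "\<dots> \<le> K * (15 * int (card V) ^ 5)"
      by (intro mult_left_mono card_repeated_tuples V K0)
    finally have "(\<Sum>xs\<in>?L - ?D. config_list E xs) \<le> 15 * (K * int (card V) ^ 5)" by simp
    moreover have "(\<Sum>xs\<in>?L. config_list E xs) = (\<Sum>xs\<in>?L - ?D. config_list E xs) + (\<Sum>xs\<in>?D. config_list E xs)"
      by (rule sum.subset_diff[OF sub finite_tuples(1)[OF V(1)]])
    moreover have "0 \<le> (\<Sum>xs\<in>?L. config_list E xs)" by (rule sum_config_list_nonneg)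
    \<comment> \<open>The constant is \<open>675 = 45 * 15\<close>: 45 terms, bounded by \<open>K\<close> on \<open>15 n^5\<close> tuples.\<close>
    ultimately have lower: "- (675 * (K * int (card V) ^ 5)) \<le> (\<Sum>xs\<in>?D. config_sum_list E xs)"
      using sum_config_sum_list[OF V(1), of E] by linarith
    let ?\<phi> = "\<lambda>S. 813600 - 4942620 * of_bool (is_copy E S) - (of_bool (\<not> induces_blowup E S) :: int)"
    have "(\<Sum>xs\<in>?D. config_sum_list E xs) \<le> (\<Sum>xs\<in>?D. ?\<phi> (set xs))"
    proof (rule sum_mono)
      fix xs assume "xs \<in> ?D"
      then have xs: "length xs = 6" "distinct xs" by (auto simp: distinct_tuples_def)
      show "config_sum_list E xs \<le> ?\<phi> (set xs)"
        using config_sum_list_bound[of E xs] config_sum_list_copy[of E xs] is_copy_imp_induces_blowup[of E "set xs"] xs sym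
        by (cases "is_copy E (set xs)") auto
    qed
    also have "\<dots> = 720 * (\<Sum>S\<in>six_sets V. ?\<phi> S)" by (rule sum_distinct_tuples[OF V(1)])
    also have "(\<Sum>S\<in>six_sets V. ?\<phi> S) = 813600 * int (card V choose 6) -
        4942620 * int (card {S \<in> six_sets V. is_copy E S}) - int (card {S \<in> six_sets V. \<not> induces_blowup E S})"
      using finite_six_sets[OF V(1)] n_subsets[OF V(1), of 6]
      by (simp add: sum_subtractf sum_distrib_left[symmetric] six_sets_def[symmetric] Int_def sum_of_bool_eq
          flip: of_nat_sum)
    finally have "- (675 * (K * int (card V) ^ 5)) \<le> 720 * (813600 * int (card V choose 6) -
        4942620 * int (card {S \<in> six_sets V. is_copy E S}) - int (card {S \<in> six_sets V. \<not> induces_blowup E S}))"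
      by (rule order_trans[OF lower])
    then show ?thesis by (simp add: algebra_simps)
  qed
  note main = this
  have "real (card {S \<in> six_sets V. is_copy E S}) + real (card {S \<in> six_sets V. \<not> induces_blowup E S}) / 4942620
       \<le> 40 / 243 * real (card V choose 6) + (675 * real_of_int K / (720 * 4942620)) * real (card V) ^ 5"
    if V: "finite V" "6 \<le> card V" and sym: "\<forall>x y. E x y = E y x" for V :: "'a set" and E
  proof -
    have "real_of_int (720 * (4942620 * int (card {S \<in> six_sets V. is_copy E S}) + int (card {S \<in> six_sets V. \<not> induces_blowup E S})))
      \<le> real_of_int (720 * (813600 * int (card V choose 6)) + 675 * (K * int (card V) ^ 5))"
      using main[of V E] V sym by (simp only: of_int_le_iff)
    then show ?thesis by (simp add: field_simps)
  qed
  then show ?thesis by blast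
qed

section \<open>Copies in graphs close to a blowup\<close>

text \<open>
  The adjacency of the blowup of \<open>B12\<close> whose parts are given by the labels of \<open>p\<close>.
\<close>

definition model :: "('a \<Rightarrow> nat) \<Rightarrow> 'a \<Rightarrow> 'a \<Rightarrow> bool" where
  "model p x y \<longleftrightarrow> B12_adj (p x) (p y)"

definition part :: "('a \<Rightarrow> nat) \<Rightarrow> 'a set \<Rightarrow> nat \<Rightarrow> 'a set" where
  "part p V j = {x \<in> V. p x = j}"

definition wrong_pairs :: "('a \<Rightarrow> 'a \<Rightarrow> bool) \<Rightarrow> ('a \<Rightarrow> nat) \<Rightarrow> 'a set \<Rightarrow> 'a set set" where
  "wrong_pairs E p V = {{x, y} | x y. x \<in> V \<and> y \<in> V \<and> x \<noteq> y \<and> E x y \<noteq> model p x y}"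

definition copies :: "('a \<Rightarrow> 'a \<Rightarrow> bool) \<Rightarrow> 'a set \<Rightarrow> 'a set set" where
  "copies E V = {S \<in> six_sets V. is_copy E S}"

lemma model_commute: "model p x y = model p y x"
  by (simp add: model_def B12_adj_commute)

lemma is_copy_cong:
  assumes "\<And>x y. x \<in> S \<Longrightarrow> y \<in> S \<Longrightarrow> x \<noteq> y \<Longrightarrow> E x y = E' x y"
  shows "is_copy E S = is_copy E' S"
proof -
  have "rows E xs = rows E' xs" if "distinct xs" "set xs = S" for xs
    using that assms by (intro rows_cong) auto
  then show ?thesis by (auto simp: is_copy_def)
qed

lemma is_copy_iff:
  "is_copy E S \<longleftrightarrow> (\<exists>c u x y z w. S = {c, u, x, y, z, w} \<and> distinct [c, u, x, y, z, w] \<and>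
     rows E [c, u, x, y, z, w] = F12_rows)"
  (is "_ \<longleftrightarrow> ?R")
proof
  assume "is_copy E S"
  then obtain xs where xs: "length xs = 6" "distinct xs" "set xs = S" "rows E xs = F12_rows"
    by (auto simp: is_copy_def)
  from xs(1) obtain c u x y z w where "xs = [c, u, x, y, z, w]" by (elim length6E)
  then show ?R using xs by (intro exI[of _ c] exI[of _ u] exI[of _ x] exI[of _ y] exI[of _ z] exI[of _ w]) simp
next
  assume ?R
  then obtain c u x y z w where "S = {c, u, x, y, z, w}" "distinct [c, u, x, y, z, w]"
     "rows E [c, u, x, y, z, w] = F12_rows" by blast
  then show "is_copy E S" unfolding is_copy_def by (intro exI[of _ "[c, u, x, y, z, w]"]) simp
qed

lemma rows_F12_iff:
  "rows E [c, u, x, y, z, w] = F12_rows \<longleftrightarrow>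
     E c x \<and> E c y \<and> E c z \<and> E u w \<and> \<not> E c u \<and> \<not> E c w \<and> \<not> E u x \<and> \<not> E u y \<and> \<not> E u z \<and>
     \<not> E x y \<and> \<not> E x z \<and> \<not> E y z \<and> \<not> E x w \<and> \<not> E y w \<and> \<not> E z w"
  by (auto simp: rows_def F12_rows_def)

text \<open>
  The adjacencies of \<open>F12\<close> that are violated when its six vertices receive the labels \<open>ls\<close>.
\<close>

definition pairs6 :: "(nat \<times> nat) list" where
  "pairs6 = concat (map (\<lambda>j. map (\<lambda>i. (i, j)) [0..<j]) [0..<6])"

definition mismatches :: "nat list \<Rightarrow> (nat \<times> nat) list" where
  "mismatches ls = filter (\<lambda>(i, j). rows_adj F12_rows i j \<noteq> B12_adj (ls ! i) (ls ! j)) pairs6"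

text \<open>
  An unfolded form of \<open>mismatches\<close> that is evaluated quickly for the 729 labellings.
\<close>

definition mismatches6 :: "nat \<Rightarrow> nat \<Rightarrow> nat \<Rightarrow> nat \<Rightarrow> nat \<Rightarrow> nat \<Rightarrow> (nat \<times> nat) list" where
  "mismatches6 a b c d e f =
     (if B12_adj a b then [(0, 1)] else []) @ (if B12_adj a c then [] else [(0, 2)]) @
     (if B12_adj b c then [(1, 2)] else []) @ (if B12_adj a d then [] else [(0, 3)]) @
     (if B12_adj b d then [(1, 3)] else []) @ (if B12_adj c d then [(2, 3)] else []) @
     (if B12_adj a e then [] else [(0, 4)]) @ (if B12_adj b e then [(1, 4)] else []) @
     (if B12_adj c e then [(2, 4)] else []) @ (if B12_adj d e then [(3, 4)] else []) @
     (if B12_adj a f then [(0, 5)] else []) @ (if B12_adj b f then [] else [(1, 5)]) @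
     (if B12_adj c f then [(2, 5)] else []) @ (if B12_adj d f then [(3, 5)] else []) @
     (if B12_adj e f then [(4, 5)] else [])"

lemma mismatches_eq: "mismatches [a, b, c, d, e, f] = mismatches6 a b c d e f"
  by (simp add: mismatches_def mismatches6_def pairs6_def rows_adj_def F12_rows_def upt_conv_Cons)

definition balanced :: "nat list \<Rightarrow> bool" where
  "balanced ls \<longleftrightarrow> count_list ls 0 = 2 \<and>
     (count_list ls 1 = 1 \<and> count_list ls 2 = 3 \<or> count_list ls 1 = 3 \<and> count_list ls 2 = 1)"

definition matches_or_two :: "nat \<Rightarrow> nat \<Rightarrow> nat \<Rightarrow> nat \<Rightarrow> nat \<Rightarrow> nat \<Rightarrow> bool" where
  "matches_or_two a b c d e f \<longleftrightarrow>
     (case mismatches6 a b c d e f of [] \<Rightarrow> balanced [a, b, c, d, e, f] | [m] \<Rightarrow> False | _ \<Rightarrow> True)"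

text \<open>
  This finite check is the reason why single wrong pairs are expensive: changing one adjacency in a
  blowup neither preserves a copy through this pair nor creates one.
\<close>

lemma labellings_match_or_miss_twice:
  "list_all (\<lambda>a. list_all (\<lambda>b. list_all (\<lambda>c. list_all (\<lambda>d. list_all (\<lambda>e.
     list_all (\<lambda>f. matches_or_two a b c d e f) [0, 1, 2]) [0, 1, 2]) [0, 1, 2]) [0, 1, 2]) [0, 1, 2]) [0, 1, 2]"
  by code_simp

lemma mismatches_cases:
  assumes "length ls = 6" "\<forall>l\<in>set ls. l < 3"
  shows "mismatches ls = [] \<and> balanced ls \<or> (\<exists>m m' ms. mismatches ls = m # m' # ms)"
proof -
  obtain a b c d e f where ls: "ls = [a, b, c, d, e, f]" using assms(1) by (elim length6E)
  have "\<forall>l\<in>set ls. l \<in> set [0, 1, 2]" using assms(2) by auto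
  then have "a \<in> set [0, 1, 2]" "b \<in> set [0, 1, 2]" "c \<in> set [0, 1, 2]"
    "d \<in> set [0, 1, 2]" "e \<in> set [0, 1, 2]" "f \<in> set [0, 1, 2]"
    unfolding ls by simp_all
  then have "matches_or_two a b c d e f"
    using labellings_match_or_miss_twice unfolding list_all_iff by blast
  then have *: "case mismatches ls of [] \<Rightarrow> balanced ls | [m] \<Rightarrow> False | _ \<Rightarrow> True"
    unfolding matches_or_two_def ls mismatches_eq .
  show ?thesis
  proof (cases "mismatches ls")
    case Nil
    then show ?thesis using * by simp
  next
    case (Cons m ms)
    then show ?thesis using * by (cases ms) auto
  qed
qed

lemma pairs6_props: "distinct pairs6" "set pairs6 = {(i, j). i < j \<and> j < 6}"
proof -
  show "distinct pairs6" by code_simp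
  have "set pairs6 = (\<Union>j\<in>{0..<6}. (\<lambda>i. (i, j)) ` {0..<j})"
    by (simp only: pairs6_def set_concat set_map set_upt image_image)
  then show "set pairs6 = {(i, j). i < j \<and> j < 6}" by auto
qed

lemma count_list_part:
  assumes "distinct xs"
  shows "count_list (map p xs) j = card (part p (set xs) j)"
proof -
  have "count_list (map p xs) j = length (filter (\<lambda>x. p x = j) xs)"
    by (induction xs) auto
  also have "\<dots> = card (set (filter (\<lambda>x. p x = j) xs))"
    by (rule distinct_card[symmetric]) (simp add: assms)
  finally show ?thesis by (simp add: part_def)
qed

text \<open>
  Either the labelling explains the copy completely, and then the copy lies in the blowup in one of
  the two possible ways, or at least two pairs are wrong.
\<close>

lemma is_copy_vs_labelling:
  assumes sym: "\<And>x y. E x y = E y x" and lab: "\<And>x. p x < (3 :: nat)" and "is_copy E S"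
  shows "wrong_pairs E p S = {} \<and> card (part p S 0) = 2 \<and>
      (card (part p S 1) = 1 \<and> card (part p S 2) = 3 \<or> card (part p S 1) = 3 \<and> card (part p S 2) = 1) \<or>
    (\<exists>e1\<in>wrong_pairs E p S. \<exists>e2\<in>wrong_pairs E p S. e1 \<noteq> e2)"
proof -
  obtain xs where xs: "length xs = 6" "distinct xs" "set xs = S" "rows E xs = F12_rows"
    using assms(3) by (auto simp: is_copy_def)
  let ?ls = "map p xs"
  have rows_adj: "rows_adj F12_rows i j = E (xs ! i) (xs ! j)" if "i < 6" "j < 6" "i \<noteq> j" for i j
    using rows_adj_rows[of E i xs j] sym xs that by simp
  have wrongI: "{xs ! i, xs ! j} \<in> wrong_pairs E p S" if "(i, j) \<in> set (mismatches ?ls)" for i j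
  proof -
    have ij: "i < j" "j < 6" using that by (auto simp: mismatches_def pairs6_props)
    then have "E (xs ! i) (xs ! j) \<noteq> model p (xs ! i) (xs ! j)"
      using that xs(1) rows_adj[of i j] by (auto simp: mismatches_def model_def)
    moreover have "xs ! i \<in> S" "xs ! j \<in> S" "xs ! i \<noteq> xs ! j"
      using ij xs by (auto simp: nth_eq_iff_index_eq)
    ultimately show ?thesis by (auto simp: wrong_pairs_def)
  qed
  consider "mismatches ?ls = []" "balanced ?ls" | m m' ms where "mismatches ?ls = m # m' # ms"
    using mismatches_cases[of ?ls] xs(1) lab by auto
  then show ?thesis
  proof cases
    case 1
    have "E x y = model p x y" if xy: "x \<in> S" "y \<in> S" "x \<noteq> y" for x y
    proof -
      obtain i where "i < length xs" "x = xs ! i" using xy(1) xs(3) by (auto simp: in_set_conv_nth)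
      moreover obtain j where "j < length xs" "y = xs ! j" using xy(2) xs(3) by (auto simp: in_set_conv_nth)
      ultimately have ij: "i < 6" "j < 6" "x = xs ! i" "y = xs ! j" using xs(1) by auto
      have "i \<noteq> j" using xy ij by auto
      then have "(min i j, max i j) \<in> set pairs6" using ij by (auto simp: pairs6_props min_def max_def)
      then have "rows_adj F12_rows (min i j) (max i j) = B12_adj (?ls ! min i j) (?ls ! max i j)"
        using 1(1) by (auto simp: mismatches_def filter_empty_conv)
      then show ?thesis
        using ij xs(1) \<open>i \<noteq> j\<close> rows_adj[of i j] rows_adj[of j i] sym[of x y] model_commute[of p x y]
        by (auto simp: model_def min_def max_def split: if_splits)
    qed
    then have "wrong_pairs E p S = {}" by (auto simp: wrong_pairs_def)
    then show ?thesis using 1(2) xs(2,3) count_list_part[of xs p] by (simp add: balanced_def)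
  next
    case 2
    obtain i j i' j' where m: "m = (i, j)" "m' = (i', j')" by fastforce
    have mem: "(i, j) \<in> set (mismatches ?ls)" "(i', j') \<in> set (mismatches ?ls)" using 2 m by auto
    have "distinct (mismatches ?ls)" by (simp add: mismatches_def pairs6_props)
    then have ne: "(i, j) \<noteq> (i', j')" using 2 m by auto
    have lt: "i < j" "j < 6" "i' < j'" "j' < 6" using mem by (auto simp: mismatches_def pairs6_props)
    have "{xs ! i, xs ! j} \<noteq> {xs ! i', xs ! j'}"
    proof
      assume "{xs ! i, xs ! j} = {xs ! i', xs ! j'}"
      then have "xs ! i = xs ! i' \<and> xs ! j = xs ! j' \<or> xs ! i = xs ! j' \<and> xs ! j = xs ! i'"
        by (auto simp: doubleton_eq_iff)
      then have "i = i' \<and> j = j' \<or> i = j' \<and> j = i'"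
        using lt xs by (simp add: nth_eq_iff_index_eq)
      then show False using lt ne by auto
    qed
    with wrongI[OF mem(1)] wrongI[OF mem(2)]
    have "\<exists>e1\<in>wrong_pairs E p S. \<exists>e2\<in>wrong_pairs E p S. e1 \<noteq> e2" by (intro bexI)
    then show ?thesis by (rule disjI2)
  qed
qed

lemma wrong_pairs_model [simp]: "wrong_pairs (model p) p V = {}"
  by (auto simp: wrong_pairs_def)

text \<open>
  The edge is in the clique, the centre of the star in one side of the bipartite graph and its
  leaves in the other.
\<close>

lemma is_copy_model_iff:
  assumes lab: "\<And>x. p x < (3 :: nat)" and "finite S"
  shows "is_copy (model p) S \<longleftrightarrow> card (part p S 0) = 2 \<and>
      (card (part p S 1) = 1 \<and> card (part p S 2) = 3 \<or> card (part p S 1) = 3 \<and> card (part p S 2) = 1)"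
  (is "_ \<longleftrightarrow> ?R")
proof
  assume "is_copy (model p) S"
  then show ?R using is_copy_vs_labelling[of "model p" p S] lab model_commute[of p] by auto
next
  assume R: ?R
  obtain s t where st: "s = 1 \<and> t = 2 \<or> s = 2 \<and> t = (1 :: nat)"
      "card (part p S s) = 1" "card (part p S t) = 3"
  proof (cases "card (part p S 1) = 1")
    case True
    then show ?thesis using R that[of 1 2] by simp
  next
    case False
    then show ?thesis using R that[of 2 1] by simp
  qed
  obtain u w where uw: "part p S 0 = {u, w}" "u \<noteq> w" using R by (meson card_2_iff)
  obtain c where c: "part p S s = {c}" using st(2) by (meson card_1_singletonE)
  obtain x y z where xyz: "part p S t = {x, y, z}" "x \<noteq> y" "y \<noteq> z" "x \<noteq> z" using st(3) unfolding card_3_iff by blast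
  have S: "S = part p S 0 \<union> part p S s \<union> part p S t"
  proof -
    have "p x = 0 \<or> p x = s \<or> p x = t" for x using lab[of x] st(1) by linarith
    then show ?thesis unfolding part_def by blast
  qed
  have pv: "p u = 0" "p w = 0" "p c = s" "p x = t" "p y = t" "p z = t"
    using uw c xyz by (auto simp: part_def)
  have "s \<noteq> 0" "t \<noteq> 0" "s \<noteq> t" using st(1) by auto
  then have "rows (model p) [c, u, x, y, z, w] = F12_rows" "distinct [c, u, x, y, z, w]"
    using pv uw(2) xyz(2-) st(1) by (auto simp: rows_F12_iff model_def B12_adj_def)
  moreover have "S = {c, u, x, y, z, w}" using S uw(1) c xyz(1) by auto
  ultimately show "is_copy (model p) S" unfolding is_copy_iff by blast
qed

section \<open>Counting copies in blowups\<close>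

definition subsets_of_size :: "nat \<Rightarrow> 'a set \<Rightarrow> 'a set set" where
  "subsets_of_size k A = {X. X \<subseteq> A \<and> card X = k}"

lemma card_subsets_of_size: "finite A \<Longrightarrow> card (subsets_of_size k A) = card A choose k"
  by (simp add: subsets_of_size_def n_subsets)

lemma finite_subsets_of_size: "finite A \<Longrightarrow> finite (subsets_of_size k A)"
  by (simp add: subsets_of_size_def)

lemma card_supersets_le:
  assumes "finite V" "T \<subseteq> V" "card T \<le> 6"
  shows "card {S \<in> six_sets V. T \<subseteq> S} \<le> card V ^ (6 - card T)"
proof -
  have fT: "finite T" using assms finite_subset by blast
  have "card {S \<in> six_sets V. T \<subseteq> S} \<le> card (subsets_of_size (6 - card T) V)"
  proof (rule card_inj_on_le[of "\<lambda>S. S - T"])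
    show "inj_on (\<lambda>S. S - T) {S \<in> six_sets V. T \<subseteq> S}"
      by (auto simp: inj_on_def)
    show "(\<lambda>S. S - T) ` {S \<in> six_sets V. T \<subseteq> S} \<subseteq> subsets_of_size (6 - card T) V"
      using fT by (auto simp: six_sets_def subsets_of_size_def card_Diff_subset)
  qed (use assms finite_subsets_of_size in auto)
  also have "\<dots> = card V choose (6 - card T)" using assms by (simp add: card_subsets_of_size)
  also have "\<dots> \<le> card V ^ (6 - card T)"
    by (cases "6 - card T \<le> card V") (auto simp: binomial_le_pow binomial_eq_0)
  finally show ?thesis .
qed

text \<open>
  Copies in a blowup are described by the number of vertices in each part.
\<close>

definition profiled :: "('a \<Rightarrow> nat) \<Rightarrow> 'a set \<Rightarrow> nat \<Rightarrow> nat \<Rightarrow> nat \<Rightarrow> 'a set set" where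
  "profiled p V i j k =
     {S. S \<subseteq> V \<and> card (part p S 0) = i \<and> card (part p S 1) = j \<and> card (part p S 2) = k}"

lemma part_Un3:
  assumes "\<And>x. p x < (3 :: nat)"
  shows "V = part p V 0 \<union> part p V 1 \<union> part p V 2"
proof -
  have "p x = 0 \<or> p x = 1 \<or> p x = 2" for x using assms[of x] by linarith
  then show ?thesis by (auto simp: part_def)
qed

lemma card_parts:
  assumes "\<And>x. p x < (3 :: nat)" "finite V"
  shows "card V = card (part p V 0) + card (part p V 1) + card (part p V 2)"
proof -
  have "card V = card (part p V 0 \<union> part p V 1 \<union> part p V 2)"
    using part_Un3[of p V] assms(1) by simp
  also have "\<dots> = card (part p V 0 \<union> part p V 1) + card (part p V 2)"
    using assms(2) by (intro card_Un_disjoint) (auto simp: part_def)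
  also have "card (part p V 0 \<union> part p V 1) = card (part p V 0) + card (part p V 1)"
    using assms(2) by (intro card_Un_disjoint) (auto simp: part_def)
  finally show ?thesis .
qed

lemma finite_part [simp]: "finite V \<Longrightarrow> finite (part p V j)"
  by (simp add: part_def)

lemma card_profiled:
  assumes lab: "\<And>x. p x < (3 :: nat)" and fin: "finite V"
  shows "card (profiled p V i j k) =
    (card (part p V 0) choose i) * (card (part p V 1) choose j) * (card (part p V 2) choose k)"
proof -
  let ?D = "subsets_of_size i (part p V 0) \<times> subsets_of_size j (part p V 1) \<times> subsets_of_size k (part p V 2)"
  let ?f = "\<lambda>S. (part p S 0, part p S 1, part p S 2)"
  have "bij_betw ?f (profiled p V i j k) ?D"
  proof (rule bij_betw_byWitness[where f' = "\<lambda>(X, Y, Z). X \<union> Y \<union> Z"])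
    show "\<forall>S\<in>profiled p V i j k. (\<lambda>(X, Y, Z). X \<union> Y \<union> Z) (?f S) = S"
      using part_Un3[of p] lab by auto
    have un: "part p (X \<union> Y \<union> Z) 0 = X \<and> part p (X \<union> Y \<union> Z) 1 = Y \<and> part p (X \<union> Y \<union> Z) 2 = Z"
      if "X \<subseteq> part p V 0" "Y \<subseteq> part p V 1" "Z \<subseteq> part p V 2" for X Y Z
      using that by (auto simp: part_def)
    then show "\<forall>t\<in>?D. ?f ((\<lambda>(X, Y, Z). X \<union> Y \<union> Z) t) = t"
      by (auto simp: subsets_of_size_def)
    show "?f ` profiled p V i j k \<subseteq> ?D"
      by (auto simp: profiled_def subsets_of_size_def part_def)
    show "(\<lambda>(X, Y, Z). X \<union> Y \<union> Z) ` ?D \<subseteq> profiled p V i j k"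
    proof safe
      fix X Y Z assume X: "X \<in> subsets_of_size i (part p V 0)" "Y \<in> subsets_of_size j (part p V 1)"
        "Z \<in> subsets_of_size k (part p V 2)"
      then have "X \<union> Y \<union> Z \<subseteq> V" by (auto simp: subsets_of_size_def part_def)
      then show "X \<union> Y \<union> Z \<in> profiled p V i j k"
        using un[of X Y Z] X by (auto simp: profiled_def subsets_of_size_def)
    qed
  qed
  then have "card (profiled p V i j k) = card ?D" by (rule bij_betw_same_card)
  then show ?thesis using fin by (simp add: card_cartesian_product card_subsets_of_size)
qed

lemma part_Diff: "part p (S - X) j = part p S j - part p X j"
  by (auto simp: part_def)

lemma part_Un: "part p (S \<union> X) j = part p S j \<union> part p X j"
  by (auto simp: part_def)

lemma part_mono: "S \<subseteq> V \<Longrightarrow> part p S j \<subseteq> part p V j"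
  by (auto simp: part_def)

lemma card_profiled_containing:
  assumes lab: "\<And>x. p x < (3 :: nat)" and fin: "finite V" and X: "X \<subseteq> V"
    and le: "card (part p X 0) \<le> i" "card (part p X 1) \<le> j" "card (part p X 2) \<le> k"
  shows "card {S \<in> profiled p V i j k. X \<subseteq> S} =
    (card (part p (V - X) 0) choose (i - card (part p X 0))) *
    (card (part p (V - X) 1) choose (j - card (part p X 1))) *
    (card (part p (V - X) 2) choose (k - card (part p X 2)))"
proof -
  have fX: "finite X" using fin X finite_subset by blast
  have "bij_betw (\<lambda>S. S - X) {S \<in> profiled p V i j k. X \<subseteq> S}
      (profiled p (V - X) (i - card (part p X 0)) (j - card (part p X 1)) (k - card (part p X 2)))"
  proof (rule bij_betw_byWitness[where f' = "\<lambda>S. S \<union> X"])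
    show "(\<lambda>S. S - X) ` {S \<in> profiled p V i j k. X \<subseteq> S} \<subseteq>
        profiled p (V - X) (i - card (part p X 0)) (j - card (part p X 1)) (k - card (part p X 2))"
      using fX by (auto simp: profiled_def part_Diff card_Diff_subset part_mono)
    show "(\<lambda>S. S \<union> X) ` profiled p (V - X) (i - card (part p X 0)) (j - card (part p X 1)) (k - card (part p X 2))
        \<subseteq> {S \<in> profiled p V i j k. X \<subseteq> S}"
    proof safe
      fix S assume S: "S \<in> profiled p (V - X) (i - card (part p X 0)) (j - card (part p X 1)) (k - card (part p X 2))"
      then have sub: "S \<subseteq> V - X" by (simp add: profiled_def)
      then have fS: "finite S" using fin finite_subset by blast
      have "card (part p (S \<union> X) l) = card (part p S l) + card (part p X l)" for l
        unfolding part_Un using fS fX sub by (intro card_Un_disjoint) (auto simp: part_def)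
      then show "S \<union> X \<in> profiled p V i j k"
        using S sub X le by (auto simp: profiled_def)
    qed
  qed (auto simp: profiled_def)
  then have "card {S \<in> profiled p V i j k. X \<subseteq> S} =
    card (profiled p (V - X) (i - card (part p X 0)) (j - card (part p X 1)) (k - card (part p X 2)))"
    by (rule bij_betw_same_card)
  then show ?thesis using card_profiled[of p "V - X"] lab fin by simp
qed

lemma copies_model:
  assumes lab: "\<And>x. p x < (3 :: nat)" and fin: "finite V"
  shows "copies (model p) V = profiled p V 2 1 3 \<union> profiled p V 2 3 1"
    and "profiled p V 2 1 3 \<inter> profiled p V 2 3 1 = {}"
proof -
  have 1: "is_copy (model p) S \<longleftrightarrow> S \<in> profiled p V 2 1 3 \<union> profiled p V 2 3 1" if "S \<subseteq> V" for S
    using that is_copy_model_iff[of p S] lab fin finite_subset[OF that fin] by (auto simp: profiled_def)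
  have 2: "card S = 6" if "S \<in> profiled p V 2 1 3 \<union> profiled p V 2 3 1" for S
    using that card_parts[of p S] lab finite_subset[OF _ fin] by (auto simp: profiled_def)
  show "copies (model p) V = profiled p V 2 1 3 \<union> profiled p V 2 3 1"
  proof (intro set_eqI iffI)
    fix S assume "S \<in> copies (model p) V"
    then show "S \<in> profiled p V 2 1 3 \<union> profiled p V 2 3 1"
      using 1[of S] by (auto simp: copies_def six_sets_def)
  next
    fix S assume S: "S \<in> profiled p V 2 1 3 \<union> profiled p V 2 3 1"
    then have "S \<subseteq> V" by (auto simp: profiled_def)
    then show "S \<in> copies (model p) V" using 1[of S] 2[OF S] S by (auto simp: copies_def six_sets_def)
  qed
  show "profiled p V 2 1 3 \<inter> profiled p V 2 3 1 = {}" by (auto simp: profiled_def)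
qed

lemma finite_copies: "finite V \<Longrightarrow> finite (copies E V)"
  by (simp add: copies_def finite_six_sets)

lemma finite_profiled: "finite V \<Longrightarrow> finite (profiled p V i j k)"
  by (rule finite_subset[of _ "Pow V"]) (auto simp: profiled_def)

lemma card_copies_model:
  assumes "\<And>x. p x < (3 :: nat)" "finite V"
  shows "card (copies (model p) V) =
    (card (part p V 0) choose 2) *
      (card (part p V 1) * (card (part p V 2) choose 3) + (card (part p V 1) choose 3) * card (part p V 2))"
proof -
  have "card (copies (model p) V) = card (profiled p V 2 1 3) + card (profiled p V 2 3 1)"
    unfolding copies_model(1)[of p V, OF assms]
    by (intro card_Un_disjoint finite_profiled assms copies_model(2))
  then show ?thesis using card_profiled[of p V] assms by (simp add: algebra_simps)
qed

lemma card_copies_model_containing: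
  assumes "\<And>x. p x < (3 :: nat)" "finite V"
  shows "card {S \<in> copies (model p) V. X \<subseteq> S} =
    card {S \<in> profiled p V 2 1 3. X \<subseteq> S} + card {S \<in> profiled p V 2 3 1. X \<subseteq> S}"
proof -
  have "{S \<in> copies (model p) V. X \<subseteq> S} =
      {S \<in> profiled p V 2 1 3. X \<subseteq> S} \<union> {S \<in> profiled p V 2 3 1. X \<subseteq> S}"
    unfolding copies_model(1)[of p V, OF assms] by auto
  also have "card \<dots> = card {S \<in> profiled p V 2 1 3. X \<subseteq> S} + card {S \<in> profiled p V 2 3 1. X \<subseteq> S}"
    using finite_profiled[OF assms(2)] copies_model(2)[of p V, OF assms]
    by (intro card_Un_disjoint) auto
  finally show ?thesis .
qed

lemma binomial_ge_third_pow:
  assumes "3 \<le> m" "m \<le> n" "k \<le> 3"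
  shows "(real m / 3) ^ k \<le> real (n choose k)"
proof (cases "k = 0")
  case False
  have "(real m / 3) ^ k \<le> (real n / real k) ^ k"
    using assms False by (intro power_mono frac_le) auto
  also have "\<dots> \<le> real (n choose k)"
    using binomial_ge_n_over_k_pow_k[of k n, where 'a = real] assms by simp
  finally show ?thesis .
qed simp

lemma card_part_Diff_ge:
  assumes "finite V" "card X \<le> k" "finite X" "m + k \<le> card (part p V j)"
  shows "m \<le> card (part p (V - X) j)"
proof -
  have "card (part p V j) - card (part p X j) \<le> card (part p (V - X) j)"
    unfolding part_Diff using assms by (intro diff_card_le_card_Diff) auto
  moreover have "card (part p X j) \<le> card X" using assms by (intro card_mono) (auto simp: part_def)
  ultimately show ?thesis using assms by linarith
qed

text \<open>
  Each pair of vertices extends to a set with one of the two profiles of copies, whatever the labels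
  of the pair: at most one of the parts 1 and 2 contains both vertices. Choosing the remaining four
  vertices gives the bound.
\<close>

lemma copies_through_pair:
  assumes lab: "\<And>x. p x < (3 :: nat)" and fin: "finite V" and ab: "a \<in> V" "b \<in> V" "a \<noteq> b"
    and m: "3 \<le> m" "\<And>j. j < 3 \<Longrightarrow> m + 2 \<le> card (part p V j)"
  shows "(real m / 3) ^ 4 \<le> real (card {S \<in> copies (model p) V. {a, b} \<subseteq> S})"
proof -
  let ?X = "{a, b}"
  have ge: "m \<le> card (part p (V - ?X) j)" if "j < 3" for j
    using card_part_Diff_ge[OF fin, of ?X 2 m p j] m(2)[OF that] ab(3) by simp
  have C: "(real m / 3) ^ k \<le> real (card (part p (V - ?X) j) choose k)" if "j < 3" "k \<le> 3" for j k
    using binomial_ge_third_pow[OF m(1) ge[OF that(1)] that(2)] .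
  have pX: "card (part p ?X j) = of_bool (p a = j) + of_bool (p b = j)" for j
  proof -
    have "part p ?X j = (if p a = j then {a} else {}) \<union> (if p b = j then {b} else {})"
      by (auto simp: part_def)
    then show ?thesis using ab(3) by auto
  qed
  have key: "(real m / 3) ^ 4 \<le> real (card {S \<in> profiled p V 2 l r. ?X \<subseteq> S})"
    if le: "card (part p ?X 0) \<le> 2" "card (part p ?X 1) \<le> l" "card (part p ?X 2) \<le> r"
      and lr: "l \<le> 3" "r \<le> 3" "l + r = 4" for l r
  proof -
    let ?i = "2 - card (part p ?X 0)" and ?j = "l - card (part p ?X 1)" and ?k = "r - card (part p ?X 2)"
    have "p a < 3" "p b < 3" using lab by auto
    then have "card (part p ?X 0) + card (part p ?X 1) + card (part p ?X 2) = 2"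
      using card_parts[of p ?X] lab ab(3) by simp
    then have "?i + ?j + ?k = 4" using le lr by linarith
    then have "(real m / 3) ^ 4 = (real m / 3) ^ ?i * (real m / 3) ^ ?j * (real m / 3) ^ ?k"
      by (metis power_add)
    also have "\<dots> \<le> real (card (part p (V - ?X) 0) choose ?i) * real (card (part p (V - ?X) 1) choose ?j) *
        real (card (part p (V - ?X) 2) choose ?k)"
      using lr by (intro mult_mono C) auto
    also have "\<dots> = real (card {S \<in> profiled p V 2 l r. ?X \<subseteq> S})"
      using card_profiled_containing[of p V ?X 2 l r] lab fin ab le by simp
    finally show ?thesis .
  qed
  have le2: "card (part p ?X j) \<le> 2" for j unfolding pX by (simp add: of_bool_def)
  have "card (part p ?X 1) \<le> 1 \<or> card (part p ?X 2) \<le> 1"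
    unfolding pX by (cases "p a = 1"; cases "p b = 1") auto
  then have "(real m / 3) ^ 4 \<le> real (card {S \<in> profiled p V 2 1 3. ?X \<subseteq> S}) \<or>
      (real m / 3) ^ 4 \<le> real (card {S \<in> profiled p V 2 3 1. ?X \<subseteq> S})"
  proof
    assume "card (part p ?X 1) \<le> 1"
    then show ?thesis using key[of 1 3] le2[of 0] le2[of 2] by linarith
  next
    assume "card (part p ?X 2) \<le> 1"
    then show ?thesis using key[of 3 1] le2[of 0] le2[of 1] by linarith
  qed
  then show ?thesis
    unfolding card_copies_model_containing[of p V, OF lab fin] by auto
qed

section \<open>Copies through a vertex that fits no part\<close>

lemma real_choose_2: "real (n choose 2) = real n * (real n - 1) / 2"
  by (simp add: binomial_gbinomial gbinomial_prod_rev numeral_2_eq_2 lessThan_atLeast0[symmetric])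

lemma real_choose_3: "real (n choose 3) = real n * (real n - 1) * (real n - 2) / 6"
  by (simp add: binomial_gbinomial gbinomial_prod_rev numeral_3_eq_3 fact_numeral eval_nat_numeral)

lemma binomial_ge_pow:
  assumes "m + 2 \<le> n" "k \<le> 3"
  shows "real m ^ k / fact k \<le> real (n choose k)"
proof -
  have n: "real m \<le> real n - 2" using assms(1) by linarith
  consider "k = 0" | "k = 1" | "k = 2" | "k = 3" using assms(2) by linarith
  then show ?thesis
  proof cases
    case 3
    have "real m * real m \<le> real n * (real n - 1)" using n by (intro mult_mono) auto
    then show ?thesis using 3 by (simp add: real_choose_2 power2_eq_square)
  next
    case 4
    have "real m * real m * real m \<le> real n * (real n - 1) * (real n - 2)" using n by (intro mult_mono) auto
    then show ?thesis using 4 by (simp add: real_choose_3 power3_eq_cube fact_numeral)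
  qed (use n in auto)
qed

lemma binomial_le_pow_fact:
  assumes "real n \<le> t" "k \<le> 3"
  shows "real (n choose k) \<le> t ^ k / fact k"
proof -
  have t: "0 \<le> t" using assms(1) by (meson of_nat_0_le_iff order_trans)
  have "real (n choose k) \<le> real n ^ k / fact k"
  proof -
    consider "k = 0" | "k = 1" | "k = 2" | "k = 3" using assms(2) by linarith
    then show ?thesis
    proof cases
      case 3
      then show ?thesis by (simp add: real_choose_2 power2_eq_square mult_left_mono)
    next
      case 4
      show ?thesis
      proof (cases "2 \<le> n")
        case True
        then have "real n * (real n - 1) * (real n - 2) \<le> real n * real n * real n"
          by (intro mult_mono) auto
        then show ?thesis using 4 by (simp add: real_choose_3 power3_eq_cube fact_numeral)
      next
        case False
        then show ?thesis using 4 by (simp add: binomial_eq_0)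
      qed
    qed auto
  qed
  also have "\<dots> \<le> t ^ k / fact k" using assms t by (intro divide_right_mono power_mono) auto
  finally show ?thesis .
qed

text \<open>
  In the balanced blowup, about \<open>1/3 (n/3)^5\<close> copies pass through each vertex, in whichever part it
  lies.
\<close>

lemma copies_through_vertex:
  assumes lab: "\<And>x. p x < (3 :: nat)" and fin: "finite V" and v: "v \<in> V"
    and m: "\<And>j. j < 3 \<Longrightarrow> m + 3 \<le> card (part p V j)"
  shows "real m ^ 5 / 3 \<le> real (card {S \<in> copies (model p) V. v \<in> S})"
proof -
  have ge: "m + 2 \<le> card (part p (V - {v}) j)" if "j < 3" for j
    using card_part_Diff_ge[OF fin, of "{v}" 1 "m + 2" p j] m(1)[OF that] by simp
  have C: "real m ^ k / fact k \<le> real (card (part p (V - {v}) j) choose k)" if "j < 3" "k \<le> 3" for j k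
    using binomial_ge_pow[OF ge[OF that(1)] that(2)] .
  have pX: "card (part p {v} j) = of_bool (p v = j)" for j
  proof -
    have "part p {v} j = (if p v = j then {v} else {})" by (auto simp: part_def)
    then show ?thesis by auto
  qed
  have P: "real m ^ (i + j + k) / (fact i * fact j * fact k) \<le>
      real ((card (part p (V - {v}) 0) choose i) * (card (part p (V - {v}) 1) choose j) * (card (part p (V - {v}) 2) choose k))"
    if "i \<le> 3" "j \<le> 3" "k \<le> 3" for i j k
  proof -
    have "real m ^ (i + j + k) / (fact i * fact j * fact k) =
        real m ^ i / fact i * (real m ^ j / fact j) * (real m ^ k / fact k)"
      by (simp add: power_add)
    also have "\<dots> \<le> real (card (part p (V - {v}) 0) choose i) * real (card (part p (V - {v}) 1) choose j) *
        real (card (part p (V - {v}) 2) choose k)"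
      using that by (intro mult_mono C) auto
    finally show ?thesis by simp
  qed
  have through: "card {S \<in> copies (model p) V. v \<in> S} =
      card {S \<in> profiled p V 2 1 3. {v} \<subseteq> S} + card {S \<in> profiled p V 2 3 1. {v} \<subseteq> S}"
    using card_copies_model_containing[of p V "{v}", OF lab fin] by simp
  have eqs: "card {S \<in> profiled p V 2 1 3. {v} \<subseteq> S} =
      (card (part p (V - {v}) 0) choose (2 - of_bool (p v = 0))) *
      (card (part p (V - {v}) 1) choose (1 - of_bool (p v = 1))) *
      (card (part p (V - {v}) 2) choose (3 - of_bool (p v = 2)))"
    "card {S \<in> profiled p V 2 3 1. {v} \<subseteq> S} =
      (card (part p (V - {v}) 0) choose (2 - of_bool (p v = 0))) *
      (card (part p (V - {v}) 1) choose (3 - of_bool (p v = 1))) *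
      (card (part p (V - {v}) 2) choose (1 - of_bool (p v = 2)))"
    using card_profiled_containing[of p V "{v}" 2 1 3] card_profiled_containing[of p V "{v}" 2 3 1]
      lab fin v pX by (simp_all add: of_bool_def)
  have "p v = 0 \<or> p v = 1 \<or> p v = 2" using lab[of v] by linarith
  then show ?thesis
  proof (elim disjE)
    assume "p v = 0"
    then show ?thesis using P[of 1 1 3] P[of 1 3 1] unfolding through eqs by (simp add: fact_numeral)
  next
    assume "p v = 1"
    then show ?thesis using P[of 2 0 3] P[of 2 2 1] unfolding through eqs by (simp add: fact_numeral)
  next
    assume "p v = 2"
    then show ?thesis using P[of 2 1 2] P[of 2 3 0] unfolding through eqs by (simp add: fact_numeral)
  qed
qed

text \<open>
  Sets composed of given numbers of vertices from three sets; they count the ways to complete a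
  vertex to a copy.
\<close>

definition unions3 :: "nat \<Rightarrow> 'a set \<Rightarrow> nat \<Rightarrow> 'a set \<Rightarrow> nat \<Rightarrow> 'a set \<Rightarrow> 'a set set" where
  "unions3 i A j B k C =
     (\<lambda>(X, Y, Z). X \<union> Y \<union> Z) ` (subsets_of_size i A \<times> subsets_of_size j B \<times> subsets_of_size k C)"

lemma unions3I:
  "\<lbrakk>R = X \<union> Y \<union> Z; X \<subseteq> A; card X = i; Y \<subseteq> B; card Y = j; Z \<subseteq> C; card Z = k\<rbrakk>
    \<Longrightarrow> R \<in> unions3 i A j B k C"
  unfolding unions3_def subsets_of_size_def by (rule image_eqI[of _ _ "(X, Y, Z)"]) auto

lemma card_unions3:
  assumes "finite A" "finite B" "finite C"
  shows "finite (unions3 i A j B k C)"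
    "card (unions3 i A j B k C) \<le> (card A choose i) * (card B choose j) * (card C choose k)"
proof -
  let ?D = "subsets_of_size i A \<times> subsets_of_size j B \<times> subsets_of_size k C"
  have fin: "finite ?D" using assms by (simp add: finite_subsets_of_size)
  then show "finite (unions3 i A j B k C)" by (simp add: unions3_def)
  have "card (unions3 i A j B k C) \<le> card ?D" unfolding unions3_def by (rule card_image_le[OF fin])
  then show "card (unions3 i A j B k C) \<le> (card A choose i) * (card B choose j) * (card C choose k)"
    using assms by (simp add: card_cartesian_product card_subsets_of_size)
qed

definition nbrs :: "('a \<Rightarrow> 'a \<Rightarrow> bool) \<Rightarrow> ('a \<Rightarrow> nat) \<Rightarrow> 'a set \<Rightarrow> 'a \<Rightarrow> nat \<Rightarrow> 'a set" where
  "nbrs E p V v j = {x \<in> V - {v}. p x = j \<and> E v x}"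

definition non_nbrs :: "('a \<Rightarrow> 'a \<Rightarrow> bool) \<Rightarrow> ('a \<Rightarrow> nat) \<Rightarrow> 'a set \<Rightarrow> 'a \<Rightarrow> nat \<Rightarrow> 'a set" where
  "non_nbrs E p V v j = {x \<in> V - {v}. p x = j \<and> \<not> E v x}"

text \<open>
  Outside of \<open>v\<close> the graph is a blowup, but \<open>v\<close> may be adjacent to any vertices. The vertex \<open>v\<close>
  plays one of three roles in a copy: an end of the isolated edge, the centre of the star, or a
  leaf. In each role the labels of the other vertices are determined up to exchanging parts 1 and 2.
\<close>

lemma copy_through_vertex_cases:
  assumes sym: "\<And>x y. E x y = E y x" and lab: "\<And>x. p x < (3 :: nat)"
    and S: "S \<subseteq> V" "v \<in> S" "is_copy E S"
    and agree: "\<And>x y. x \<in> V - {v} \<Longrightarrow> y \<in> V - {v} \<Longrightarrow> x \<noteq> y \<Longrightarrow> E x y = model p x y"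
  defines "N \<equiv> nbrs E p V v" and "M \<equiv> non_nbrs E p V v"
  shows "S - {v} \<in> unions3 1 (N 0) 1 (M 1) 3 (M 2) \<union> unions3 1 (N 0) 3 (M 1) 1 (M 2) \<union>
    (unions3 2 (M 0) 3 (N 1) 0 (N 2) \<union> unions3 2 (M 0) 0 (N 1) 3 (N 2)) \<union>
    (unions3 2 (M 0) 1 (N 1) 2 (M 2) \<union> unions3 2 (M 0) 2 (M 1) 1 (N 2))"
proof -
  obtain c u x y z w where Seq: "S = {c, u, x, y, z, w}" and dist: "distinct [c, u, x, y, z, w]"
    and F: "rows E [c, u, x, y, z, w] = F12_rows" using S(3) unfolding is_copy_iff by blast
  have lab3: "p x = 0 \<or> p x = 1 \<or> p x = 2" for x using lab[of x] by linarith
  have edge_end: ?thesis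
    if "S - {v} = {w, c, x, y, z}" "distinct [v, w, c, x, y, z]" "E v w" "\<not> E v c" "\<not> E v x" "\<not> E v y" "\<not> E v z"
      "E c x" "E c y" "E c z" "\<not> E x y" "\<not> E x z" "\<not> E y z" "\<not> E w c" "\<not> E w x" for w c x y z
  proof -
    have inV: "{w, c, x, y, z} \<subseteq> V - {v}" using that(1) S(1) by blast
    have b: "B12_adj (p c) (p x)" "B12_adj (p c) (p y)" "B12_adj (p c) (p z)" "\<not> B12_adj (p x) (p y)"
        "\<not> B12_adj (p w) (p c)" "\<not> B12_adj (p w) (p x)"
      using that inV agree by (auto simp: model_def)
    have "p c = 1 \<and> p x = 2 \<and> p y = 2 \<and> p z = 2 \<and> p w = 0 \<or> p c = 2 \<and> p x = 1 \<and> p y = 1 \<and> p z = 1 \<and> p w = 0"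
      using b lab3[of w] unfolding B12_adj_def by (elim disjE conjE; simp)
    then show ?thesis
    proof (elim disjE conjE)
      assume "p c = 1" "p x = 2" "p y = 2" "p z = 2" "p w = 0"
      then have "S - {v} \<in> unions3 1 (N 0) 1 (M 1) 3 (M 2)"
        using that inV by (intro unions3I[of _ "{w}" "{c}" "{x, y, z}"]) (auto simp: N_def M_def nbrs_def non_nbrs_def)
      then show ?thesis by blast
    next
      assume "p c = 2" "p x = 1" "p y = 1" "p z = 1" "p w = 0"
      then have "S - {v} \<in> unions3 1 (N 0) 3 (M 1) 1 (M 2)"
        using that inV by (intro unions3I[of _ "{w}" "{x, y, z}" "{c}"]) (auto simp: N_def M_def nbrs_def non_nbrs_def)
      then show ?thesis by blast
    qed
  qed
  have centre: ?thesis
    if "S - {v} = {u, w, x, y, z}" "distinct [v, u, w, x, y, z]" "\<not> E v u" "\<not> E v w" "E v x" "E v y" "E v z"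
      "E u w" "\<not> E x y" "\<not> E x z" "\<not> E y z" "\<not> E u x" "\<not> E u y" "\<not> E u z" "\<not> E w x" "\<not> E w y" for u w x y z
  proof -
    have inV: "{u, w, x, y, z} \<subseteq> V - {v}" using that(1) S(1) by blast
    have b: "B12_adj (p u) (p w)" "\<not> B12_adj (p x) (p y)" "\<not> B12_adj (p x) (p z)" "\<not> B12_adj (p y) (p z)"
        "\<not> B12_adj (p u) (p x)" "\<not> B12_adj (p u) (p y)" "\<not> B12_adj (p u) (p z)" "\<not> B12_adj (p w) (p x)" "\<not> B12_adj (p w) (p y)"
      using that inV agree by (auto simp: model_def)
    have "p u = 0 \<and> p w = 0 \<and> (p x = 1 \<and> p y = 1 \<and> p z = 1 \<or> p x = 2 \<and> p y = 2 \<and> p z = 2)"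
      using b lab3[of x] lab3[of y] lab3[of z] unfolding B12_adj_def by (elim disjE conjE; simp)
    then show ?thesis
    proof (elim disjE conjE)
      assume "p u = 0" "p w = 0" "p x = 1" "p y = 1" "p z = 1"
      then have "S - {v} \<in> unions3 2 (M 0) 3 (N 1) 0 (N 2)"
        using that inV by (intro unions3I[of _ "{u, w}" "{x, y, z}" "{}"]) (auto simp: N_def M_def nbrs_def non_nbrs_def)
      then show ?thesis by blast
    next
      assume "p u = 0" "p w = 0" "p x = 2" "p y = 2" "p z = 2"
      then have "S - {v} \<in> unions3 2 (M 0) 0 (N 1) 3 (N 2)"
        using that inV by (intro unions3I[of _ "{u, w}" "{}" "{x, y, z}"]) (auto simp: N_def M_def nbrs_def non_nbrs_def)
      then show ?thesis by blast
    qed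
  qed
  have leaf: ?thesis
    if "S - {v} = {u, w, c, y, z}" "distinct [v, u, w, c, y, z]" "\<not> E v u" "\<not> E v w" "E v c" "\<not> E v y" "\<not> E v z"
      "E u w" "E c y" "E c z" "\<not> E y z" "\<not> E u c" "\<not> E u y" "\<not> E w c" "\<not> E w y" for u w c y z
  proof -
    have inV: "{u, w, c, y, z} \<subseteq> V - {v}" using that(1) S(1) by blast
    have b: "B12_adj (p u) (p w)" "B12_adj (p c) (p y)" "B12_adj (p c) (p z)" "\<not> B12_adj (p y) (p z)"
        "\<not> B12_adj (p u) (p c)" "\<not> B12_adj (p u) (p y)" "\<not> B12_adj (p w) (p c)" "\<not> B12_adj (p w) (p y)"
      using that inV agree by (auto simp: model_def)
    have "p u = 0 \<and> p w = 0 \<and> (p c = 1 \<and> p y = 2 \<and> p z = 2 \<or> p c = 2 \<and> p y = 1 \<and> p z = 1)"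
      using b lab3[of u] lab3[of w] unfolding B12_adj_def by (elim disjE conjE; simp)
    then show ?thesis
    proof (elim disjE conjE)
      assume "p u = 0" "p w = 0" "p c = 1" "p y = 2" "p z = 2"
      then have "S - {v} \<in> unions3 2 (M 0) 1 (N 1) 2 (M 2)"
        using that inV by (intro unions3I[of _ "{u, w}" "{c}" "{y, z}"]) (auto simp: N_def M_def nbrs_def non_nbrs_def)
      then show ?thesis by blast
    next
      assume "p u = 0" "p w = 0" "p c = 2" "p y = 1" "p z = 1"
      then have "S - {v} \<in> unions3 2 (M 0) 2 (M 1) 1 (N 2)"
        using that inV by (intro unions3I[of _ "{u, w}" "{y, z}" "{c}"]) (auto simp: N_def M_def nbrs_def non_nbrs_def)
      then show ?thesis by blast
    qed
  qed
  have R: "E c x" "E c y" "E c z" "E u w" "\<not> E c u" "\<not> E c w" "\<not> E u x" "\<not> E u y" "\<not> E u z"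
      "\<not> E x y" "\<not> E x z" "\<not> E y z" "\<not> E x w" "\<not> E y w" "\<not> E z w"
    using F by (simp_all add: rows_F12_iff)
  have R': "E x c" "E y c" "E z c" "E w u" "\<not> E u c" "\<not> E w c" "\<not> E x u" "\<not> E y u" "\<not> E z u"
      "\<not> E y x" "\<not> E z x" "\<not> E z y" "\<not> E w x" "\<not> E w y" "\<not> E w z"
    using R sym by blast+
  consider "v = c" | "v = u" | "v = w" | "v = x" | "v = y" | "v = z" using S(2) Seq by auto
  then show ?thesis
  proof cases
    case 1
    show ?thesis using dist R R' Seq 1 by (intro centre[of u w x y z]) auto
  next
    case 2
    show ?thesis using dist R R' Seq 2 by (intro edge_end[of w c x y z]) auto
  next
    case 3
    show ?thesis using dist R R' Seq 3 by (intro edge_end[of u c x y z]) auto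
  next
    case 4
    show ?thesis using dist R R' Seq 4 by (intro leaf[of u w c y z]) auto
  next
    case 5
    show ?thesis using dist R R' Seq 5 by (intro leaf[of u w c x z]) auto
  next
    case 6
    show ?thesis using dist R R' Seq 6 by (intro leaf[of u w c x y]) auto
  qed
qed

text \<open>
  If \<open>v\<close> is adjacent to the fractions \<open>a\<close>, \<open>b\<close>, \<open>c\<close> of parts 0, 1, 2, all of size \<open>t\<close>, this is the
  number of copies through \<open>v\<close> divided by \<open>t^5\<close>, up to lower order terms. The first summand counts
  copies in which \<open>v\<close> is an end of the isolated edge, and the second those in which it is the centre
  or a leaf of the star.
\<close>

definition vertex_form :: "real \<Rightarrow> real \<Rightarrow> real \<Rightarrow> real" where
  "vertex_form a b c =
     a * ((1 - b) * (1 - c) ^ 3 + (1 - c) * (1 - b) ^ 3) / 6 +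
     (1 - a)\<^sup>2 / 2 * ((b ^ 3 + c ^ 3) / 6 + b * (1 - c)\<^sup>2 / 2 + c * (1 - b)\<^sup>2 / 2)"

lemma vertex_form_swap: "vertex_form a b c = vertex_form a c b"
  by (simp add: vertex_form_def algebra_simps)

text \<open>
  The form takes the value \<open>1/3\<close> at \<open>(1,0,0)\<close>, \<open>(0,0,1)\<close> and \<open>(0,1,0)\<close>, where \<open>v\<close> behaves like a
  vertex of one of the three parts. For \<open>b \<le> c\<close> the correction term vanishes at the first two of
  them only, and its summands are easy to bound below.
\<close>

lemma vertex_form_le:
  assumes "0 \<le> a" "a \<le> 1" "0 \<le> b" "b \<le> c" "c \<le> 1"
  shows "vertex_form a b c \<le> 1 / 3 - (a * c / 3 + (1 - a) * ((1 - b) * (1 - c) / 3 + b * c / 6))"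
proof -
  define T where "T = (b ^ 3 + c ^ 3) / 6 + b * (1 - c)\<^sup>2 / 2 + c * (1 - b)\<^sup>2 / 2"
  define U where "U = (1 - b) * (1 - c) ^ 3 + (1 - c) * (1 - b) ^ 3"
  have T0: "0 \<le> T" using assms unfolding T_def by simp
  have "2 / 3 * (b + c) - b * c - T = b * (1 - b\<^sup>2) / 6 + c * (1 - c\<^sup>2) / 6 + b * c * (1 - (b + c) / 2)"
    unfolding T_def by (simp add: power2_eq_square power3_eq_cube field_simps)
  also have "\<dots> \<ge> 0" using assms by (intro add_nonneg_nonneg mult_nonneg_nonneg divide_nonneg_nonneg)
      (auto simp: power_le_one)
  finally have T: "T \<le> 2 / 3 * (b + c) - b * c" by simp
  have "U = (1 - b) * (1 - c) * ((1 - c)\<^sup>2 + (1 - b)\<^sup>2)"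
    unfolding U_def by (simp add: power2_eq_square power3_eq_cube algebra_simps)
  also have "\<dots> \<le> 1 * (1 - c) * (1 + 1)"
    using assms by (intro mult_mono add_mono power_le_one) auto
  finally have U: "U \<le> 2 * (1 - c)" by simp
  have "(1 - a)\<^sup>2 \<le> 1 - a"
    using assms mult_left_le[of "1 - a" "1 - a"] by (simp add: power2_eq_square)
  then have "(1 - a)\<^sup>2 / 2 * T \<le> (1 - a) / 2 * (2 / 3 * (b + c) - b * c)"
    using T0 T assms by (intro mult_mono) auto
  moreover have "a * U / 6 \<le> a * (2 * (1 - c)) / 6" using U assms by (intro divide_right_mono mult_left_mono) auto
  ultimately have "vertex_form a b c \<le> a * (2 * (1 - c)) / 6 + (1 - a) / 2 * (2 / 3 * (b + c) - b * c)"
    unfolding vertex_form_def T_def U_def by linarith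
  also have "\<dots> = 1 / 3 - (a * c / 3 + (1 - a) * ((1 - b) * (1 - c) / 3 + b * c / 6))"
    by (simp add: field_simps)
  finally show ?thesis .
qed

text \<open>
  The assumptions on \<open>e\<close> say that \<open>(a, b, c)\<close> has \<open>l1\<close> distance at least \<open>e\<close> from the three
  maximisers.
\<close>

lemma vertex_form_gap:
  assumes "0 \<le> a" "a \<le> 1" "0 \<le> b" "b \<le> 1" "0 \<le> c" "c \<le> 1" "0 \<le> e" "e \<le> 1"
    and dev: "e \<le> (1 - a) + b + c" "e \<le> a + b + (1 - c)" "e \<le> a + c + (1 - b)"
  shows "vertex_form a b c \<le> 1 / 3 - e / 48"
  using assms
proof (induction b c rule: linorder_wlog)
  case (sym b c)
  then show ?case using vertex_form_swap[of a b c] by (simp add: algebra_simps)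
next
  case (le b c)
  have "e / 48 \<le> a * c / 3 + (1 - a) * ((1 - b) * (1 - c) / 3 + b * c / 6)"
  proof -
    have nn: "0 \<le> a * c" "0 \<le> (1 - a) * ((1 - b) * (1 - c))" "0 \<le> (1 - a) * (b * c)" "0 \<le> b * c" "0 \<le> (1 - b) * (1 - c)"
      using le by auto
    have eq: "a * c / 3 + (1 - a) * ((1 - b) * (1 - c) / 3 + b * c / 6) =
        a * c / 3 + (1 - a) * ((1 - b) * (1 - c)) / 3 + (1 - a) * (b * c) / 6"
      by (simp add: field_simps)
    show ?thesis
    proof (cases "1 / 2 \<le> a")
      case a: True
      show ?thesis
      proof (cases "e / 4 \<le> c")
        case True
        then have "1 / 2 * (e / 4) \<le> a * c" using a le by (intro mult_mono) auto
        then show ?thesis using nn le eq by linarith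
      next
        case False
        then have "3 / 4 * (3 / 4) \<le> (1 - b) * (1 - c)" using le by (intro mult_mono) auto
        then have "e / 2 * (9 / 16) \<le> (1 - a) * ((1 - b) * (1 - c))" using le False by (intro mult_mono) auto
        then show ?thesis using nn le eq by linarith
      qed
    next
      case a: False
      show ?thesis
      proof (cases "c \<le> 1 / 2")
        case True
        then have "1 / 2 * (1 / 2) \<le> (1 - b) * (1 - c)" using le by (intro mult_mono) auto
        then have "1 / 2 * (1 / 4) \<le> (1 - a) * ((1 - b) * (1 - c))" using le a by (intro mult_mono) auto
        then show ?thesis using nn le eq by linarith
      next
        case c: False
        have 1: "a * (1 / 2) \<le> a * c" using c le by (intro mult_left_mono) auto
        show ?thesis
        proof (cases "b \<le> 1 / 2")
          case True
          have "1 / 2 * (1 - c) \<le> (1 - b) * (1 - c)" using True le by (intro mult_right_mono) auto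
          moreover have "b * (1 / 2) \<le> b * c" using c le by (intro mult_left_mono) auto
          ultimately have "1 / 2 * (1 - c) / 3 + b * (1 / 2) / 6 \<le> (1 - b) * (1 - c) / 3 + b * c / 6"
            by linarith
          then have "1 / 2 * (1 / 2 * (1 - c) / 3 + b * (1 / 2) / 6)
              \<le> (1 - a) * ((1 - b) * (1 - c) / 3 + b * c / 6)"
            using a le by (intro mult_mono) auto
          moreover have "1 / 2 * (1 / 2 * (1 - c) / 3 + b * (1 / 2) / 6) = (1 - c) / 12 + b / 24" by simp
          ultimately have "(1 - c) / 12 + b / 24 \<le> (1 - a) * ((1 - b) * (1 - c) / 3 + b * c / 6)" by simp
          moreover have "e \<le> 8 * a + (4 * (1 - c) + 2 * b)" using le by argo
          then have "e / 48 \<le> a / 6 + ((1 - c) / 12 + b / 24)" by (simp add: field_simps)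
          ultimately show ?thesis using 1 by linarith
        next
          case False
          then have "1 / 2 * (1 / 2) \<le> b * c" using c by (intro mult_mono) auto
          then have "1 / 2 * (1 / 4) \<le> (1 - a) * (b * c)" using a by (intro mult_mono) auto
          then show ?thesis using nn le eq by linarith
        qed
      qed
    qed
  qed
  then show ?case using vertex_form_le[of a b c] le by linarith
qed

text \<open>
  The left hand side lists the six cases of \<open>copy_through_vertex_cases\<close> in this order.
\<close>

lemma vertex_form_scale:
  "(t * a) * (t * (1 - b)) * ((t * (1 - c)) ^ 3 / 6) + (t * a) * ((t * (1 - b)) ^ 3 / 6) * (t * (1 - c)) +
    ((t * (1 - a)) ^ 2 / 2 * ((t * b) ^ 3 / 6) + (t * (1 - a)) ^ 2 / 2 * ((t * c) ^ 3 / 6)) +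
    ((t * (1 - a)) ^ 2 / 2 * (t * b) * ((t * (1 - c)) ^ 2 / 2) + (t * (1 - a)) ^ 2 / 2 * ((t * (1 - b)) ^ 2 / 2) * (t * c))
   = t ^ 5 * vertex_form a b c"
proof -
  have "t ^ 5 = t * t * (t * t * t)" by (simp add: eval_nat_numeral)
  then show ?thesis
    unfolding vertex_form_def power_mult_distrib by (simp add: power2_eq_square power3_eq_cube field_simps)
qed

text \<open>
  The wrong pairs at \<open>v\<close> if \<open>v\<close> had the label \<open>j\<close>, given by their other ends.
\<close>

definition deviation :: "('a \<Rightarrow> 'a \<Rightarrow> bool) \<Rightarrow> ('a \<Rightarrow> nat) \<Rightarrow> 'a set \<Rightarrow> 'a \<Rightarrow> nat \<Rightarrow> 'a set" where
  "deviation E p V v j = {y \<in> V - {v}. E v y \<noteq> B12_adj j (p y)}"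

lemma card_nbrs_non_nbrs:
  assumes "finite V"
  shows "card (nbrs E p V v j) + card (non_nbrs E p V v j) \<le> card (part p V j)"
proof -
  have "card (nbrs E p V v j) + card (non_nbrs E p V v j) = card (nbrs E p V v j \<union> non_nbrs E p V v j)"
    using assms by (intro card_Un_disjoint[symmetric]) (auto simp: nbrs_def non_nbrs_def)
  also have "\<dots> \<le> card (part p V j)"
    using assms by (intro card_mono) (auto simp: nbrs_def non_nbrs_def part_def)
  finally show ?thesis .
qed

lemma card_deviation:
  fixes E :: "'a \<Rightarrow> 'a \<Rightarrow> bool" and v :: 'a
  assumes lab: "\<And>x. p x < (3 :: nat)" and fin: "finite V"
  defines "N \<equiv> nbrs E p V v" and "M \<equiv> non_nbrs E p V v"
  shows "card (deviation E p V v 0) \<le> card (M 0) + card (N 1) + card (N 2)"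
    "card (deviation E p V v 1) \<le> card (N 0) + card (N 1) + card (M 2)"
    "card (deviation E p V v 2) \<le> card (N 0) + card (N 2) + card (M 1)"
proof -
  have finN: "finite (N j)" "finite (M j)" for j using fin by (auto simp: N_def M_def nbrs_def non_nbrs_def)
  have le3: "card D \<le> card X + card Y + card Z"
    if "D \<subseteq> X \<union> Y \<union> Z" "finite X" "finite Y" "finite Z" for D X Y Z :: "'a set"
  proof -
    have "card D \<le> card (X \<union> Y \<union> Z)" using that by (intro card_mono) auto
    also have "\<dots> \<le> card (X \<union> Y) + card Z" by (rule card_Un_le)
    also have "card (X \<union> Y) \<le> card X + card Y" by (rule card_Un_le)
    finally show ?thesis by simp
  qed
  have c: "p y = 0 \<or> p y = 1 \<or> p y = 2" for y using lab[of y] by linarith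
  have "deviation E p V v 0 \<subseteq> M 0 \<union> N 1 \<union> N 2"
  proof
    fix y show "y \<in> deviation E p V v 0 \<Longrightarrow> y \<in>  M 0 \<union> N 1 \<union> N 2"
      using c[of y] by (auto simp: deviation_def N_def M_def nbrs_def non_nbrs_def B12_adj_def)
  qed
  then show "card (deviation E p V v 0) \<le> card (M 0) + card (N 1) + card (N 2)" by (intro le3 finN)
  have "deviation E p V v 1 \<subseteq> N 0 \<union> N 1 \<union> M 2"
  proof
    fix y show "y \<in> deviation E p V v 1 \<Longrightarrow> y \<in>  N 0 \<union> N 1 \<union> M 2"
      using c[of y] by (auto simp: deviation_def N_def M_def nbrs_def non_nbrs_def B12_adj_def)
  qed
  then show "card (deviation E p V v 1) \<le> card (N 0) + card (N 1) + card (M 2)" by (intro le3 finN)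
  have "deviation E p V v 2 \<subseteq> N 0 \<union> N 2 \<union> M 1"
  proof
    fix y show "y \<in> deviation E p V v 2 \<Longrightarrow> y \<in>  N 0 \<union> N 2 \<union> M 1"
      using c[of y] by (auto simp: deviation_def N_def M_def nbrs_def non_nbrs_def B12_adj_def)
  qed
  then show "card (deviation E p V v 2) \<le> card (N 0) + card (N 2) + card (M 1)" by (intro le3 finN)
qed

text \<open>
  If \<open>v\<close> deviates from each of the three parts on a positive fraction of the vertices, then its
  adjacencies are not those of a maximiser of \<open>vertex_form\<close>, so fewer copies pass through it than
  through a vertex of the blowup.
\<close>

lemma copies_through_deviating_vertex_le:
  assumes sym: "\<And>x y. E x y = E y x" and lab: "\<And>x. p x < (3 :: nat)" and fin: "finite V"
    and agree: "\<And>x y. x \<in> V - {v} \<Longrightarrow> y \<in> V - {v} \<Longrightarrow> x \<noteq> y \<Longrightarrow> E x y = model p x y"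
    and t: "0 < t" "\<And>j. j < 3 \<Longrightarrow> real (card (part p V j)) \<le> t"
    and e: "0 \<le> e" "e \<le> 1" and dev: "\<And>j. j < 3 \<Longrightarrow> e * t \<le> real (card (deviation E p V v j))"
  shows "real (card {S \<in> copies E V. v \<in> S}) \<le> t ^ 5 * (1 / 3 - e / 48)"
proof -
  let ?N = "nbrs E p V v" and ?M = "non_nbrs E p V v"
  define x where "x j = real (card (?N j)) / t" for j
  have finN: "finite (?N j)" "finite (?M j)" for j using fin by (auto simp: nbrs_def non_nbrs_def)
  have N: "real (card (?N j)) = t * x j" for j using t(1) by (simp add: x_def)
  have M: "real (card (?M j)) \<le> t * (1 - x j)" if "j < 3" for j
    using card_nbrs_non_nbrs[OF fin, of E p v j] t(2)[OF that] N[of j] by (simp add: algebra_simps)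
  have x0: "0 \<le> x j" for j using t(1) by (simp add: x_def)
  have x1: "x j \<le> 1" if "j < 3" for j
  proof -
    have "0 \<le> t * (1 - x j)" using M[OF that] by (meson of_nat_0_le_iff order_trans)
    then show ?thesis using t(1) by (simp add: zero_le_mult_iff)
  qed
  have CN: "real (card (?N j) choose k) \<le> (t * x j) ^ k / fact k" if "k \<le> 3" for j k
    using N[of j] that by (intro binomial_le_pow_fact) auto
  have CM: "real (card (?M j) choose k) \<le> (t * (1 - x j)) ^ k / fact k" if "j < 3" "k \<le> 3" for j k
    using M that by (intro binomial_le_pow_fact) auto
  have U: "real (card (unions3 i A j B k C)) \<le> a * b * c"
    if "finite A" "finite B" "finite C" "real (card A choose i) \<le> a" "real (card B choose j) \<le> b"
      "real (card C choose k) \<le> c" for i j k and A B C :: "'a set" and a b c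
  proof -
    have "real (card (unions3 i A j B k C)) \<le> real ((card A choose i) * (card B choose j) * (card C choose k))"
      using card_unions3(2)[OF that(1-3), of i j k] by (simp only: of_nat_le_iff)
    also have "\<dots> = real (card A choose i) * real (card B choose j) * real (card C choose k)" by simp
    also have "\<dots> \<le> a * b * c"
      using that by (intro mult_mono) (auto intro: order_trans[rotated])
    finally show ?thesis .
  qed
  let ?U1 = "unions3 1 (?N 0) 1 (?M 1) 3 (?M 2)" and ?U2 = "unions3 1 (?N 0) 3 (?M 1) 1 (?M 2)"
    and ?U3 = "unions3 2 (?M 0) 3 (?N 1) 0 (?N 2)" and ?U4 = "unions3 2 (?M 0) 0 (?N 1) 3 (?N 2)"
    and ?U5 = "unions3 2 (?M 0) 1 (?N 1) 2 (?M 2)" and ?U6 = "unions3 2 (?M 0) 2 (?M 1) 1 (?N 2)"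
  let ?a = "x 0" and ?b = "x 1" and ?c = "x 2"
  have b1: "real (card ?U1) \<le> (t * ?a) ^ 1 / fact 1 * ((t * (1 - ?b)) ^ 1 / fact 1) * ((t * (1 - ?c)) ^ 3 / fact 3)"
    by (intro U finN CN CM) auto
  have b2: "real (card ?U2) \<le> (t * ?a) ^ 1 / fact 1 * ((t * (1 - ?b)) ^ 3 / fact 3) * ((t * (1 - ?c)) ^ 1 / fact 1)"
    by (intro U finN CN CM) auto
  have b3: "real (card ?U3) \<le> (t * (1 - ?a)) ^ 2 / fact 2 * ((t * ?b) ^ 3 / fact 3) * ((t * ?c) ^ 0 / fact 0)"
    by (intro U finN CN CM) auto
  have b4: "real (card ?U4) \<le> (t * (1 - ?a)) ^ 2 / fact 2 * ((t * ?b) ^ 0 / fact 0) * ((t * ?c) ^ 3 / fact 3)"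
    by (intro U finN CN CM) auto
  have b5: "real (card ?U5) \<le> (t * (1 - ?a)) ^ 2 / fact 2 * ((t * ?b) ^ 1 / fact 1) * ((t * (1 - ?c)) ^ 2 / fact 2)"
    by (intro U finN CN CM) auto
  have b6: "real (card ?U6) \<le> (t * (1 - ?a)) ^ 2 / fact 2 * ((t * (1 - ?b)) ^ 2 / fact 2) * ((t * ?c) ^ 1 / fact 1)"
    by (intro U finN CN CM) auto
  let ?UU = "?U1 \<union> ?U2 \<union> (?U3 \<union> ?U4) \<union> (?U5 \<union> ?U6)"
  have finU: "finite ?UU" by (intro finite_UnI card_unions3(1) finN)
  have "card {S \<in> copies E V. v \<in> S} \<le> card ?UU"
  proof (rule card_inj_on_le[of "\<lambda>S. S - {v}"])
    show "inj_on (\<lambda>S. S - {v}) {S \<in> copies E V. v \<in> S}" by (auto simp: inj_on_def)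
    show "(\<lambda>S. S - {v}) ` {S \<in> copies E V. v \<in> S} \<subseteq> ?UU"
    proof (rule image_subsetI)
      fix S assume "S \<in> {S \<in> copies E V. v \<in> S}"
      then have "S \<subseteq> V" "v \<in> S" "is_copy E S" by (auto simp: copies_def six_sets_def)
      then show "S - {v} \<in> ?UU" by (rule copy_through_vertex_cases[of E p, OF sym lab _ _ _ agree])
    qed
  qed (rule finU)
  also have "card ?UU \<le> (card ?U1 + card ?U2 + (card ?U3 + card ?U4)) + (card ?U5 + card ?U6)"
    by (meson card_Un_le add_mono order_trans)
  finally have "real (card {S \<in> copies E V. v \<in> S}) \<le> real ((card ?U1 + card ?U2 + (card ?U3 + card ?U4)) + (card ?U5 + card ?U6))"
    by (simp only: of_nat_le_iff)
  also have "\<dots> \<le> t ^ 5 * vertex_form ?a ?b ?c"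
    using b1 b2 b3 b4 b5 b6 vertex_form_scale[of t ?a ?b ?c] by (simp add: fact_numeral)
  also have "\<dots> \<le> t ^ 5 * (1 / 3 - e / 48)"
  proof (intro mult_left_mono vertex_form_gap)
    have "e * t \<le> t * ((1 - ?a) + ?b + ?c)"
      using card_deviation(1)[of p V E v, OF lab fin] M[of 0] N[of 1] N[of 2] dev[of 0]
      by (simp add: distrib_left)
    then show "e \<le> (1 - ?a) + ?b + ?c" using t(1) by (simp add: mult.commute[of e])
    have "e * t \<le> t * (?a + ?b + (1 - ?c))"
      using card_deviation(2)[of p V E v, OF lab fin] M[of 2] N[of 0] N[of 1] dev[of 1]
      by (simp add: distrib_left)
    then show "e \<le> ?a + ?b + (1 - ?c)" using t(1) by (simp add: mult.commute[of e])
    have "e * t \<le> t * (?a + ?c + (1 - ?b))"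
      using card_deviation(3)[of p V E v, OF lab fin] M[of 1] N[of 0] N[of 2] dev[of 2]
      by (simp add: distrib_left)
    then show "e \<le> ?a + ?c + (1 - ?b)" using t(1) by (simp add: mult.commute[of e])
  qed (use x0 x1 e t(1) in auto)
  finally show ?thesis .
qed

section \<open>Repairing a nearly optimal graph\<close>

lemma finite_wrong_pairs: "finite V \<Longrightarrow> finite (wrong_pairs E p V)"
  by (rule finite_subset[of _ "Pow V"]) (auto simp: wrong_pairs_def)

lemma wrong_pairD: "e \<in> wrong_pairs E p V \<Longrightarrow> e \<subseteq> V \<and> card e = 2"
  by (auto simp: wrong_pairs_def)

lemma card_Union_le_mult:
  assumes "finite I" "\<And>i. i \<in> I \<Longrightarrow> card (A i) \<le> k"
  shows "card (\<Union>i\<in>I. A i) \<le> card I * k"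
proof -
  have "card (\<Union>i\<in>I. A i) \<le> (\<Sum>i\<in>I. card (A i))" by (rule card_UN_le[OF assms(1)])
  also have "\<dots> \<le> (\<Sum>i\<in>I. k)" by (rule sum_mono) (use assms in auto)
  finally show ?thesis by simp
qed

text \<open>
  A changed pair that avoids \<open>v\<close> affects at most \<open>n^3\<close> of the sets of six vertices through \<open>v\<close>. As
  the number of changed pairs is a small multiple of \<open>n^2\<close>, the total effect is small compared with
  \<open>n^5\<close>.
\<close>

lemma copies_through_perturb:
  assumes fin: "finite V" and v: "v \<in> V" and D: "finite D" "\<And>e. e \<in> D \<Longrightarrow> e \<subseteq> V - {v} \<and> card e = 2"
    and diff: "\<And>x y. x \<in> V \<Longrightarrow> y \<in> V \<Longrightarrow> x \<noteq> y \<Longrightarrow> E x y \<noteq> E' x y \<Longrightarrow> {x, y} \<in> D"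
  shows "card {S \<in> copies E V. v \<in> S} \<le> card {S \<in> copies E' V. v \<in> S} + card D * card V ^ 3"
proof -
  let ?B = "\<Union>e\<in>D. {S \<in> six_sets V. insert v e \<subseteq> S}"
  have finB: "finite ?B" using D(1) finite_six_sets[OF fin] by auto
  have "{S \<in> copies E V. v \<in> S} \<subseteq> {S \<in> copies E' V. v \<in> S} \<union> ?B"
  proof
    fix S assume S: "S \<in> {S \<in> copies E V. v \<in> S}"
    then have SV: "S \<in> six_sets V" "S \<subseteq> V" "is_copy E S" by (auto simp: copies_def six_sets_def)
    show "S \<in> {S \<in> copies E' V. v \<in> S} \<union> ?B"
    proof (cases "is_copy E' S")
      case True
      then show ?thesis using S SV by (auto simp: copies_def)
    next
      case False
      then obtain x y where "x \<in> S" "y \<in> S" "x \<noteq> y" "E x y \<noteq> E' x y"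
        using SV(3) is_copy_cong[of S E E'] by blast
      then have "{x, y} \<in> D" "insert v {x, y} \<subseteq> S" using diff[of x y] SV S by auto
      then show ?thesis using SV(1) by blast
    qed
  qed
  then have "card {S \<in> copies E V. v \<in> S} \<le> card ({S \<in> copies E' V. v \<in> S} \<union> ?B)"
    using finB finite_copies[OF fin] by (intro card_mono) auto
  also have "\<dots> \<le> card {S \<in> copies E' V. v \<in> S} + card ?B" by (rule card_Un_le)
  also have "card ?B \<le> card D * card V ^ 3"
  proof (rule card_Union_le_mult[OF D(1)])
    fix e assume e: "e \<in> D"
    then have "finite e" using D(2)[OF e] fin finite_subset by (metis Diff_subset subset_trans)
    then have "card (insert v e) = 3" using D(2)[OF e] by (simp add: subset_Diff_insert)
    then show "card {S \<in> six_sets V. insert v e \<subseteq> S} \<le> card V ^ 3"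
      using card_supersets_le[OF fin, of "insert v e"] v D(2)[OF e] by auto
  qed
  finally show ?thesis by simp
qed

definition fix_at :: "('a \<Rightarrow> nat) \<Rightarrow> 'a set \<Rightarrow> ('a \<Rightarrow> 'a \<Rightarrow> bool) \<Rightarrow> 'a \<Rightarrow> 'a \<Rightarrow> bool" where
  "fix_at p Y E x y = (if x \<in> Y \<or> y \<in> Y then model p x y else E x y)"

lemma fix_at_commute: "(\<And>x y. E x y = E y x) \<Longrightarrow> fix_at p Y E x y = fix_at p Y E y x"
  using model_commute[of p x y] by (auto simp: fix_at_def)

lemma wrong_pairs_fix_at: "wrong_pairs (fix_at p Y E) p V = {e \<in> wrong_pairs E p V. e \<inter> Y = {}}"
  by (auto simp: wrong_pairs_def fix_at_def split: if_splits)

lemma card_copies_split: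
  assumes "finite V"
  shows "card (copies E V) = card {S \<in> copies E V. v \<in> S} + card {S \<in> copies E V. v \<notin> S}"
proof -
  have "copies E V = {S \<in> copies E V. v \<in> S} \<union> {S \<in> copies E V. v \<notin> S}" by auto
  then have "card (copies E V) = card ({S \<in> copies E V. v \<in> S} \<union> {S \<in> copies E V. v \<notin> S})" by simp
  also have "\<dots> = card {S \<in> copies E V. v \<in> S} + card {S \<in> copies E V. v \<notin> S}"
    using finite_copies[OF assms] by (intro card_Un_disjoint) auto
  finally show ?thesis .
qed

text \<open>
  Sets that avoid \<open>v\<close> are not affected by the repair. Copies through \<open>v\<close> are few before the repair
  by \<open>copies_through_deviating_vertex_le\<close> and many afterwards by \<open>copies_through_vertex\<close>. Both
  lemmas speak about graphs that agree with a blowup away from \<open>v\<close>, so the wrong pairs away from \<open>v\<close>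
  enter as an error term on each side.
\<close>

lemma fix_vertex_gain:
  assumes sym: "\<And>x y. E x y = E y x" and lab: "\<And>x. p x < (3 :: nat)" and fin: "finite V"
    and v: "v \<in> V" "v \<notin> Y"
    and m: "\<And>j. j < 3 \<Longrightarrow> m + 3 \<le> card (part p V j)"
    and t: "0 < t" "\<And>j. j < 3 \<Longrightarrow> real (card (part p V j)) \<le> t"
    and e: "0 \<le> e" "e \<le> 1" and dev: "\<And>j. j < 3 \<Longrightarrow> e * t \<le> real (card (deviation (fix_at p Y E) p V v j))"
  shows "real (card (copies (fix_at p Y E) V)) +
      (real m ^ 5 / 3 - t ^ 5 * (1 / 3 - e / 48) - 2 * real (card (wrong_pairs E p V)) * real (card V) ^ 3)
    \<le> real (card (copies (fix_at p (insert v Y) E) V))"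
proof -
  let ?E1 = "fix_at p Y E" and ?E2 = "fix_at p (insert v Y) E"
  let ?D = "{e \<in> wrong_pairs E p V. v \<notin> e}"
  have D: "finite ?D" "\<And>e. e \<in> ?D \<Longrightarrow> e \<subseteq> V - {v} \<and> card e = 2"
    using finite_wrong_pairs[OF fin] wrong_pairD[of _ E p V] by auto
  have cD: "card ?D \<le> card (wrong_pairs E p V)" using finite_wrong_pairs[OF fin] by (intro card_mono) auto
  define E' where "E' x y = (if x = v \<or> y = v then ?E1 x y else model p x y)" for x y
  have sym1: "?E1 x y = ?E1 y x" for x y by (rule fix_at_commute[OF sym])
  have sym': "E' x y = E' y x" for x y unfolding E'_def using sym1[of x y] model_commute[of p x y] by auto
  have dev': "deviation E' p V v j = deviation ?E1 p V v j" for j by (auto simp: deviation_def E'_def)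
  have cD': "card ?D * card V ^ 3 \<le> card (wrong_pairs E p V) * card V ^ 3" using cD by simp
  have "card {S \<in> copies ?E1 V. v \<in> S} \<le> card {S \<in> copies E' V. v \<in> S} + card ?D * card V ^ 3"
    by (rule copies_through_perturb[OF fin v(1) D])
       (auto simp: E'_def fix_at_def wrong_pairs_def split: if_splits)
  then have "card {S \<in> copies ?E1 V. v \<in> S} \<le> card {S \<in> copies E' V. v \<in> S} + card (wrong_pairs E p V) * card V ^ 3"
    using cD' by linarith
  then have 1: "real (card {S \<in> copies ?E1 V. v \<in> S}) \<le>
      real (card {S \<in> copies E' V. v \<in> S} + card (wrong_pairs E p V) * card V ^ 3)" by (simp only: of_nat_le_iff)
  have 2: "real (card {S \<in> copies E' V. v \<in> S}) \<le> t ^ 5 * (1 / 3 - e / 48)"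
    by (rule copies_through_deviating_vertex_le[of E' p, OF sym' lab fin _ t e]) (auto simp: E'_def dev' dev)
  have "card {S \<in> copies (model p) V. v \<in> S} \<le> card {S \<in> copies ?E2 V. v \<in> S} + card ?D * card V ^ 3"
    by (rule copies_through_perturb[OF fin v(1) D])
       (auto simp: fix_at_def wrong_pairs_def split: if_splits)
  then have "card {S \<in> copies (model p) V. v \<in> S} \<le> card {S \<in> copies ?E2 V. v \<in> S} + card (wrong_pairs E p V) * card V ^ 3"
    using cD' by linarith
  then have 3: "real (card {S \<in> copies (model p) V. v \<in> S}) \<le>
      real (card {S \<in> copies ?E2 V. v \<in> S} + card (wrong_pairs E p V) * card V ^ 3)" by (simp only: of_nat_le_iff)
  have 4: "real m ^ 5 / 3 \<le> real (card {S \<in> copies (model p) V. v \<in> S})"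
    by (rule copies_through_vertex[of p, OF lab fin v(1) m])
  have "is_copy ?E1 S = is_copy ?E2 S" if "v \<notin> S" for S
    using that by (intro is_copy_cong) (auto simp: fix_at_def)
  then have 5: "{S \<in> copies ?E1 V. v \<notin> S} = {S \<in> copies ?E2 V. v \<notin> S}" by (auto simp: copies_def)
  show ?thesis
    using 1 2 3 4 card_copies_split[OF fin, of ?E1 v] card_copies_split[OF fin, of ?E2 v]
    unfolding 5 by simp
qed

lemma fix_set_gain:
  assumes "finite X" "X \<subseteq> V"
    and step: "\<And>v Y. v \<in> X \<Longrightarrow> Y \<subseteq> X \<Longrightarrow> v \<notin> Y \<Longrightarrow>
      real (card (copies (fix_at p Y E) V)) + g \<le> real (card (copies (fix_at p (insert v Y) E) V))"
  shows "real (card (copies E V)) + real (card X) * g \<le> real (card (copies (fix_at p X E) V))"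
proof -
  have "Y \<subseteq> X \<Longrightarrow> real (card (copies E V)) + real (card Y) * g \<le> real (card (copies (fix_at p Y E) V))"
    if "finite Y" for Y
    using that
  proof (induction Y)
    case empty
    have "fix_at p {} E = E" by (intro ext) (simp add: fix_at_def)
    then show ?case by simp
  next
    case (insert v Y)
    then show ?case using step[of v Y] by (simp add: algebra_simps)
  qed
  then show ?thesis using assms(1) by blast
qed

text \<open>
  Two pairs with a common vertex leave three vertices to choose, and there are at most \<open>2 d\<close> such
  partners of a pair. Two disjoint pairs leave only two vertices to choose.
\<close>

lemma card_sets_with_two_pairs_le:
  assumes fin: "finite V" and W: "\<And>e. e \<in> W \<Longrightarrow> e \<subseteq> V \<and> card e = 2"
    and d: "\<And>v. v \<in> V \<Longrightarrow> card {e \<in> W. v \<in> e} \<le> d"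
  shows "card {S \<in> six_sets V. \<exists>e1\<in>W. \<exists>e2\<in>W. e1 \<noteq> e2 \<and> e1 \<subseteq> S \<and> e2 \<subseteq> S}
    \<le> card W * (2 * d * card V ^ 3 + card W * card V ^ 2)" (is "card ?D \<le> _")
proof -
  let ?n = "card V"
  let ?meeting = "\<lambda>e1. {e2 \<in> W. e2 \<noteq> e1 \<and> e1 \<inter> e2 \<noteq> {}}" and ?disjoint = "\<lambda>e1. {e2 \<in> W. e1 \<inter> e2 = {}}"
  let ?above = "\<lambda>e1 e2. {S \<in> six_sets V. e1 \<union> e2 \<subseteq> S}"
  have finW: "finite W" using W fin by (intro finite_subset[of W "Pow V"]) auto
  have finD: "finite (\<Union>e1\<in>W. (\<Union>e2\<in>?meeting e1. ?above e1 e2) \<union> (\<Union>e2\<in>?disjoint e1. ?above e1 e2))"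
    using finW finite_six_sets[OF fin] by auto
  have sub: "?D \<subseteq> (\<Union>e1\<in>W. (\<Union>e2\<in>?meeting e1. ?above e1 e2) \<union> (\<Union>e2\<in>?disjoint e1. ?above e1 e2))"
  proof
    fix S assume "S \<in> ?D"
    then obtain e1 e2 where e: "e1 \<in> W" "e2 \<in> W" "e1 \<noteq> e2" "S \<in> ?above e1 e2" by auto
    then have "S \<in> (\<Union>e2\<in>?meeting e1. ?above e1 e2) \<union> (\<Union>e2\<in>?disjoint e1. ?above e1 e2)"
      by (cases "e1 \<inter> e2 = {}") (intro UnI2 UN_I[of e2], simp_all, intro disjI1 exI[of _ e2], simp)
    then show "S \<in> (\<Union>e1\<in>W. (\<Union>e2\<in>?meeting e1. ?above e1 e2) \<union> (\<Union>e2\<in>?disjoint e1. ?above e1 e2))"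
      by (rule UN_I[OF e(1)])
  qed
  show ?thesis
  proof (rule order_trans[OF card_mono[OF finD sub] card_Union_le_mult[OF finW]])
    fix e1 assume e1: "e1 \<in> W"
    have finite_pair: "finite e" if "e \<in> W" for e using W[OF that] fin finite_subset by blast
    have above: "card (?above e1 e2) \<le> ?n ^ (6 - card (e1 \<union> e2))" if "e2 \<in> W" for e2
    proof -
      have "card (e1 \<union> e2) \<le> 4" using card_Un_le[of e1 e2] W[OF e1] W[OF that] by linarith
      then show ?thesis using W[OF e1] W[OF that] by (intro card_supersets_le[OF fin]) auto
    qed
    have "card (\<Union>e2\<in>?meeting e1. ?above e1 e2) \<le> card (?meeting e1) * ?n ^ 3"
    proof (rule card_Union_le_mult)
      fix e2 assume e2: "e2 \<in> ?meeting e1"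
      then have c: "card e2 = 2" "finite e2" "card e1 = 2" "finite e1" using W e1 finite_pair by auto
      have "card (e1 \<union> e2) + card (e1 \<inter> e2) = 4" using card_Un_Int[of e1 e2] c by simp
      moreover have "card (e1 \<inter> e2) \<noteq> 0" using e2 c by auto
      moreover have "card (e1 \<inter> e2) < 2"
      proof (rule ccontr)
        assume "\<not> card (e1 \<inter> e2) < 2"
        then have "e1 \<inter> e2 = e1" "e1 \<inter> e2 = e2" using c by (metis card_seteq inf_le1 not_less, metis card_seteq inf_le2 not_less)
        then show False using e2 by auto
      qed
      ultimately have "card (e1 \<union> e2) = 3" by linarith
      then show "card (?above e1 e2) \<le> ?n ^ 3" using above[of e2] e2 by simp
    qed (use finW in auto)
    also have "\<dots> \<le> 2 * d * ?n ^ 3"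
    proof (rule mult_right_mono)
      obtain a b where ab: "e1 = {a, b}" using W[OF e1] by (meson card_2_iff)
      have "card (?meeting e1) \<le> card ({e \<in> W. a \<in> e} \<union> {e \<in> W. b \<in> e})"
        using finW ab by (intro card_mono) auto
      also have "\<dots> \<le> card {e \<in> W. a \<in> e} + card {e \<in> W. b \<in> e}" by (rule card_Un_le)
      also have "\<dots> \<le> d + d" using d[of a] d[of b] W[OF e1] ab by (intro add_mono) auto
      finally show "card (?meeting e1) \<le> 2 * d" by simp
    qed simp
    finally have A: "card (\<Union>e2\<in>?meeting e1. ?above e1 e2) \<le> 2 * d * ?n ^ 3" .
    have "card (\<Union>e2\<in>?disjoint e1. ?above e1 e2) \<le> card (?disjoint e1) * ?n ^ 2"
    proof (rule card_Union_le_mult)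
      fix e2 assume e2: "e2 \<in> ?disjoint e1"
      then have "card (e1 \<union> e2) = 4" using W[OF e1] W[of e2] finite_pair e1 by (simp add: card_Un_disjoint)
      then show "card (?above e1 e2) \<le> ?n ^ 2" using above[of e2] e2 by simp
    qed (use finW in auto)
    also have "\<dots> \<le> card W * ?n ^ 2" using finW by (intro mult_right_mono card_mono) auto
    finally have B: "card (\<Union>e2\<in>?disjoint e1. ?above e1 e2) \<le> card W * ?n ^ 2" .
    show "card ((\<Union>e2\<in>?meeting e1. ?above e1 e2) \<union> (\<Union>e2\<in>?disjoint e1. ?above e1 e2)) \<le> 2 * d * ?n ^ 3 + card W * ?n ^ 2"
      by (rule order_trans[OF card_Un_le add_mono[OF A B]])
  qed
qed

text \<open>
  Let every vertex be on at most \<open>d\<close> wrong pairs. A copy of the blowup with exactly one wrong pair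
  is lost, and each wrong pair is on at least \<open>q\<close> copies of the blowup. A new copy contains at least
  two wrong pairs. So up to the sets with two wrong pairs, the loss is \<open>q\<close> for every wrong pair. A
  set with two wrong pairs accounts for at most one new copy, and it has \<open>2^6 = 64\<close> subsets, so it
  contains at most 64 of the wrong pairs; this explains the factor 65.
\<close>

lemma copies_le_model_of_low_degree:
  assumes sym: "\<And>x y. E x y = E y x" and lab: "\<And>x. p x < (3 :: nat)" and fin: "finite V"
    and d: "\<And>v. v \<in> V \<Longrightarrow> card {e \<in> wrong_pairs E p V. v \<in> e} \<le> d"
    and q: "\<And>e. e \<in> wrong_pairs E p V \<Longrightarrow> q \<le> real (card {S \<in> copies (model p) V. e \<subseteq> S})"
  defines "W \<equiv> wrong_pairs E p V"
  shows "real (card (copies E V)) + q * real (card W) \<le>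
    real (card (copies (model p) V)) + 65 * (real (card W) * (2 * real d * real (card V) ^ 3 + real (card W) * real (card V) ^ 2))"
proof -
  let ?n = "card V"
  have finW: "finite W" unfolding W_def by (rule finite_wrong_pairs[OF fin])
  have W2: "e \<subseteq> V \<and> card e = 2 \<and> finite e" if "e \<in> W" for e
    using that wrong_pairD[of e E p V] fin finite_subset unfolding W_def by blast
  define D2 where "D2 = {S \<in> six_sets V. \<exists>e1\<in>W. \<exists>e2\<in>W. e1 \<noteq> e2 \<and> e1 \<subseteq> S \<and> e2 \<subseteq> S}"
  define C1 where "C1 = {S \<in> copies (model p) V. S \<notin> D2 \<and> (\<exists>e\<in>W. e \<subseteq> S)}"
  have finD2: "finite D2" unfolding D2_def using finite_six_sets[OF fin] by auto
  have finC1: "finite C1" unfolding C1_def using finite_copies[OF fin] by auto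
  have wrong_S: "wrong_pairs E p S = {e \<in> W. e \<subseteq> S}" if "S \<subseteq> V" for S
  proof (intro set_eqI iffI)
    fix e assume "e \<in> wrong_pairs E p S"
    then show "e \<in> {e \<in> W. e \<subseteq> S}" using that unfolding W_def wrong_pairs_def by auto
  next
    fix e assume e: "e \<in> {e \<in> W. e \<subseteq> S}"
    then obtain x y where "e = {x, y}" "x \<noteq> y" "E x y \<noteq> model p x y" unfolding W_def wrong_pairs_def by blast
    moreover have "x \<in> S" "y \<in> S" using e calculation(1) by auto
    ultimately show "e \<in> wrong_pairs E p S" unfolding wrong_pairs_def by blast
  qed
  \<comment> \<open>Every copy is a copy of the blowup without wrong pairs or contains two wrong pairs.\<close>
  have "copies E V \<subseteq> (copies (model p) V - C1) \<union> D2"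
  proof
    fix S assume "S \<in> copies E V"
    then have S: "S \<in> six_sets V" "S \<subseteq> V" "is_copy E S" by (auto simp: copies_def six_sets_def)
    show "S \<in> (copies (model p) V - C1) \<union> D2"
    proof (cases "S \<in> D2")
      case False
      then have none: "wrong_pairs E p S = {}"
        using is_copy_vs_labelling[of E p S, OF sym lab S(3)] wrong_S[OF S(2)] S(1) unfolding D2_def by blast
      then have "is_copy (model p) S" using S(3) is_copy_cong[of S E "model p"] by (auto simp: wrong_pairs_def)
      moreover have "S \<notin> C1" using none wrong_S[OF S(2)] by (auto simp: C1_def)
      ultimately show ?thesis using S(1) by (auto simp: copies_def)
    qed simp
  qed
  then have "card (copies E V) \<le> card ((copies (model p) V - C1) \<union> D2)"
    using finD2 finite_copies[OF fin] by (intro card_mono) auto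
  also have "\<dots> \<le> card (copies (model p) V - C1) + card D2" by (rule card_Un_le)
  also have "card (copies (model p) V - C1) = card (copies (model p) V) - card C1"
    using finC1 by (intro card_Diff_subset) (auto simp: C1_def)
  finally have 1: "real (card (copies E V)) \<le> real (card (copies (model p) V)) - real (card C1) + real (card D2)"
    using card_mono[OF finite_copies[OF fin, of "model p"], of C1] unfolding C1_def by auto
  \<comment> \<open>Wrong pairs with a copy of the blowup through them are counted in two ways.\<close>
  have "q * real (card W) \<le> (\<Sum>e\<in>W. real (card {S \<in> copies (model p) V. e \<subseteq> S}))"
    using sum_mono[of W "\<lambda>_. q"] q unfolding W_def by (simp add: mult.commute)
  also have "\<dots> = real (\<Sum>e\<in>W. \<Sum>S\<in>copies (model p) V. of_bool (e \<subseteq> S))"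
    using finite_copies[OF fin] by (simp add: sum_of_bool_eq Int_def)
  finally have 0: "q * real (card W) \<le> real (\<Sum>e\<in>W. \<Sum>S\<in>copies (model p) V. of_bool (e \<subseteq> S))" .
  have "(\<Sum>e\<in>W. \<Sum>S\<in>copies (model p) V. of_bool (e \<subseteq> S)) = (\<Sum>S\<in>copies (model p) V. card {e \<in> W. e \<subseteq> S})"
    using finW by (subst sum.swap) (simp add: sum_of_bool_eq Int_def)
  also have "\<dots> \<le> (\<Sum>S\<in>copies (model p) V. of_bool (S \<in> C1) + 64 * of_bool (S \<in> D2))"
  proof (rule sum_mono)
    fix S assume S: "S \<in> copies (model p) V"
    then have S6: "S \<in> six_sets V" "card S = 6" "finite S"
      using fin finite_subset by (auto simp: copies_def six_sets_def)
    show "card {e \<in> W. e \<subseteq> S} \<le> of_bool (S \<in> C1) + 64 * of_bool (S \<in> D2)"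
    proof (cases "S \<in> D2")
      case True
      have "card {e \<in> W. e \<subseteq> S} \<le> card (Pow S)" using S6 by (intro card_mono) auto
      then show ?thesis using True S6 by (simp add: card_Pow)
    next
      case False
      show ?thesis
      proof (cases "\<exists>e\<in>W. e \<subseteq> S")
        case True
        then obtain e where e: "e \<in> W" "e \<subseteq> S" by blast
        then have "{e \<in> W. e \<subseteq> S} = {e}" using False S6(1) unfolding D2_def by blast
        then show ?thesis using e S False by (auto simp: C1_def)
      next
        case none: False
        then have "{e \<in> W. e \<subseteq> S} = {}" by blast
        then show ?thesis by (simp only: card.empty zero_le)
      qed
    qed
  qed
  also have "\<dots> \<le> card C1 + 64 * card D2"
  proof -
    have "(\<Sum>S\<in>copies (model p) V. of_bool (S \<in> C1)) = card (copies (model p) V \<inter> C1)"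
      using finite_copies[OF fin] by (simp add: sum_of_bool_eq Int_def)
    also have "\<dots> \<le> card C1" using finC1 by (intro card_mono) auto
    finally have 1: "(\<Sum>S\<in>copies (model p) V. of_bool (S \<in> C1)) \<le> card C1" .
    have "(\<Sum>S\<in>copies (model p) V. of_bool (S \<in> D2)) = card (copies (model p) V \<inter> D2)"
      using finite_copies[OF fin] by (simp add: sum_of_bool_eq Int_def)
    also have "\<dots> \<le> card D2" using finD2 by (intro card_mono) auto
    finally have "(\<Sum>S\<in>copies (model p) V. of_bool (S \<in> D2)) \<le> card D2" .
    then show ?thesis using 1 by (simp add: sum.distrib flip: sum_distrib_left)
  qed
  finally have "real (\<Sum>e\<in>W. \<Sum>S\<in>copies (model p) V. of_bool (e \<subseteq> S)) \<le> real (card C1 + 64 * card D2)"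
    by (simp only: of_nat_le_iff)
  then have 2: "q * real (card W) \<le> real (card C1) + 64 * real (card D2)" using 0 by simp
  have "card D2 \<le> card W * (2 * d * ?n ^ 3 + card W * ?n ^ 2)"
    unfolding D2_def using W2 d by (intro card_sets_with_two_pairs_le[OF fin]) (auto simp: W_def)
  then have "real (card D2) \<le> real (card W * (2 * d * ?n ^ 3 + card W * ?n ^ 2))" by (simp only: of_nat_le_iff)
  then have 3: "real (card D2) \<le> real (card W) * (2 * real d * real ?n ^ 3 + real (card W) * real ?n ^ 2)" by simp
  show ?thesis using 1 2 3 by linarith
qed

lemma wrong_through_vertex:
  assumes sym: "\<And>x y. E x y = E y x" and v: "v \<in> V"
  shows "{e \<in> wrong_pairs E (p(v := j)) V. v \<in> e} = (\<lambda>y. {v, y}) ` deviation E p V v j"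
proof (intro set_eqI iffI)
  fix e assume "e \<in> {e \<in> wrong_pairs E (p(v := j)) V. v \<in> e}"
  then obtain x y where e: "e = {x, y}" "x \<in> V" "y \<in> V" "x \<noteq> y" "E x y \<noteq> model (p(v := j)) x y" "v \<in> {x, y}"
    unfolding wrong_pairs_def by blast
  then consider "v = x" | "v = y" by blast
  then show "e \<in> (\<lambda>y. {v, y}) ` deviation E p V v j"
  proof cases
    case 1
    then have "y \<in> deviation E p V v j" using e by (simp add: deviation_def model_def)
    then show ?thesis using e(1) 1 by blast
  next
    case 2
    then have "x \<in> deviation E p V v j"
      using e sym[of v x] B12_adj_commute[of j "p x"] by (simp add: deviation_def model_def)
    moreover have "e = {v, x}" using e(1) 2 by auto
    ultimately show ?thesis by blast
  qed
next
  fix e assume "e \<in> (\<lambda>y. {v, y}) ` deviation E p V v j"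
  then obtain y where "e = {v, y}" "y \<in> V" "y \<noteq> v" "E v y \<noteq> B12_adj j (p y)" by (auto simp: deviation_def)
  then have "E v y \<noteq> model (p(v := j)) v y" by (simp add: model_def)
  then show "e \<in> {e \<in> wrong_pairs E (p(v := j)) V. v \<in> e}"
    using \<open>e = {v, y}\<close> \<open>y \<in> V\<close> \<open>y \<noteq> v\<close> v unfolding wrong_pairs_def by blast
qed

lemma card_wrong_through_vertex:
  assumes "\<And>x y. E x y = E y x" "v \<in> V"
  shows "card {e \<in> wrong_pairs E (p(v := j)) V. v \<in> e} = card (deviation E p V v j)"
  unfolding wrong_through_vertex[of E, OF assms]
  by (rule card_image) (auto simp: inj_on_def deviation_def doubleton_eq_iff)

lemma wrong_avoiding_vertex:
  "{e \<in> wrong_pairs E (p(v := j)) V. v \<notin> e} = {e \<in> wrong_pairs E p V. v \<notin> e}"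
  unfolding wrong_pairs_def model_def by (auto split: if_splits)

text \<open>
  Otherwise giving \<open>v\<close> the label \<open>j\<close> would reduce the number of wrong pairs.
\<close>

lemma minimal_deviation:
  assumes sym: "\<And>x y. E x y = E y x" and lab: "\<And>x. p x < (3 :: nat)" and fin: "finite V"
    and minimal: "\<And>r. (\<And>x. r x < (3 :: nat)) \<Longrightarrow> card (wrong_pairs E p V) \<le> card (wrong_pairs E r V)"
    and v: "v \<in> V" and j: "j < 3"
  shows "card {e \<in> wrong_pairs E p V. v \<in> e} \<le> card (deviation E p V v j)"
proof -
  have split: "card (wrong_pairs E r V) = card {e \<in> wrong_pairs E r V. v \<in> e} + card {e \<in> wrong_pairs E r V. v \<notin> e}" for r
  proof -
    have "wrong_pairs E r V = {e \<in> wrong_pairs E r V. v \<in> e} \<union> {e \<in> wrong_pairs E r V. v \<notin> e}" by auto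
    then have "card (wrong_pairs E r V) = card ({e \<in> wrong_pairs E r V. v \<in> e} \<union> {e \<in> wrong_pairs E r V. v \<notin> e})" by simp
    then show ?thesis using finite_wrong_pairs[OF fin, of E r] by (simp add: card_Un_disjoint Int_def)
  qed
  have "card (wrong_pairs E p V) \<le> card (wrong_pairs E (p(v := j)) V)" using lab j by (intro minimal) auto
  then show ?thesis
    using split[of p] split[of "p(v := j)"] wrong_avoiding_vertex[of E p v j V]
      card_wrong_through_vertex[of E v V p j, OF sym v] by simp
qed

lemma combine_gains:
  fixes a b x :: real
  assumes "a \<le> b + x" "0 \<le> x" "n0 + 8 / 10 ^ 12 * x \<le> n1" "n1 + 1 / 10 ^ 12 * b \<le> n2"
  shows "a / 10 ^ 12 \<le> n2 - n0"
proof -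
  have "n0 + 8 * (x / 10 ^ 12) \<le> n1" "n1 + b / 10 ^ 12 \<le> n2" using assms(3,4) by simp_all
  moreover have "a / 10 ^ 12 \<le> b / 10 ^ 12 + x / 10 ^ 12" using assms(1) by (simp add: field_simps)
  moreover have "0 \<le> x / 10 ^ 12" using assms(2) by simp
  ultimately show ?thesis by linarith
qed

text \<open>
  Vertices on at least \<open>n / 10^7\<close> wrong pairs are called bad. By minimality of the labelling they
  deviate from every part, so repairing them gains at least \<open>g = 8 / 10^12 * n^5\<close> copies each.
  Afterwards all degrees in the graph of wrong pairs are small, and \<open>copies_le_model_of_low_degree\<close>
  applies. The repair removes at most \<open>n\<close> wrong pairs for each bad vertex, which its gain pays for.

  The constants are generous rather than optimal. What matters is their order: with the threshold
  \<open>e = 1 / 10^7\<close> the gain at a bad vertex is about \<open>e / 48 * (n/3)^5\<close>, roughly \<open>8.57 / 10^12 * n^5\<close>,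
  and the errors caused by the wrong pairs and by unequal parts are small multiples of
  \<open>n^5 / 10^15\<close>.
\<close>

lemma copies_le_model_of_minimal:
  assumes sym: "\<And>x y. E x y = E y x" and lab: "\<And>x. p x < (3 :: nat)" and fin: "finite V"
    and minimal: "\<And>r. (\<And>x. r x < (3 :: nat)) \<Longrightarrow> card (wrong_pairs E p V) \<le> card (wrong_pairs E r V)"
  defines "n \<equiv> real (card V)"
  assumes few: "real (card (wrong_pairs E p V)) \<le> n ^ 2 / 10 ^ 15"
    and parts: "\<And>j. j < 3 \<Longrightarrow> \<bar>real (card (part p V j)) - n / 3\<bar> \<le> n / 10 ^ 15"
    and large: "10 ^ 16 \<le> n"
  shows "real (card (wrong_pairs E p V)) * n ^ 4 / 10 ^ 12 \<le> real (card (copies (model p) V)) - real (card (copies E V))"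
proof -
  let ?W = "wrong_pairs E p V"
  define deg where "deg v = card {e \<in> ?W. v \<in> e}" for v
  define X where "X = {v \<in> V. n / 10 ^ 7 \<le> real (deg v)}"
  have n0: "0 < n" using large by (rule less_le_trans[rotated]) simp
  have finX: "finite X" "X \<subseteq> V" using fin by (auto simp: X_def)
  have finW: "finite ?W" by (rule finite_wrong_pairs[OF fin])
  \<comment> \<open>By double counting, few vertices are bad.\<close>
  have "(\<Sum>v\<in>V. deg v) = (\<Sum>v\<in>V. \<Sum>e\<in>?W. of_bool (v \<in> e))"
    using finW by (simp add: deg_def sum_of_bool_eq Int_def)
  also have "\<dots> = (\<Sum>e\<in>?W. \<Sum>v\<in>V. of_bool (v \<in> e))" by (rule sum.swap)
  also have "\<dots> = (\<Sum>e\<in>?W. 2)"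
  proof (rule sum.cong[OF refl])
    fix e assume e: "e \<in> ?W"
    have "(\<Sum>v\<in>V. of_bool (v \<in> e)) = card (V \<inter> e)" using fin by (simp add: sum_of_bool_eq Int_def)
    also have "V \<inter> e = e" using wrong_pairD[OF e] by auto
    finally show "(\<Sum>v\<in>V. of_bool (v \<in> e)) = (2 :: nat)" using wrong_pairD[OF e] by simp
  qed
  finally have degsum: "(\<Sum>v\<in>V. deg v) = 2 * card ?W" by simp
  have "real (card X) * (n / 10 ^ 7) \<le> (\<Sum>v\<in>X. real (deg v))"
    using sum_mono[of X "\<lambda>_. n / 10 ^ 7" "\<lambda>v. real (deg v)"] by (simp add: X_def)
  also have "\<dots> \<le> (\<Sum>v\<in>V. real (deg v))" using fin finX by (intro sum_mono2) auto
  also have "\<dots> = 2 * real (card ?W)" using degsum by (simp flip: of_nat_sum)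
  also have "\<dots> \<le> 2 * (n ^ 2 / 10 ^ 15)" using few by simp
  finally have "real (card X) * n \<le> (n / (5 * 10 ^ 7)) * n" by (simp add: power2_eq_square ac_simps)
  then have cX: "real (card X) \<le> n / (5 * 10 ^ 7)" using n0 by (simp only: mult_le_cancel_right)
  define m where "m = nat \<lfloor>n / 3 - n / 10 ^ 15\<rfloor> - 3"
  define t where "t = (1 / 3 + 1 / 10 ^ 15) * n"
  have t0: "0 < t" using n0 by (simp add: t_def)
  have m_le: "m + 3 \<le> card (part p V j)" if "j < 3" for j
  proof -
    have "n / 3 - n / 10 ^ 15 \<le> real (card (part p V j))" using parts[OF that] by linarith
    then have "\<lfloor>n / 3 - n / 10 ^ 15\<rfloor> \<le> int (card (part p V j))" by linarith
    moreover have "3 \<le> n / 3 - n / 10 ^ 15" using large by simp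
    then have "3 \<le> \<lfloor>n / 3 - n / 10 ^ 15\<rfloor>" by (simp add: le_floor_iff)
    ultimately show ?thesis unfolding m_def by linarith
  qed
  have m_ge: "(1 / 3 - 2 / 10 ^ 15) * n \<le> real m"
  proof -
    have "4 \<le> n / 10 ^ 15" using large by simp
    moreover have "n / 3 - n / 10 ^ 15 - 4 \<le> real m" unfolding m_def by linarith
    ultimately show ?thesis by (simp add: left_diff_distrib)
  qed
  have t_ge: "real (card (part p V j)) \<le> t" if "j < 3" for j
  proof -
    have "t = n / 3 + n / 10 ^ 15" by (simp add: t_def distrib_right)
    then show ?thesis using parts[OF that] by linarith
  qed
  define g where "g = 8 / 10 ^ 12 * n ^ 5"
  have gain: "real (card (copies (fix_at p Y E) V)) + g \<le> real (card (copies (fix_at p (insert v Y) E) V))"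
    if vY: "v \<in> X" "Y \<subseteq> X" "v \<notin> Y" for v Y
  proof -
    have v: "v \<in> V" "n / 10 ^ 7 \<le> real (deg v)" using vY(1) by (auto simp: X_def)
    \<comment> \<open>The deviation may shrink by earlier repairs, but only at the few bad vertices.\<close>
    have dev: "1 / 10 ^ 7 * t \<le> real (card (deviation (fix_at p Y E) p V v j))" if "j < 3" for j
    proof -
      have "deg v \<le> card (deviation E p V v j)"
        unfolding deg_def by (rule minimal_deviation[of E p, OF sym lab fin minimal v(1) that])
      moreover have "card (deviation E p V v j) - card X \<le> card (deviation E p V v j - X)"
        by (rule diff_card_le_card_Diff[OF finX(1)])
      moreover have "card (deviation E p V v j - X) \<le> card (deviation (fix_at p Y E) p V v j)"
        using fin vY by (intro card_mono) (auto simp: deviation_def fix_at_def)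
      ultimately have "real (deg v) - real (card X) \<le> real (card (deviation (fix_at p Y E) p V v j))" by linarith
      moreover have "1 / 10 ^ 7 * t \<le> n / 10 ^ 7 - n / (5 * 10 ^ 7)" using n0 by (simp add: t_def)
      ultimately show ?thesis using v(2) cX by linarith
    qed
    have "g \<le> real m ^ 5 / 3 - t ^ 5 * (1 / 3 - (1 / 10 ^ 7) / 48) - 2 * real (card ?W) * n ^ 3"
    proof -
      have "((1 / 3 - 2 / 10 ^ 15) * n) ^ 5 \<le> real m ^ 5" using m_ge n0 by (intro power_mono) auto
      moreover have "2 * real (card ?W) * n ^ 3 \<le> 2 * (n ^ 2 / 10 ^ 15) * n ^ 3"
        using few n0 by (intro mult_right_mono mult_left_mono) auto
      moreover have "2 * (n ^ 2 / 10 ^ 15) * n ^ 3 = 2 / 10 ^ 15 * n ^ 5" by (simp add: eval_nat_numeral)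
      moreover have "g + t ^ 5 * (1 / 3 - (1 / 10 ^ 7) / 48) + 2 / 10 ^ 15 * n ^ 5
          = (8 / 10 ^ 12 + (1 / 3 + 1 / 10 ^ 15) ^ 5 * (1 / 3 - (1 / 10 ^ 7) / 48) + 2 / 10 ^ 15) * n ^ 5"
        unfolding g_def t_def power_mult_distrib by (simp only: algebra_simps)
      moreover have "\<dots> \<le> ((1 / 3 - 2 / 10 ^ 15) ^ 5 / 3) * n ^ 5"
        using n0 by (intro mult_right_mono) (simp_all add: power_divide power_mult_distrib field_simps)
      moreover have "((1 / 3 - 2 / 10 ^ 15) ^ 5 / 3) * n ^ 5 = ((1 / 3 - 2 / 10 ^ 15) * n) ^ 5 / 3"
        by (simp only: power_mult_distrib times_divide_eq_left)
      ultimately show ?thesis by linarith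
    qed
    moreover have "real (card (copies (fix_at p Y E) V)) +
      (real m ^ 5 / 3 - t ^ 5 * (1 / 3 - (1 / 10 ^ 7) / 48) - 2 * real (card ?W) * real (card V) ^ 3)
        \<le> real (card (copies (fix_at p (insert v Y) E) V))"
      by (rule fix_vertex_gain[of E p, OF sym lab fin v(1) vY(3) m_le t0 t_ge _ _ dev]) auto
    ultimately show ?thesis unfolding n_def by linarith
  qed
  have fixed: "real (card (copies E V)) + real (card X) * g \<le> real (card (copies (fix_at p X E) V))"
    by (rule fix_set_gain[OF finX gain])
  \<comment> \<open>After the repair, only wrong pairs between vertices that are not bad remain.\<close>
  let ?E1 = "fix_at p X E"
  let ?W1 = "wrong_pairs ?E1 p V"
  have W1: "?W1 = {e \<in> ?W. e \<inter> X = {}}" by (rule wrong_pairs_fix_at)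
  have cW1: "card ?W1 \<le> card ?W" unfolding W1 using finW by (intro card_mono) auto
  define d where "d = nat \<lfloor>n / 10 ^ 7\<rfloor>"
  have d: "card {e \<in> ?W1. v \<in> e} \<le> d" if "v \<in> V" for v
  proof (cases "v \<in> X")
    case True
    then have "{e \<in> ?W1. v \<in> e} = {}" unfolding W1 by auto
    then show ?thesis by (simp only: card.empty zero_le)
  next
    case False
    have "card {e \<in> ?W1. v \<in> e} \<le> deg v" unfolding deg_def W1 using finW by (intro card_mono) auto
    moreover have "real (deg v) < n / 10 ^ 7" using False that by (simp add: X_def)
    ultimately show ?thesis unfolding d_def by linarith
  qed
  have q: "(n / 12) ^ 4 \<le> real (card {S \<in> copies (model p) V. e \<subseteq> S})" if eW: "e \<in> ?W1" for e
  proof -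
    obtain a b where ab: "e = {a, b}" "a \<in> V" "b \<in> V" "a \<noteq> b" using eW unfolding wrong_pairs_def by blast
    have m4: "n / 4 \<le> real m" using m_ge n0 by (simp add: left_diff_distrib)
    then have "(n / 12) ^ 4 \<le> (real m / 3) ^ 4" using n0 by (intro power_mono) auto
    also have "\<dots> \<le> real (card {S \<in> copies (model p) V. {a, b} \<subseteq> S})"
    proof (rule copies_through_pair[of p, OF lab fin ab(2-4)])
      have "12 \<le> n" using large by (rule order_trans[rotated]) simp
      then show "3 \<le> m" using m4 by linarith
      show "m + 2 \<le> card (part p V j)" if "j < 3" for j using m_le[OF that] by simp
    qed
    finally show ?thesis using ab(1) by simp
  qed
  have sym1: "?E1 x y = ?E1 y x" for x y by (rule fix_at_commute[OF sym])
  have "real (card (copies ?E1 V)) + (n / 12) ^ 4 * real (card ?W1) \<le> real (card (copies (model p) V)) +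
      65 * (real (card ?W1) * (2 * real d * real (card V) ^ 3 + real (card ?W1) * real (card V) ^ 2))"
    by (rule copies_le_model_of_low_degree[of ?E1 p, OF sym1 lab fin d q])
  moreover have "2 * real d * n ^ 3 + real (card ?W1) * n ^ 2 \<le> 3 / 10 ^ 7 * n ^ 4"
  proof -
    have "real d \<le> n / 10 ^ 7" unfolding d_def using n0 by (intro of_nat_floor) simp
    then have "2 * real d * n ^ 3 \<le> 2 * (n / 10 ^ 7) * n ^ 3" using n0 by (intro mult_right_mono) auto
    also have "\<dots> = 2 / 10 ^ 7 * n ^ 4" by (simp add: eval_nat_numeral)
    finally have A: "2 * real d * n ^ 3 \<le> 2 / 10 ^ 7 * n ^ 4" .
    have "real (card ?W1) * n ^ 2 \<le> n ^ 2 / 10 ^ 15 * n ^ 2"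
      using cW1 few by (intro mult_right_mono) auto
    also have "\<dots> = 1 / 10 ^ 15 * n ^ 4" by (simp add: eval_nat_numeral)
    finally have B: "real (card ?W1) * n ^ 2 \<le> 1 / 10 ^ 15 * n ^ 4" .
    have "2 / 10 ^ 7 * n ^ 4 + 1 / 10 ^ 15 * n ^ 4 = (2 / 10 ^ 7 + 1 / 10 ^ 15) * n ^ 4"
      by (simp only: distrib_right)
    also have "\<dots> \<le> 3 / 10 ^ 7 * n ^ 4" by (intro mult_right_mono) auto
    finally show ?thesis using A B by linarith
  qed
  then have "65 * (real (card ?W1) * (2 * real d * n ^ 3 + real (card ?W1) * n ^ 2)) \<le>
      65 * (real (card ?W1) * (3 / 10 ^ 7 * n ^ 4))"
    by (intro mult_left_mono) auto
  ultimately have "real (card (copies ?E1 V)) + (n / 12) ^ 4 * real (card ?W1) \<le>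
      real (card (copies (model p) V)) + 65 * (real (card ?W1) * (3 / 10 ^ 7 * n ^ 4))"
    unfolding n_def by linarith
  moreover have "(n / 12) ^ 4 * real (card ?W1) - 65 * (real (card ?W1) * (3 / 10 ^ 7 * n ^ 4)) =
      (1 / 20736 - 195 / 10 ^ 7) * (real (card ?W1) * n ^ 4)"
    by (simp add: power_divide field_simps)
  moreover have "1 / 10 ^ 12 * (real (card ?W1) * n ^ 4) \<le> (1 / 20736 - 195 / 10 ^ 7) * (real (card ?W1) * n ^ 4)"
    by (intro mult_right_mono) auto
  ultimately have rest: "real (card (copies ?E1 V)) + 1 / 10 ^ 12 * (real (card ?W1) * n ^ 4) \<le> real (card (copies (model p) V))"
    by linarith
  \<comment> \<open>Every other wrong pair is at a bad vertex.\<close>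
  have deg_le: "real (deg v) \<le> n" if "v \<in> V" for v
  proof -
    have "p = p(v := p v)" by simp
    then have "deg v = card (deviation E p V v (p v))"
      unfolding deg_def using card_wrong_through_vertex[of E v V p "p v", OF sym that] by simp
    also have "\<dots> \<le> card V" using fin by (intro card_mono) (auto simp: deviation_def)
    finally show ?thesis by (simp add: n_def)
  qed
  have "?W = ?W1 \<union> (\<Union>v\<in>X. {e \<in> ?W. v \<in> e})" unfolding W1 by auto
  then have "card ?W \<le> card ?W1 + card (\<Union>v\<in>X. {e \<in> ?W. v \<in> e})" by (metis card_Un_le)
  also have "card (\<Union>v\<in>X. {e \<in> ?W. v \<in> e}) \<le> (\<Sum>v\<in>X. deg v)"
    unfolding deg_def by (rule card_UN_le[OF finX(1)])
  finally have "real (card ?W) \<le> real (card ?W1) + (\<Sum>v\<in>X. real (deg v))" by (simp flip: of_nat_sum of_nat_add)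
  also have "(\<Sum>v\<in>X. real (deg v)) \<le> real (card X) * n"
    using sum_mono[of X "\<lambda>v. real (deg v)" "\<lambda>_. n"] deg_le finX(2) by (auto simp: subset_iff)
  finally have "real (card ?W) * n ^ 4 \<le> (real (card ?W1) + real (card X) * n) * n ^ 4"
    by (intro mult_right_mono) auto
  also have "\<dots> = real (card ?W1) * n ^ 4 + real (card X) * n ^ 5" by (simp add: eval_nat_numeral algebra_simps)
  finally have le: "real (card ?W) * n ^ 4 \<le> real (card ?W1) * n ^ 4 + real (card X) * n ^ 5" .
  have gX: "real (card X) * g = 8 / 10 ^ 12 * (real (card X) * n ^ 5)" by (simp add: g_def)
  have nonneg: "0 \<le> real (card X) * n ^ 5" using n0 by simp
  show ?thesis by (rule combine_gains[OF le nonneg fixed[unfolded gX] rest])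
qed

section \<open>A labelling with few wrong pairs\<close>

text \<open>
  A path on three vertices with centre \<open>c\<close> and a vertex \<open>u\<close> without neighbours among them.
\<close>

definition template :: "('a \<Rightarrow> 'a \<Rightarrow> bool) \<Rightarrow> 'a set \<Rightarrow> bool" where
  "template E T \<longleftrightarrow> (\<exists>u c x y. T = {u, c, x, y} \<and> distinct [u, c, x, y] \<and>
     E c x \<and> E c y \<and> \<not> E x y \<and> \<not> E u c \<and> \<not> E u x \<and> \<not> E u y)"

lemma copy_contains_template:
  assumes sym: "\<And>x y. E x y = E y x" and "is_copy E S"
  obtains T where "T \<subseteq> S" "template E T"
proof -
  obtain c u x y z w where S: "S = {c, u, x, y, z, w}" "distinct [c, u, x, y, z, w]"
    and F: "rows E [c, u, x, y, z, w] = F12_rows" using assms(2) unfolding is_copy_iff by blast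
  have "\<not> E c u" using F by (simp add: rows_F12_iff)
  then have "\<not> E u c" using sym[of u c] by blast
  then have "template E {u, c, x, y}" unfolding template_def
    using S(2) F by (intro exI[of _ u] exI[of _ c] exI[of _ x] exI[of _ y]) (auto simp: rows_F12_iff)
  then show thesis using that[of "{u, c, x, y}"] S(1) by blast
qed

text \<open>
  In a blowup the path uses both sides of the bipartite part, with \<open>c\<close> on one side and \<open>x\<close>, \<open>y\<close> on
  the other. A vertex \<open>a\<close> is thus on the side of \<open>x\<close> iff it is adjacent to \<open>c\<close>, on the side of \<open>c\<close>
  iff it is adjacent to \<open>x\<close>, and in the clique otherwise. As \<open>B12\<close> has an automorphism exchanging 1
  and 2, the side of \<open>c\<close> may be called part 1.
\<close>

lemma template_determines:
  assumes sym: "\<And>x y. E x y = E y x" and T: "template E T"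
  obtains p where "\<And>x. p x < (3 :: nat)"
    "\<And>a b. a \<notin> T \<Longrightarrow> b \<notin> T \<Longrightarrow> a \<noteq> b \<Longrightarrow> induces_blowup E (T \<union> {a, b}) \<Longrightarrow> E a b = model p a b"
proof -
  obtain u c x y where Teq: "T = {u, c, x, y}" and dist: "distinct [u, c, x, y]"
    and E: "E c x" "E c y" "\<not> E x y" "\<not> E u c" "\<not> E u x" "\<not> E u y"
    using T unfolding template_def by blast
  define p where "p v = (if E c v then 2 else if E x v then 1 else 0 :: nat)" for v
  have "E a b = model p a b" if ab: "a \<notin> T" "b \<notin> T" "a \<noteq> b" "induces_blowup E (T \<union> {a, b})" for a b
  proof -
    obtain q where q: "labelling E q (T \<union> {a, b})" using ab(4) by (auto simp: induces_blowup_def)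
    have lt: "q v < 3" if "v \<in> T \<union> {a, b}" for v using q that unfolding labelling_def by blast
    have qE: "E v w = B12_adj (q v) (q w)" if "v \<in> T \<union> {a, b}" "w \<in> T \<union> {a, b}" "v \<noteq> w" for v w
      using q that unfolding labelling_def by blast
    have mem: "u \<in> T \<union> {a, b}" "c \<in> T \<union> {a, b}" "x \<in> T \<union> {a, b}" "y \<in> T \<union> {a, b}"
      "a \<in> T \<union> {a, b}" "b \<in> T \<union> {a, b}" using Teq by auto
    have ne: "c \<noteq> a" "c \<noteq> b" "x \<noteq> a" "x \<noteq> b" using ab Teq by auto
    have t: "B12_adj (q c) (q x)" "B12_adj (q c) (q y)" "\<not> B12_adj (q x) (q y)"
      using E qE[OF mem(2,3)] qE[OF mem(2,4)] qE[OF mem(3,4)] dist by auto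
    have ca: "E c a = B12_adj (q c) (q a)" "E c b = B12_adj (q c) (q b)" "E x a = B12_adj (q x) (q a)" "E x b = B12_adj (q x) (q b)"
      "E a b = B12_adj (q a) (q b)"
      using qE[OF mem(2,5) ne(1)] qE[OF mem(2,6) ne(2)] qE[OF mem(3,5) ne(3)] qE[OF mem(3,6) ne(4)] qE[OF mem(5,6) ab(3)] by auto
    have cases_a: "q a = 0 \<or> q a = 1 \<or> q a = 2" "q b = 0 \<or> q b = 1 \<or> q b = 2" using lt[OF mem(5)] lt[OF mem(6)] by linarith+
    have "q c = 1 \<and> q x = 2 \<or> q c = 2 \<and> q x = 1"
      using t unfolding B12_adj_def by (elim disjE conjE; simp)
    then show ?thesis
    proof (elim disjE conjE)
      assume "q c = 1" "q x = 2"
      then have "p a = q a" "p b = q b" using cases_a ca by (auto simp: p_def B12_adj_def)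
      then show ?thesis using ca(5) by (simp add: model_def)
    next
      assume "q c = 2" "q x = 1"
      then have "p a = (if q a = 0 then 0 else 3 - q a)" "p b = (if q b = 0 then 0 else 3 - q b)"
        using cases_a ca by (auto simp: p_def B12_adj_def)
      then show ?thesis using ca(5) cases_a by (auto simp: model_def B12_adj_def)
    qed
  qed
  moreover have "p v < 3" for v by (simp add: p_def)
  ultimately show thesis using that by blast
qed

text \<open>
  With the labels read off from a template \<open>T\<close>, each wrong pair \<open>ab\<close> outside \<open>T\<close> gives a six-vertex
  set \<open>T \<union> {a, b}\<close> that does not induce a blowup, and at most \<open>4 n\<close> pairs meet \<open>T\<close>. Each copy
  contains a template, and a template is in at most \<open>n^2\<close> copies, so there are many templates, and
  some template lies in at most the average number of six-vertex sets that do not induce a blowup.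
\<close>

lemma exists_close_labelling:
  assumes sym: "\<And>x y. E x y = E y x" and fin: "finite V" and pos: "0 < card (copies E V)"
  defines "n \<equiv> real (card V)"
  obtains p where "\<And>x. p x < (3 :: nat)"
    "real (card (wrong_pairs E p V)) \<le> 4 * n + 64 * real (card {S \<in> six_sets V. \<not> induces_blowup E S}) * n ^ 2 / real (card (copies E V))"
proof -
  let ?B = "{S \<in> six_sets V. \<not> induces_blowup E S}"
  have finC: "finite (copies E V)" by (rule finite_copies[OF fin])
  have finB: "finite ?B" using finite_six_sets[OF fin] by simp
  have "\<forall>S\<in>copies E V. \<exists>T. T \<subseteq> S \<and> template E T"
    using copy_contains_template[of E, OF sym] unfolding copies_def by blast
  then obtain t where t: "\<And>S. S \<in> copies E V \<Longrightarrow> t S \<subseteq> S \<and> template E (t S)" by metis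
  let ?T = "t ` copies E V"
  have T4: "T \<subseteq> V \<and> card T = 4 \<and> finite T \<and> template E T" if "T \<in> ?T" for T
  proof -
    have "T \<subseteq> V" "template E T" using that t by (auto simp: copies_def six_sets_def)
    moreover have "card T = 4" using calculation(2) unfolding template_def by (elim exE conjE) simp
    ultimately show ?thesis using fin finite_subset by blast
  qed
  have finT: "finite ?T" using finC by simp
  have "copies E V \<subseteq> (\<Union>T\<in>?T. {S \<in> six_sets V. T \<subseteq> S})" using t by (auto simp: copies_def)
  then have "card (copies E V) \<le> card (\<Union>T\<in>?T. {S \<in> six_sets V. T \<subseteq> S})"
    using finite_six_sets[OF fin] by (intro card_mono finite_UN_I[OF finT]) auto
  also have "\<dots> \<le> card ?T * card V ^ 2"
  proof (rule card_Union_le_mult[OF finT])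
    fix T assume "T \<in> ?T"
    then show "card {S \<in> six_sets V. T \<subseteq> S} \<le> card V ^ 2"
      using card_supersets_le[OF fin, of T] T4[of T] by simp
  qed
  finally have N: "card (copies E V) \<le> card ?T * card V ^ 2" .
  have "(\<Sum>T\<in>?T. card {S \<in> ?B. T \<subseteq> S}) = (\<Sum>T\<in>?T. \<Sum>S\<in>?B. of_bool (T \<subseteq> S))"
    using finB by (simp add: sum_of_bool_eq Int_def)
  also have "\<dots> = (\<Sum>S\<in>?B. card {T \<in> ?T. T \<subseteq> S})"
    using finT by (subst sum.swap) (simp add: sum_of_bool_eq Int_def)
  also have "\<dots> \<le> (\<Sum>S\<in>?B. 64)"
  proof (rule sum_mono)
    fix S assume "S \<in> ?B"
    then have S: "card S = 6" "finite S" using fin finite_subset by (auto simp: six_sets_def)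
    have "card {T \<in> ?T. T \<subseteq> S} \<le> card (Pow S)" using S by (intro card_mono) auto
    then show "card {T \<in> ?T. T \<subseteq> S} \<le> 64" using S by (simp add: card_Pow)
  qed
  finally have config_total: "(\<Sum>T\<in>?T. card {S \<in> ?B. T \<subseteq> S}) \<le> 64 * card ?B" by simp
  have "\<exists>T\<in>?T. card ?T * card {S \<in> ?B. T \<subseteq> S} \<le> 64 * card ?B"
  proof (rule ccontr)
    assume "\<not> ?thesis"
    then have lt: "\<And>T. T \<in> ?T \<Longrightarrow> 64 * card ?B < card ?T * card {S \<in> ?B. T \<subseteq> S}" by (meson not_le)
    have ne: "?T \<noteq> {}" using pos by auto
    have "(\<Sum>T\<in>?T. 64 * card ?B) < (\<Sum>T\<in>?T. card ?T * card {S \<in> ?B. T \<subseteq> S})"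
      by (rule sum_strict_mono[OF finT ne lt])
    also have "\<dots> = card ?T * (\<Sum>T\<in>?T. card {S \<in> ?B. T \<subseteq> S})" by (simp only: sum_distrib_left)
    also have "\<dots> \<le> card ?T * (64 * card ?B)" by (intro mult_left_mono config_total) simp
    finally show False by simp
  qed
  then obtain T where T: "T \<in> ?T" "card ?T * card {S \<in> ?B. T \<subseteq> S} \<le> 64 * card ?B" by blast
  obtain p where p: "\<And>x. p x < (3 :: nat)"
    "\<And>a b. a \<notin> T \<Longrightarrow> b \<notin> T \<Longrightarrow> a \<noteq> b \<Longrightarrow> induces_blowup E (T \<union> {a, b}) \<Longrightarrow> E a b = model p a b"
    using template_determines[of E T, OF sym] T4[OF T(1)] by blast
  let ?W = "wrong_pairs E p V"
  have "?W \<subseteq> (\<Union>s\<in>T. (\<lambda>y. {s, y}) ` V) \<union> {e \<in> ?W. e \<inter> T = {}}"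
    unfolding wrong_pairs_def by blast
  then have "card ?W \<le> card ((\<Union>s\<in>T. (\<lambda>y. {s, y}) ` V) \<union> {e \<in> ?W. e \<inter> T = {}})"
    using fin T4[OF T(1)] finite_wrong_pairs[OF fin] by (intro card_mono) auto
  also have "\<dots> \<le> card (\<Union>s\<in>T. (\<lambda>y. {s, y}) ` V) + card {e \<in> ?W. e \<inter> T = {}}" by (rule card_Un_le)
  also have "card (\<Union>s\<in>T. (\<lambda>y. {s, y}) ` V) \<le> card T * card V"
    using T4[OF T(1)] by (intro card_Union_le_mult card_image_le fin) auto
  also have "card T = 4" using T4[OF T(1)] by simp
  also have "card {e \<in> ?W. e \<inter> T = {}} \<le> card {S \<in> ?B. T \<subseteq> S}"
  proof (rule card_inj_on_le[of "\<lambda>e. e \<union> T"])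
    show "inj_on (\<lambda>e. e \<union> T) {e \<in> ?W. e \<inter> T = {}}" by (auto simp: inj_on_def)
    show "(\<lambda>e. e \<union> T) ` {e \<in> ?W. e \<inter> T = {}} \<subseteq> {S \<in> ?B. T \<subseteq> S}"
    proof (rule image_subsetI)
      fix e assume e: "e \<in> {e \<in> ?W. e \<inter> T = {}}"
      then obtain a b where ab: "e = {a, b}" "a \<in> V" "b \<in> V" "a \<noteq> b" "E a b \<noteq> model p a b"
        unfolding wrong_pairs_def by blast
      then have "a \<notin> T" "b \<notin> T" using e by auto
      then have "\<not> induces_blowup E (T \<union> {a, b})" using p(2)[of a b] ab by blast
      moreover have "card (e \<union> T) = 6"
        using T4[OF T(1)] e ab by (subst card_Un_disjoint) auto
      ultimately show "e \<union> T \<in> {S \<in> ?B. T \<subseteq> S}"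
        using ab T4[OF T(1)] by (auto simp: six_sets_def Un_commute)
    qed
  qed (use finite_six_sets[OF fin] in auto)
  finally have W: "card ?W \<le> 4 * card V + card {S \<in> ?B. T \<subseteq> S}" by simp
  have "card (copies E V) * card {S \<in> ?B. T \<subseteq> S} \<le> card ?T * card V ^ 2 * card {S \<in> ?B. T \<subseteq> S}"
    using N by (rule mult_right_mono) simp
  also have "\<dots> = card ?T * card {S \<in> ?B. T \<subseteq> S} * card V ^ 2" by (simp only: ac_simps)
  also have "\<dots> \<le> 64 * card ?B * card V ^ 2" using T(2) by (rule mult_right_mono) simp
  finally have "real (card (copies E V) * card {S \<in> ?B. T \<subseteq> S}) \<le> real (64 * card ?B * card V ^ 2)"
    by (simp only: of_nat_le_iff)
  then have "real (card {S \<in> ?B. T \<subseteq> S}) \<le> 64 * real (card ?B) * n ^ 2 / real (card (copies E V))"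
    using pos by (simp add: n_def field_simps)
  moreover have "real (card ?W) \<le> 4 * n + real (card {S \<in> ?B. T \<subseteq> S})"
    using W unfolding n_def by linarith
  ultimately have "real (card ?W) \<le> 4 * n + 64 * real (card ?B) * n ^ 2 / real (card (copies E V))"
    by linarith
  with p(1) show thesis by (rule that)
qed

text \<open>
  With \<open>q = x (1 - x)^2\<close> one has \<open>96 f = q^2 - x^2 (b - c)^4\<close>, and \<open>q\<close> has its maximum \<open>4/27\<close> over
  the unit interval at \<open>1/3\<close>. The two inequalities measure how far a point is from the maximiser.
\<close>

lemma simplex_bound:
  fixes x b c :: real
  assumes "0 \<le> x" "0 \<le> b" "0 \<le> c" "x + b + c = 1"
  defines "f \<equiv> x\<^sup>2 * (b * c * (b\<^sup>2 + c\<^sup>2)) / 12"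
  shows "(x - 1 / 3)\<^sup>2 \<le> 1944 * (1 / 4374 - f)" "x\<^sup>2 * (b - c) ^ 4 \<le> 96 * (1 / 4374 - f)"
proof -
  define q where "q = x * (1 - x)\<^sup>2"
  have s: "b + c = 1 - x" using assms(4) by simp
  have "8 * (b * c * (b\<^sup>2 + c\<^sup>2)) = (b + c) ^ 4 - (b - c) ^ 4" by (simp add: eval_nat_numeral algebra_simps)
  then have "8 * (b * c * (b\<^sup>2 + c\<^sup>2)) = (1 - x) ^ 4 - (b - c) ^ 4" by (simp only: s)
  then have "96 * f = x\<^sup>2 * ((1 - x) ^ 4 - (b - c) ^ 4)" by (simp add: f_def)
  then have f96: "96 * f = q\<^sup>2 - x\<^sup>2 * (b - c) ^ 4" by (simp add: q_def power_mult_distrib right_diff_distrib)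
  have q0: "0 \<le> q" using assms(1) by (simp add: q_def)
  have x1: "x \<le> 1" using assms by linarith
  have q: "4 / 27 - q = (x - 1 / 3)\<^sup>2 * (4 / 3 - x)"
    by (simp add: q_def power2_eq_square field_simps)
  also have "\<dots> \<ge> (x - 1 / 3)\<^sup>2 * (1 / 3)" using x1 by (intro mult_left_mono) auto
  finally have q1: "(x - 1 / 3)\<^sup>2 / 3 \<le> 4 / 27 - q" by simp
  have q2: "q \<le> 4 / 27" using q1 zero_le_power2[of "x - 1 / 3"] by linarith
  have "4 / 27 * ((x - 1 / 3)\<^sup>2 / 3) \<le> (4 / 27 + q) * (4 / 27 - q)"
    using q0 q1 q2 by (intro mult_mono) auto
  also have "\<dots> = 16 / 729 - q\<^sup>2" by (simp add: power2_eq_square algebra_simps)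
  finally have 1: "4 / 81 * (x - 1 / 3)\<^sup>2 \<le> 16 / 729 - q\<^sup>2" by simp
  have 2: "0 \<le> x\<^sup>2 * (b - c) ^ 4" by simp
  have 3: "0 \<le> (x - 1 / 3)\<^sup>2" by simp
  have arith: "A \<le> 1944 * (1 / 4374 - f)" "D \<le> 96 * (1 / 4374 - f)"
    if "4 / 81 * A \<le> 16 / 729 - Q" "0 \<le> A" "0 \<le> D" "96 * f = Q - D" for A D Q :: real
    using that by (simp_all add: field_simps)
  show "(x - 1 / 3)\<^sup>2 \<le> 1944 * (1 / 4374 - f)" by (rule arith(1)[OF 1 3 2 f96])
  show "x\<^sup>2 * (b - c) ^ 4 \<le> 96 * (1 / 4374 - f)" by (rule arith(2)[OF 1 3 2 f96])
qed

text \<open>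
  The bound on \<open>b - c\<close> is obtained as a fourth root, so a deficit of \<open>1 / 10^64\<close> is small enough for
  an accuracy of \<open>1 / 10^15\<close>.
\<close>

lemma simplex_near_optimal:
  fixes x b c :: real
  assumes "0 \<le> x" "0 \<le> b" "0 \<le> c" "x + b + c = 1"
    and near: "1 / 4374 - 1 / 10 ^ 64 \<le> x\<^sup>2 * (b * c * (b\<^sup>2 + c\<^sup>2)) / 12"
  shows "\<bar>x - 1 / 3\<bar> \<le> 1 / 10 ^ 15" "\<bar>b - 1 / 3\<bar> \<le> 1 / 10 ^ 15" "\<bar>c - 1 / 3\<bar> \<le> 1 / 10 ^ 15"
proof -
  define f where "f = x\<^sup>2 * (b * c * (b\<^sup>2 + c\<^sup>2)) / 12"
  have near': "1 / 4374 - f \<le> 1 / 10 ^ 64" using near unfolding f_def[symmetric] by linarith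
  have "(x - 1 / 3)\<^sup>2 \<le> 1944 * (1 / 4374 - f)"
    using simplex_bound(1)[OF assms(1-4)] unfolding f_def .
  also have "\<dots> \<le> 1944 * (1 / 10 ^ 64)" by (rule mult_left_mono[OF near']) simp
  also have "\<dots> \<le> (1 / 10 ^ 30)\<^sup>2" by (simp add: power_divide)
  finally have "(x - 1 / 3)\<^sup>2 \<le> (1 / 10 ^ 30)\<^sup>2" .
  then have "\<bar>x - 1 / 3\<bar> \<le> 1 / 10 ^ 30" using abs_le_square_iff[of "x - 1 / 3" "1 / 10 ^ 30"] by simp
  moreover have "1 / 10 ^ 30 \<le> (1 / 10 ^ 15 :: real)" "1 / 10 ^ 30 \<le> (1 / 6 :: real)" by simp_all
  ultimately have x: "\<bar>x - 1 / 3\<bar> \<le> 1 / 10 ^ 15" and "\<bar>x - 1 / 3\<bar> \<le> 1 / 6" by (blast intro: order_trans)+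
  then have x2: "1 / 6 \<le> x" by linarith
  show "\<bar>x - 1 / 3\<bar> \<le> 1 / 10 ^ 15" by (rule x)
  have "(1 / 6)\<^sup>2 * (b - c) ^ 4 \<le> x\<^sup>2 * (b - c) ^ 4" using x2 by (intro mult_right_mono power_mono) auto
  also have "\<dots> \<le> 96 * (1 / 4374 - f)" using simplex_bound(2)[OF assms(1-4)] unfolding f_def .
  also have "\<dots> \<le> 96 * (1 / 10 ^ 64)" by (rule mult_left_mono[OF near']) simp
  finally have "\<bar>b - c\<bar> ^ 4 \<le> (1 / 10 ^ 15) ^ 4" by (simp add: power_divide)
  then have d: "\<bar>b - c\<bar> \<le> 1 / 10 ^ 15" by (rule power_mono_iff[THEN iffD1, rotated -1]) auto
  have "\<bar>b - 1 / 3\<bar> \<le> k \<and> \<bar>c - 1 / 3\<bar> \<le> k" if "\<bar>b - c\<bar> \<le> k" "\<bar>x - 1 / 3\<bar> \<le> k" for k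
    using that assms(4) by linarith
  then show "\<bar>b - 1 / 3\<bar> \<le> 1 / 10 ^ 15" "\<bar>c - 1 / 3\<bar> \<le> 1 / 10 ^ 15" using d x by blast+
qed

lemma card_copies_model_le:
  assumes "\<And>x. p x < (3 :: nat)" "finite V"
  shows "real (card (copies (model p) V)) \<le> (real (card (part p V 0)))\<^sup>2 *
    (real (card (part p V 1)) * real (card (part p V 2)) *
      ((real (card (part p V 1)))\<^sup>2 + (real (card (part p V 2)))\<^sup>2)) / 12"
proof -
  let ?a = "real (card (part p V 0))" and ?b = "real (card (part p V 1))" and ?c = "real (card (part p V 2))"
  have C: "real (card (part p V j) choose k) \<le> real (card (part p V j)) ^ k / fact k" if "k \<le> 3" for j k
    by (rule binomial_le_pow_fact) (use that in auto)
  have "real (card (copies (model p) V)) =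
      real (card (part p V 0) choose 2) * (?b * real (card (part p V 2) choose 3) + real (card (part p V 1) choose 3) * ?c)"
    using card_copies_model[of p V, OF assms] by simp
  also have "\<dots> \<le> ?a ^ 2 / fact 2 * (?b * (?c ^ 3 / fact 3) + ?b ^ 3 / fact 3 * ?c)"
    by (intro mult_mono add_mono C) auto
  also have "\<dots> = ?a\<^sup>2 * (?b * ?c * (?b\<^sup>2 + ?c\<^sup>2)) / 12"
    by (simp add: fact_numeral power2_eq_square power3_eq_cube field_simps)
  finally show ?thesis .
qed

lemma parts_near_third:
  assumes lab: "\<And>x. p x < (3 :: nat)" and fin: "finite V" and ne: "0 < card V"
  defines "n \<equiv> real (card V)"
  assumes near: "(1 / 4374 - 1 / 10 ^ 64) * n ^ 6 \<le> real (card (copies (model p) V))" and j: "j < 3"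
  shows "\<bar>real (card (part p V j)) - n / 3\<bar> \<le> n / 10 ^ 15"
proof -
  define x where "x i = real (card (part p V i)) / n" for i
  have n0: "0 < n" using ne by (simp add: n_def)
  have px: "real (card (part p V i)) = x i * n" for i using n0 by (simp add: x_def)
  have "n = real (card (part p V 0)) + real (card (part p V 1)) + real (card (part p V 2))"
    unfolding n_def using card_parts[of p V, OF lab fin] by simp
  then have "x 0 + x 1 + x 2 = 1" using n0 by (simp add: x_def add_divide_distrib[symmetric])
  moreover have "0 \<le> x i" for i using n0 by (simp add: x_def)
  moreover have "1 / 4374 - 1 / 10 ^ 64 \<le> (x 0)\<^sup>2 * (x 1 * x 2 * ((x 1)\<^sup>2 + (x 2)\<^sup>2)) / 12"
  proof -
    have "(1 / 4374 - 1 / 10 ^ 64) * n ^ 6 \<le>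
        (x 0 * n)\<^sup>2 * ((x 1 * n) * (x 2 * n) * ((x 1 * n)\<^sup>2 + (x 2 * n)\<^sup>2)) / 12"
      using near card_copies_model_le[of p V, OF lab fin] unfolding px by linarith
    also have "\<dots> = ((x 0)\<^sup>2 * (x 1 * x 2 * ((x 1)\<^sup>2 + (x 2)\<^sup>2)) / 12) * n ^ 6"
      by (simp add: eval_nat_numeral algebra_simps)
    finally show ?thesis using n0 by (simp only: mult_le_cancel_right) auto
  qed
  ultimately have "\<bar>x 0 - 1 / 3\<bar> \<le> 1 / 10 ^ 15" "\<bar>x 1 - 1 / 3\<bar> \<le> 1 / 10 ^ 15" "\<bar>x 2 - 1 / 3\<bar> \<le> 1 / 10 ^ 15"
    using simplex_near_optimal[of "x 0" "x 1" "x 2"] by blast+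
  moreover have "j = 0 \<or> j = 1 \<or> j = 2" using j by linarith
  ultimately have "\<bar>x j - 1 / 3\<bar> \<le> 1 / 10 ^ 15" by blast
  then have "\<bar>x j - 1 / 3\<bar> * n \<le> 1 / 10 ^ 15 * n" using n0 by (intro mult_right_mono) auto
  moreover have "\<bar>x j - 1 / 3\<bar> * n = \<bar>x j * n - n / 3\<bar>"
    using n0 by (simp add: abs_mult_pos' algebra_simps)
  ultimately show ?thesis unfolding px by simp
qed

lemma card_copies_le_model:
  assumes fin: "finite V"
  shows "card (copies E V) \<le> card (copies (model p) V) + card (wrong_pairs E p V) * card V ^ 4"
proof -
  let ?B = "\<Union>e\<in>wrong_pairs E p V. {S \<in> six_sets V. e \<subseteq> S}"
  have "copies E V \<subseteq> copies (model p) V \<union> ?B"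
  proof
    fix S assume "S \<in> copies E V"
    then have S: "S \<in> six_sets V" "S \<subseteq> V" "is_copy E S" by (auto simp: copies_def six_sets_def)
    show "S \<in> copies (model p) V \<union> ?B"
    proof (cases "is_copy (model p) S")
      case False
      then obtain x y where xy: "x \<in> S" "y \<in> S" "x \<noteq> y" "E x y \<noteq> model p x y"
        using S(3) is_copy_cong[of S E "model p"] by blast
      then have "{x, y} \<in> wrong_pairs E p V" using S(2) unfolding wrong_pairs_def by blast
      then show ?thesis using xy S(1) by blast
    qed (use S in \<open>simp add: copies_def\<close>)
  qed
  then have "card (copies E V) \<le> card (copies (model p) V \<union> ?B)"
    using finite_copies[OF fin] finite_six_sets[OF fin] finite_wrong_pairs[OF fin] by (intro card_mono) auto
  also have "\<dots> \<le> card (copies (model p) V) + card ?B" by (rule card_Un_le)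
  also have "card ?B \<le> card (wrong_pairs E p V) * card V ^ 4"
  proof (rule card_Union_le_mult[OF finite_wrong_pairs[OF fin]])
    fix e assume "e \<in> wrong_pairs E p V"
    then show "card {S \<in> six_sets V. e \<subseteq> S} \<le> card V ^ 4"
      using card_supersets_le[OF fin, of e] wrong_pairD[of e E p V] by simp
  qed
  finally show ?thesis by simp
qed

lemma real_choose_6_le: "real (n choose 6) \<le> real n ^ 6 / 720"
proof -
  have "(n choose 6) * fact 6 \<le> n ^ 6" by (rule binomial_fact_pow)
  then have "real ((n choose 6) * fact 6) \<le> real (n ^ 6)" by (simp only: of_nat_le_iff)
  then show ?thesis by (simp add: fact_numeral)
qed

lemma exists_minimal_labelling:
  obtains p where "\<And>x. p x < (3 :: nat)"
    "\<And>r. (\<And>x. r x < (3 :: nat)) \<Longrightarrow> card (wrong_pairs E p V) \<le> card (wrong_pairs E r V)"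
proof -
  have "\<exists>p. (\<forall>x. p x < (3 :: nat)) \<and> (\<forall>r. (\<forall>x. r x < (3 :: nat)) \<longrightarrow> card (wrong_pairs E p V) \<le> card (wrong_pairs E r V))"
    by (rule ex_has_least_nat[of "\<lambda>p. \<forall>x. p x < (3 :: nat)" "\<lambda>_. 0" "\<lambda>p. card (wrong_pairs E p V)"]) simp
  then show thesis using that by blast
qed

text \<open>
  The number of copies is at least \<open>n^6 / 4374 - n^6 / 10^78\<close>, so by \<open>flag_bound\<close> few six-vertex
  sets do not induce blowups. So there is a labelling with at most \<open>2 / 10^65 * n^2\<close> wrong pairs by
  \<open>exists_close_labelling\<close>, and a labelling with the least number of wrong pairs is at least as
  good. Its blowup has almost the same number of copies as the given graph, so its parts are close
  to \<open>n/3\<close>, and \<open>copies_le_model_of_minimal\<close> applies.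
\<close>

lemma wrong_pairs_le_deficit:
  "\<exists>n0. \<forall>(V :: 'a set) E. (\<forall>x y. E x y = E y x) \<longrightarrow> finite V \<longrightarrow> n0 \<le> real (card V) \<longrightarrow>
     (1 / 4374 - 1 / 10 ^ 78) * real (card V) ^ 6 \<le> real (card (copies E V)) \<longrightarrow>
     (\<exists>p. (\<forall>x. p x < (3 :: nat)) \<and>
       real (card (wrong_pairs E p V)) * real (card V) ^ 4 / 10 ^ 12 \<le> real (card (copies (model p) V)) - real (card (copies E V)))"
proof -
  obtain K where K: "\<And>(V :: 'a set) E. finite V \<Longrightarrow> 6 \<le> card V \<Longrightarrow> (\<forall>x y. E x y = E y x) \<Longrightarrow>
     real (card (copies E V)) + real (card {S \<in> six_sets V. \<not> induces_blowup E S}) / 4942620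
       \<le> 40 / 243 * real (card V choose 6) + K * real (card V) ^ 5"
    using flag_bound[where 'a = 'a] unfolding copies_def by blast
  \<comment> \<open>The factor is \<open>320000 = 64 * 5000\<close>, where 5000 comes from \<open>n^6 / 5000\<close> as a lower bound for the number of copies.\<close>
  define L where "L = 4 + 320000 * 4942620 * \<bar>K\<bar>"
  have L: "4 \<le> L" by (simp add: L_def)
  show ?thesis
  proof (intro exI[of _ "10 ^ 65 * L"] allI impI)
    fix V :: "'a set" and E
    assume sym: "\<forall>x y. E x y = E y x" and fin: "finite V" and large: "10 ^ 65 * L \<le> real (card V)"
      and N: "(1 / 4374 - 1 / 10 ^ 78) * real (card V) ^ 6 \<le> real (card (copies E V))"
    define n where "n = real (card V)"
    have "10 ^ 65 * 4 \<le> 10 ^ 65 * L" using L by simp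
    then have n4: "4 * 10 ^ 65 \<le> n" using large unfolding n_def by linarith
    have n16: "10 ^ 16 \<le> n" using n4 by (rule order_trans[rotated]) simp
    have n6: "6 \<le> n" using n4 by (rule order_trans[rotated]) simp
    have n0: "0 < n" using n6 by linarith
    then have ne: "0 < card V" by (simp add: n_def)
    have six: "6 \<le> card V" using n6 unfolding n_def by linarith
    have sym': "E x y = E y x" for x y using sym by blast
    let ?N = "real (card (copies E V))" and ?B = "real (card {S \<in> six_sets V. \<not> induces_blowup E S})"
    have "?N + ?B / 4942620 \<le> 40 / 243 * (n ^ 6 / 720) + K * n ^ 5"
      using K[OF fin six sym] real_choose_6_le[of "card V"] unfolding n_def by linarith
    also have "\<dots> \<le> n ^ 6 / 4374 + \<bar>K\<bar> * n ^ 5"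
      using n0 mult_right_mono[OF abs_ge_self[of K], of "n ^ 5"] by simp
    finally have "?B / 4942620 \<le> 1 / 10 ^ 78 * n ^ 6 + \<bar>K\<bar> * n ^ 5"
      using N unfolding n_def[symmetric] left_diff_distrib by simp
    then have B: "?B \<le> 4942620 * (1 / 10 ^ 78 * n ^ 6 + \<bar>K\<bar> * n ^ 5)" by (simp add: field_simps)
    have "n ^ 6 / 5000 \<le> (1 / 4374 - 1 / 10 ^ 78) * n ^ 6"
    proof -
      have "1 / 5000 * n ^ 6 \<le> (1 / 4374 - 1 / 10 ^ 78) * n ^ 6" by (intro mult_right_mono) auto
      then show ?thesis by simp
    qed
    then have N5: "n ^ 6 / 5000 \<le> ?N" using N unfolding n_def by linarith
    then have Npos: "0 < ?N" using n0 by (intro less_le_trans[OF _ N5]) simp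
    then have Npos': "0 < card (copies E V)" by simp
    obtain p0 where p0: "\<And>x. p0 x < (3 :: nat)" "real (card (wrong_pairs E p0 V)) \<le> 4 * n + 64 * ?B * n ^ 2 / ?N"
      using exists_close_labelling[of E V, OF sym' fin Npos'] unfolding n_def by blast
    have "64 * ?B * n ^ 2 / ?N \<le> 64 * (4942620 * (1 / 10 ^ 78 * n ^ 6 + \<bar>K\<bar> * n ^ 5)) * n ^ 2 / (n ^ 6 / 5000)"
      using B N5 n0 by (intro frac_le mult_right_mono mult_left_mono) auto
    also have "\<dots> = 320000 * 4942620 / 10 ^ 78 * n ^ 2 + 320000 * 4942620 * \<bar>K\<bar> * n"
      using n0 by (simp add: field_simps eval_nat_numeral)
    finally have "real (card (wrong_pairs E p0 V)) \<le> 320000 * 4942620 / 10 ^ 78 * n ^ 2 + L * n"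
      using p0(2) by (simp add: L_def algebra_simps)
    also have "L * n \<le> n / 10 ^ 65 * n"
      using large n0 unfolding n_def[symmetric] by (intro mult_right_mono) (simp_all add: field_simps)
    also have "320000 * 4942620 / 10 ^ 78 * n ^ 2 + n / 10 ^ 65 * n = (320000 * 4942620 / 10 ^ 78 + 1 / 10 ^ 65) * n ^ 2"
      by (simp add: power2_eq_square distrib_right)
    also have "\<dots> \<le> 2 / 10 ^ 65 * n ^ 2" by (intro mult_right_mono) auto
    finally have W0: "real (card (wrong_pairs E p0 V)) \<le> 2 / 10 ^ 65 * n ^ 2" by simp
    obtain p where lab: "\<And>x. p x < (3 :: nat)"
      and minimal: "\<And>r. (\<And>x. r x < (3 :: nat)) \<Longrightarrow> card (wrong_pairs E p V) \<le> card (wrong_pairs E r V)"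
      using exists_minimal_labelling by blast
    have W: "real (card (wrong_pairs E p V)) \<le> 2 / 10 ^ 65 * n ^ 2"
    proof -
      have "card (wrong_pairs E p V) \<le> card (wrong_pairs E p0 V)" by (rule minimal) (rule p0(1))
      then show ?thesis using W0 by linarith
    qed
    have "?N \<le> real (card (copies (model p) V) + card (wrong_pairs E p V) * card V ^ 4)"
      using card_copies_le_model[OF fin, of E p] by (simp only: of_nat_le_iff)
    then have "?N \<le> real (card (copies (model p) V)) + real (card (wrong_pairs E p V)) * n ^ 4" by (simp add: n_def)
    also have "real (card (wrong_pairs E p V)) * n ^ 4 \<le> 2 / 10 ^ 65 * n ^ 2 * n ^ 4" by (intro mult_right_mono W) simp
    also have "2 / 10 ^ 65 * n ^ 2 * n ^ 4 = 2 / 10 ^ 65 * n ^ 6" by (simp add: eval_nat_numeral)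
    finally have model: "?N \<le> real (card (copies (model p) V)) + 2 / 10 ^ 65 * n ^ 6" by simp
    have "(1 / 4374 - 1 / 10 ^ 64) * n ^ 6 \<le> (1 / 4374 - 1 / 10 ^ 78 - 2 / 10 ^ 65) * n ^ 6"
      by (intro mult_right_mono) auto
    also have "\<dots> = (1 / 4374 - 1 / 10 ^ 78) * n ^ 6 - 2 / 10 ^ 65 * n ^ 6" by (simp only: left_diff_distrib)
    also have "\<dots> \<le> real (card (copies (model p) V))" using N model unfolding n_def by linarith
    finally have near: "(1 / 4374 - 1 / 10 ^ 64) * n ^ 6 \<le> real (card (copies (model p) V))" .
    have few: "real (card (wrong_pairs E p V)) \<le> n ^ 2 / 10 ^ 15"
    proof -
      have "2 / 10 ^ 65 * n ^ 2 \<le> 1 / 10 ^ 15 * n ^ 2" by (intro mult_right_mono) auto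
      then show ?thesis using W by simp
    qed
    have third: "\<bar>real (card (part p V j)) - real (card V) / 3\<bar> \<le> real (card V) / 10 ^ 15" if "j < 3" for j
      by (rule parts_near_third[of p V, OF lab fin ne near[unfolded n_def] that])
    have "real (card (wrong_pairs E p V)) * n ^ 4 / 10 ^ 12 \<le> real (card (copies (model p) V)) - ?N"
      unfolding n_def
      by (rule copies_le_model_of_minimal[of E p V, OF sym' lab fin minimal few[unfolded n_def] third n16[unfolded n_def]])
    then show "\<exists>p. (\<forall>x. p x < (3 :: nat)) \<and>
       real (card (wrong_pairs E p V)) * real (card V) ^ 4 / 10 ^ 12 \<le> real (card (copies (model p) V)) - real (card (copies E V))"
      using lab unfolding n_def by blast
  qed
qed

section \<open>Patterns, densities and limits\<close>

definition adjacency :: "'a pattern \<Rightarrow> 'a \<Rightarrow> 'a \<Rightarrow> bool" where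
  "adjacency G x y \<longleftrightarrow> {x, y} \<in> edges G"

lemma adjacency_commute: "adjacency G x y = adjacency G y x"
  by (simp add: adjacency_def insert_commute)

lemma F12_adjacency: "rows (adjacency F12) [0..<6] = F12_rows"
  by (simp add: rows_def F12_rows_def adjacency_def F12_def upt_conv_Cons doubleton_eq_iff)

lemma edge_endsD:
  assumes "is_graph G" "e \<in> edges G"
  obtains x y where "e = {x, y}" "x \<in> verts G" "y \<in> verts G" "x \<noteq> y"
proof -
  obtain x y where xy: "e = {x, y}" "x \<in> verts G" "y \<in> verts G"
    using assms unfolding is_graph_def is_pattern_def by blast
  moreover have "x \<noteq> y" using assms xy(1) unfolding is_graph_def by blast
  ultimately show thesis using that by blast
qed

lemma isomorphic_F12_iff:
  assumes G: "is_graph G" and S: "S \<subseteq> verts G"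
  shows "isomorphic F12 (induced G S) \<longleftrightarrow> is_copy (adjacency G) S"
proof
  assume "isomorphic F12 (induced G S)"
  then obtain f where bij: "bij_betw f {0..<6} S"
    and f: "\<And>x y. x < 6 \<Longrightarrow> y < 6 \<Longrightarrow> {x, y} \<in> edges F12 \<longleftrightarrow> {f x, f y} \<in> edges G \<and> {f x, f y} \<subseteq> S"
    by (auto simp: isomorphic_def isomorphism_def induced_def F12_def)
  have fS: "f x \<in> S" if "x < 6" for x using bij that by (auto simp: bij_betw_def)
  let ?xs = "map f [0..<6]"
  have "rows (adjacency G) ?xs = rows (\<lambda>i j. adjacency G (f i) (f j)) [0..<6]" by (rule rows_map)
  also have "\<dots> = rows (adjacency F12) [0..<6]"
    by (rule rows_cong) (use f fS in \<open>auto simp: adjacency_def\<close>)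
  finally have "rows (adjacency G) ?xs = F12_rows" by (simp only: F12_adjacency)
  moreover have "distinct ?xs" using bij by (auto simp: distinct_map bij_betw_def)
  moreover have "set ?xs = S" using bij by (auto simp: bij_betw_def)
  moreover have "length ?xs = 6" by simp
  ultimately show "is_copy (adjacency G) S" unfolding is_copy_def by blast
next
  assume "is_copy (adjacency G) S"
  then obtain xs where xs: "length xs = 6" "distinct xs" "set xs = S" "rows (adjacency G) xs = F12_rows"
    unfolding is_copy_def by blast
  have rows_adj: "adjacency G (xs ! i) (xs ! j) = adjacency F12 i j" if "i < 6" "j < 6" "i \<noteq> j" for i j
    using rows_adj_rows[of "adjacency G" i xs j] rows_adj_rows[of "adjacency F12" i "[0..<6]" j]
      adjacency_commute[of G] adjacency_commute[of F12] that xs F12_adjacency by (simp del: upt_rec_numeral)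
  have "bij_betw ((!) xs) {0..<6} S" using bij_betw_nth[OF xs(2), of "{..<6}" S] xs by (simp add: atLeast0LessThan)
  moreover have "{x, y} \<in> edges F12 \<longleftrightarrow> {xs ! x, xs ! y} \<in> edges G \<and> {xs ! x, xs ! y} \<subseteq> S"
    if "x < 6" "y < 6" for x y
  proof (cases "x = y")
    case True
    then show ?thesis using G by (auto simp: F12_def is_graph_def doubleton_eq_iff)
  next
    case False
    have "xs ! x \<in> S" "xs ! y \<in> S" using that xs by auto
    then show ?thesis using rows_adj[OF that False] by (simp add: adjacency_def)
  qed
  ultimately have "isomorphism ((!) xs) F12 (induced G S)"
    by (auto simp: isomorphism_def induced_def F12_def)
  then show "isomorphic F12 (induced G S)" unfolding isomorphic_def by blast
qed

lemma induced_density_eq: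
  assumes "is_graph G"
  shows "induced_density F12 G = real (card (copies (adjacency G) (verts G))) / real (card (verts G) choose 6)"
proof -
  have "{S. S \<subseteq> verts G \<and> card S = card (verts F12) \<and> isomorphic F12 (induced G S)} =
      copies (adjacency G) (verts G)"
    using isomorphic_F12_iff[OF assms] by (auto simp: copies_def six_sets_def F12_def)
  then show ?thesis by (simp add: induced_density_def F12_def)
qed

definition blowup_of :: "('a \<Rightarrow> nat) \<Rightarrow> 'a set \<Rightarrow> 'a pattern" where
  "blowup_of p V = blowup B12 (part p V)"

lemma B12_edge_iff: "i < 3 \<Longrightarrow> j < 3 \<Longrightarrow> {i, j} \<in> edges B12 \<longleftrightarrow> B12_adj i j"
  by (auto simp: B12_def B12_adj_def doubleton_eq_iff)

lemma blowup_of_eq: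
  assumes "\<And>x. p x < (3 :: nat)"
  shows "blowup_of p V = (V, {{x, y} | x y. x \<in> V \<and> y \<in> V \<and> x \<noteq> y \<and> model p x y})"
proof -
  have u: "(\<Union>i\<in>verts B12. part p V i) = V" using assms by (auto simp: B12_def part_def)
  have e: "(\<exists>i\<in>verts B12. \<exists>j\<in>verts B12. x \<in> part p V i \<and> y \<in> part p V j \<and> {i, j} \<in> edges B12) \<longleftrightarrow>
      x \<in> V \<and> y \<in> V \<and> model p x y" for x y
    using assms B12_edge_iff by (auto simp: part_def model_def B12_def)
  have "{{x, y} | x y. x \<noteq> y \<and> x \<in> V \<and> y \<in> V \<and> model p x y} =
      {{x, y} | x y. x \<in> V \<and> y \<in> V \<and> x \<noteq> y \<and> model p x y}"
    by (rule Collect_cong) blast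
  then show ?thesis by (simp only: blowup_of_def blowup_def u e)
qed

lemma blowup_of_graph:
  assumes "\<And>x. p x < (3 :: nat)" "finite V"
  shows "is_graph (blowup_of p V)"
  using assms(2) unfolding blowup_of_eq[of p, OF assms(1)] is_graph_def is_pattern_def
  by (auto simp: doubleton_eq_iff)

lemma copies_blowup_of:
  assumes "\<And>x. p x < (3 :: nat)"
  shows "copies (adjacency (blowup_of p V)) V = copies (model p) V"
proof -
  have "adjacency (blowup_of p V) x y = model p x y" if "x \<in> V" "y \<in> V" "x \<noteq> y" for x y
    using that model_commute[of p x y] unfolding blowup_of_eq[of p, OF assms] adjacency_def
    by (auto simp: doubleton_eq_iff)
  then have "is_copy (adjacency (blowup_of p V)) S = is_copy (model p) S" if "S \<subseteq> V" for S
    using that by (intro is_copy_cong) auto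
  then show ?thesis by (auto simp: copies_def six_sets_def)
qed

lemma density_blowup_of:
  assumes "\<And>x. p x < (3 :: nat)" "finite V"
  shows "induced_density F12 (blowup_of p V) = real (card (copies (model p) V)) / real (card V choose 6)"
  using induced_density_eq[OF blowup_of_graph[of p V, OF assms]] copies_blowup_of[of p V, OF assms(1)]
  by (simp add: blowup_of_eq[of p V, OF assms(1)])

lemma edit_distance_le_wrong:
  assumes G: "is_graph G" and lab: "\<And>x. p x < (3 :: nat)"
  shows "edit_distance G B12 \<le> card (wrong_pairs (adjacency G) p (verts G))"
proof -
  let ?V = "verts G" and ?H = "blowup_of p (verts G)"
  have fin: "finite ?V" using G by (auto simp: is_graph_def is_pattern_def)
  have "blowup_parts B12 (part p ?V)" using fin by (auto simp: blowup_parts_def disjoint_family_on_def part_def)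
  then have bl: "?H \<in> blowups B12" unfolding blowups_def blowup_of_def by blast
  have iso: "isomorphic ?H ?H" unfolding isomorphic_def isomorphism_def
    by (intro exI[of _ id]) auto
  have "(edges G - edges ?H) \<union> (edges ?H - edges G) = wrong_pairs (adjacency G) p ?V"
  proof (intro set_eqI iffI)
    fix e assume e: "e \<in> (edges G - edges ?H) \<union> (edges ?H - edges G)"
    then have "e \<in> edges G \<or> e \<in> edges ?H" by blast
    then obtain x y where xy: "e = {x, y}" "x \<in> ?V" "y \<in> ?V" "x \<noteq> y"
    proof
      assume "e \<in> edges G" then show thesis using edge_endsD[OF G] that by metis
    next
      assume "e \<in> edges ?H" then show thesis using that unfolding blowup_of_eq[of p, OF lab] by auto
    qed
    have "e \<in> edges ?H \<longleftrightarrow> model p x y"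
      using xy model_commute[of p x y] unfolding blowup_of_eq[of p, OF lab] by (auto simp: doubleton_eq_iff)
    then have "adjacency G x y \<noteq> model p x y" using e xy(1) by (auto simp: adjacency_def)
    then show "e \<in> wrong_pairs (adjacency G) p ?V" using xy unfolding wrong_pairs_def by blast
  next
    fix e assume "e \<in> wrong_pairs (adjacency G) p ?V"
    then obtain x y where xy: "e = {x, y}" "x \<in> ?V" "y \<in> ?V" "x \<noteq> y" "adjacency G x y \<noteq> model p x y"
      unfolding wrong_pairs_def by blast
    have "e \<in> edges ?H \<longleftrightarrow> model p x y"
      using xy model_commute[of p x y] unfolding blowup_of_eq[of p, OF lab] by (auto simp: doubleton_eq_iff)
    then show "e \<in> (edges G - edges ?H) \<union> (edges ?H - edges G)" using xy by (auto simp: adjacency_def)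
  qed
  moreover have "verts ?H = ?V" by (simp add: blowup_of_eq[of p, OF lab])
  ultimately show ?thesis
    unfolding edit_distance_def using blowup_of_graph[of p ?V, OF lab fin] bl iso
    by (intro Least_le exI[of _ ?H]) auto
qed

lemma edit_distance_le_square:
  assumes G: "is_graph G"
  shows "edit_distance G B12 \<le> card (verts G) ^ 2"
proof -
  let ?W = "wrong_pairs (adjacency G) (\<lambda>_. 0) (verts G)"
  have fin: "finite (verts G)" using G by (auto simp: is_graph_def is_pattern_def)
  have "edit_distance G B12 \<le> card ?W" by (rule edit_distance_le_wrong[OF G]) simp
  also have "?W \<subseteq> (\<lambda>(x, y). {x, y}) ` (verts G \<times> verts G)" unfolding wrong_pairs_def by blast
  then have "card ?W \<le> card ((\<lambda>(x, y). {x, y}) ` (verts G \<times> verts G))" using fin by (intro card_mono) auto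
  also have "\<dots> \<le> card (verts G \<times> verts G)" using fin by (intro card_image_le) auto
  finally show ?thesis by (simp add: card_cartesian_product power2_eq_square)
qed

text \<open>
  The product formula for binomial coefficients, divided by \<open>n^j\<close> factor by factor.
\<close>

lemma binomial_limit:
  assumes "(\<lambda>n. real (k n) / real n) \<longlonglongrightarrow> x"
  shows "(\<lambda>n. real (k n choose j) / real n ^ j) \<longlonglongrightarrow> x ^ j / fact j"
proof -
  have "(\<lambda>n. (\<Prod>i\<in>{0..<j}. real (k n) / real n - real i / real n) / fact j) \<longlonglongrightarrow> (\<Prod>i\<in>{0..<j}. x - 0) / fact j"
    by (intro tendsto_divide tendsto_prod tendsto_diff assms tendsto_const lim_const_over_n) auto
  moreover have "(\<Prod>i\<in>{0..<j}. real (k n) / real n - real i / real n) / fact j = real (k n choose j) / real n ^ j" for n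
    by (simp add: binomial_gbinomial gbinomial_prod_rev diff_divide_distrib[symmetric] prod_dividef)
  ultimately show ?thesis by simp
qed

text \<open>
  The number of copies in a blowup with relative part sizes \<open>x 0\<close>, \<open>x 1\<close>, \<open>x 2\<close> is this density
  times \<open>n^6 / 720\<close>, up to lower order terms.
\<close>

definition limit_density :: "(nat \<Rightarrow> real) \<Rightarrow> real" where
  "limit_density x = 720 * ((x 0)\<^sup>2 * (x 1 * x 2 * ((x 1)\<^sup>2 + (x 2)\<^sup>2)) / 12)"

definition label_of :: "(nat \<Rightarrow> 'a set) \<Rightarrow> 'a \<Rightarrow> nat" where
  "label_of V x = (if x \<in> V 1 then 1 else if x \<in> V 2 then 2 else 0)"

lemma B12_verts: "verts B12 = {0, 1, 2}"
  by (auto simp: B12_def)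

lemma blowup_eq_blowup_of:
  assumes "blowup_parts B12 V"
  defines "U \<equiv> V 0 \<union> V 1 \<union> V 2"
  shows "blowup B12 V = blowup_of (label_of V) U" "\<And>j. j < 3 \<Longrightarrow> part (label_of V) U j = V j" "finite U"
proof -
  have disj: "V 0 \<inter> V 1 = {}" "V 0 \<inter> V 2 = {}" "V 1 \<inter> V 2 = {}" and fin: "finite (V 0)" "finite (V 1)" "finite (V 2)"
    using assms(1) by (auto simp: blowup_parts_def disjoint_family_on_def B12_verts)
  show part: "part (label_of V) U j = V j" if "j < 3" for j
  proof -
    have "j = 0 \<or> j = 1 \<or> j = 2" using that by linarith
    then show ?thesis using disj by (auto simp: part_def label_of_def U_def)
  qed
  show "finite U" using fin by (simp add: U_def)
  show "blowup B12 V = blowup_of (label_of V) U"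
    unfolding blowup_of_def blowup_def by (simp add: B12_verts part)
qed

lemma quotient_rescale:
  fixes t :: real
  assumes "0 < t"
  shows "a / t ^ 2 * (b / t ^ 1 * (c / t ^ 3) + d / t ^ 3 * (e / t ^ 1)) / (m / t ^ 6) = a * (b * c + d * e) / m"
proof -
  have "t ^ 6 = t ^ 2 * (t ^ 1 * t ^ 3)" by (simp add: eval_nat_numeral)
  then have "a / t ^ 2 * (b / t ^ 1 * (c / t ^ 3) + d / t ^ 3 * (e / t ^ 1)) = a * (b * c + d * e) / t ^ 6"
    by (simp add: add_divide_distrib[symmetric] ac_simps)
  then show ?thesis using assms by simp
qed

lemma blowup_density_limit:
  assumes V: "\<And>n. blowup_parts B12 (V n)" and x: "x \<in> std_simplex (verts B12)"
    and lim: "\<And>i. i \<in> verts B12 \<Longrightarrow> (\<lambda>n. real (card (V n i)) / real n) \<longlonglongrightarrow> x i"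
  shows "(\<lambda>n. induced_density F12 (blowup B12 (V n))) \<longlonglongrightarrow> limit_density x"
proof -
  let ?k = "\<lambda>i n. card (V n i)" and ?N = "\<lambda>n. card (V n 0) + card (V n 1) + card (V n 2)"
  have sum1: "x 0 + x 1 + x 2 = 1" using x by (simp add: std_simplex_def B12_verts)
  have l: "(\<lambda>n. real (?k i n) / real n) \<longlonglongrightarrow> x i" if "i \<in> {0, 1, 2}" for i
    using lim[of i] that by (simp add: B12_verts)
  have "(\<lambda>n. real (?k 0 n) / real n + real (?k 1 n) / real n + real (?k 2 n) / real n) \<longlonglongrightarrow> x 0 + x 1 + x 2"
    by (intro tendsto_add l) auto
  then have "(\<lambda>n. real (?N n) / real n) \<longlonglongrightarrow> 1" using sum1 by (simp add: add_divide_distrib)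
  then have den: "(\<lambda>n. real (?N n choose 6) / real n ^ 6) \<longlonglongrightarrow> 1 ^ 6 / fact 6" by (rule binomial_limit)
  have num: "(\<lambda>n. real (?k 0 n choose 2) / real n ^ 2 *
      (real (?k 1 n choose 1) / real n ^ 1 * (real (?k 2 n choose 3) / real n ^ 3) +
       real (?k 1 n choose 3) / real n ^ 3 * (real (?k 2 n choose 1) / real n ^ 1)))
    \<longlonglongrightarrow> x 0 ^ 2 / fact 2 * (x 1 ^ 1 / fact 1 * (x 2 ^ 3 / fact 3) + x 1 ^ 3 / fact 3 * (x 2 ^ 1 / fact 1))"
    by (intro tendsto_mult tendsto_add binomial_limit l) auto
  have eq: "x 0 ^ 2 / fact 2 * (x 1 ^ 1 / fact 1 * (x 2 ^ 3 / fact 3) + x 1 ^ 3 / fact 3 * (x 2 ^ 1 / fact 1)) / (1 ^ 6 / fact 6)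
      = limit_density x"
    by (simp add: limit_density_def fact_numeral power2_eq_square power3_eq_cube field_simps)
  have "eventually (\<lambda>n. real (?k 0 n choose 2) / real n ^ 2 *
      (real (?k 1 n choose 1) / real n ^ 1 * (real (?k 2 n choose 3) / real n ^ 3) +
       real (?k 1 n choose 3) / real n ^ 3 * (real (?k 2 n choose 1) / real n ^ 1)) / (real (?N n choose 6) / real n ^ 6)
     = induced_density F12 (blowup B12 (V n))) sequentially"
    using eventually_gt_at_top[of 0]
  proof eventually_elim
    case (elim n)
    define U where "U = V n 0 \<union> V n 1 \<union> V n 2"
    note b = blowup_eq_blowup_of[OF V[of n], folded U_def]
    have lab: "label_of (V n) y < 3" for y by (simp add: label_of_def)
    have parts: "part (label_of (V n)) U 0 = V n 0" "part (label_of (V n)) U 1 = V n 1" "part (label_of (V n)) U 2 = V n 2"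
      using b(2) by simp_all
    have "card U = ?N n" using card_parts[of "label_of (V n)" U, OF lab b(3)] parts by simp
    then have "induced_density F12 (blowup B12 (V n)) =
        real ((?k 0 n choose 2) * (?k 1 n * (?k 2 n choose 3) + (?k 1 n choose 3) * ?k 2 n)) / real (?N n choose 6)"
      using density_blowup_of[of "label_of (V n)" U, OF lab b(3)]
        card_copies_model[of "label_of (V n)" U, OF lab b(3)] parts unfolding b(1) by simp
    then show ?case using elim by (subst quotient_rescale) simp_all
  qed
  moreover have "(\<lambda>n. real (?k 0 n choose 2) / real n ^ 2 *
      (real (?k 1 n choose 1) / real n ^ 1 * (real (?k 2 n choose 3) / real n ^ 3) +
       real (?k 1 n choose 3) / real n ^ 3 * (real (?k 2 n choose 1) / real n ^ 1)) / (real (?N n choose 6) / real n ^ 6))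
     \<longlonglongrightarrow> limit_density x"
    unfolding eq[symmetric] by (intro tendsto_divide num den) simp
  ultimately show ?thesis by (rule Lim_transform_eventually[rotated])
qed

section \<open>The extremal problem\<close>

lemma exists_blowup_sequence:
  fixes k :: "nat \<Rightarrow> nat \<Rightarrow> nat"
  shows "\<exists>V :: nat \<Rightarrow> nat \<Rightarrow> nat set. \<forall>n. blowup_parts B12 (V n) \<and> (\<forall>i<3. card (V n i) = k i n) \<and>
    verts (blowup B12 (V n)) = {0..<k 0 n + k 1 n + k 2 n}"
proof -
  define V where "V n i = (if i = 0 then {0..<k 0 n} else if i = 1 then {k 0 n..<k 0 n + k 1 n}
      else {k 0 n + k 1 n..<k 0 n + k 1 n + k 2 n})" for n i :: nat
  have "blowup_parts B12 (V n)" for n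
    by (auto simp: blowup_parts_def disjoint_family_on_def B12_verts V_def)
  moreover have "card (V n i) = k i n" if "i < 3" for n i
  proof -
    have "i = 0 \<or> i = 1 \<or> i = 2" using that by linarith
    then show ?thesis by (auto simp: V_def)
  qed
  moreover have "verts (blowup B12 (V n)) = {0..<k 0 n + k 1 n + k 2 n}" for n
    by (auto simp: blowup_def B12_verts V_def)
  ultimately show ?thesis by blast
qed

lemma floor_ratio_limit:
  assumes "0 \<le> (x :: real)"
  shows "(\<lambda>n. real (nat \<lfloor>x * real n\<rfloor>) / real n) \<longlonglongrightarrow> x"
proof (rule tendsto_sandwich)
  show "eventually (\<lambda>n. x - 1 / real n \<le> real (nat \<lfloor>x * real n\<rfloor>) / real n) sequentially"
    using eventually_gt_at_top[of 0]
  proof eventually_elim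
    case (elim n)
    have "x * real n - 1 \<le> real (nat \<lfloor>x * real n\<rfloor>)" by linarith
    then have "(x * real n - 1) / real n \<le> real (nat \<lfloor>x * real n\<rfloor>) / real n"
      by (rule divide_right_mono) simp
    then show ?case using elim by (simp add: diff_divide_distrib)
  qed
  show "eventually (\<lambda>n. real (nat \<lfloor>x * real n\<rfloor>) / real n \<le> x) sequentially"
    using eventually_gt_at_top[of 0]
  proof eventually_elim
    case (elim n)
    have "real (nat \<lfloor>x * real n\<rfloor>) \<le> x * real n" using assms by (intro of_nat_floor) simp
    then show ?case using elim by (simp add: field_simps)
  qed
  show "(\<lambda>n. x - 1 / real n) \<longlonglongrightarrow> x"
    using tendsto_diff[OF tendsto_const[of x] lim_const_over_n[of 1]] by simp
qed simp

text \<open>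
  The density is defined by a universal property, so uniqueness needs at least one sequence of
  blowups with the prescribed ratios; rounding down provides it.
\<close>

lemma blowup_density_eq:
  assumes x: "x \<in> std_simplex (verts B12)"
  shows "blowup_density F12 B12 x = limit_density x"
  unfolding blowup_density_def
proof (rule the_equality)
  show "\<forall>V :: nat \<Rightarrow> nat \<Rightarrow> nat set. (\<forall>n. blowup_parts B12 (V n)) \<longrightarrow>
      (\<forall>i\<in>verts B12. (\<lambda>n. real (card (V n i)) / real n) \<longlonglongrightarrow> x i) \<longrightarrow>
      (\<lambda>n. induced_density F12 (blowup B12 (V n))) \<longlonglongrightarrow> limit_density x"
  proof (intro allI impI)
    fix V :: "nat \<Rightarrow> nat \<Rightarrow> nat set"
    assume V: "\<forall>n. blowup_parts B12 (V n)"
      and lim: "\<forall>i\<in>verts B12. (\<lambda>n. real (card (V n i)) / real n) \<longlonglongrightarrow> x i"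
    show "(\<lambda>n. induced_density F12 (blowup B12 (V n))) \<longlonglongrightarrow> limit_density x"
      by (rule blowup_density_limit[OF V[rule_format] x bspec[OF lim]])
  qed
next
  fix L
  assume L: "\<forall>V :: nat \<Rightarrow> nat \<Rightarrow> nat set. (\<forall>n. blowup_parts B12 (V n)) \<longrightarrow>
      (\<forall>i\<in>verts B12. (\<lambda>n. real (card (V n i)) / real n) \<longlonglongrightarrow> x i) \<longrightarrow>
      (\<lambda>n. induced_density F12 (blowup B12 (V n))) \<longlonglongrightarrow> L"
  obtain V :: "nat \<Rightarrow> nat \<Rightarrow> nat set" where "\<forall>n. blowup_parts B12 (V n) \<and>
      (\<forall>i<3. card (V n i) = nat \<lfloor>x i * real n\<rfloor>) \<and> verts (blowup B12 (V n)) =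
        {0..<nat \<lfloor>x 0 * real n\<rfloor> + nat \<lfloor>x 1 * real n\<rfloor> + nat \<lfloor>x 2 * real n\<rfloor>}"
    using exists_blowup_sequence[of "\<lambda>i n. nat \<lfloor>x i * real n\<rfloor>"] ..
  then have V: "\<And>n. blowup_parts B12 (V n)" "\<And>n i. i < 3 \<Longrightarrow> card (V n i) = nat \<lfloor>x i * real n\<rfloor>"
    by simp_all
  have lim: "(\<lambda>n. real (card (V n i)) / real n) \<longlonglongrightarrow> x i" if "i \<in> verts B12" for i
  proof -
    have "i < 3" "0 \<le> x i" using that x by (auto simp: B12_verts std_simplex_def)
    then show ?thesis using floor_ratio_limit[of "x i"] V(2) by simp
  qed
  have "(\<lambda>n. induced_density F12 (blowup B12 (V n))) \<longlonglongrightarrow> L" by (rule L[rule_format, OF V(1) lim])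
  moreover have "(\<lambda>n. induced_density F12 (blowup B12 (V n))) \<longlonglongrightarrow> limit_density x"
    by (rule blowup_density_limit[OF V(1) x lim])
  ultimately show "L = limit_density x" by (rule LIMSEQ_unique)
qed

lemma finite_densities:
  "finite {induced_density F12 G | G :: nat pattern. is_graph G \<and> card (verts G) = n}" (is "finite ?D")
proof (rule finite_subset)
  show "?D \<subseteq> (\<lambda>k. real k / real (n choose 6)) ` {..2 ^ n}"
  proof
    fix d assume "d \<in> ?D"
    then obtain G :: "nat pattern" where G: "d = induced_density F12 G" "is_graph G" "card (verts G) = n" by blast
    have fin: "finite (verts G)" using G(2) by (auto simp: is_graph_def is_pattern_def)
    have "card (copies (adjacency G) (verts G)) \<le> card (Pow (verts G))"
      using fin by (intro card_mono) (auto simp: copies_def six_sets_def)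
    then have "card (copies (adjacency G) (verts G)) \<le> 2 ^ n" using fin G(3) by (simp add: card_Pow)
    then show "d \<in> (\<lambda>k. real k / real (n choose 6)) ` {..2 ^ n}"
      using induced_density_eq[OF G(2)] G(1,3) by auto
  qed
qed simp

lemma max_density_ge:
  assumes "is_graph (G :: nat pattern)"
  shows "induced_density F12 G \<le> max_density F12 (card (verts G))"
  unfolding max_density_def using assms by (intro Max_ge finite_densities) blast

lemma max_density_attained:
  obtains G :: "nat pattern" where "is_graph G" "card (verts G) = n" "max_density F12 n = induced_density F12 G"
proof -
  let ?D = "{induced_density F12 G | G :: nat pattern. is_graph G \<and> card (verts G) = n}"
  have "is_graph ({0..<n}, {} :: nat set set)" "card (verts ({0..<n}, {} :: nat set set)) = n"
    by (auto simp: is_graph_def is_pattern_def)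
  then have "?D \<noteq> {}" by blast
  then have "max_density F12 n \<in> ?D" unfolding max_density_def by (rule Max_in[OF finite_densities])
  then show thesis using that by blast
qed

lemma choose_6_limit: "(\<lambda>n. real (n choose 6) / real n ^ 6) \<longlonglongrightarrow> 1 ^ 6 / fact 6"
proof (rule binomial_limit)
  have "eventually (\<lambda>n. 1 = real n / real n) sequentially"
    using eventually_gt_at_top[of 0] by eventually_elim simp
  then show "(\<lambda>n. real n / real n) \<longlonglongrightarrow> 1" by (rule Lim_transform_eventually[OF tendsto_const])
qed

lemma max_density_limit: "max_density F12 \<longlonglongrightarrow> 40 / 243"
proof -
  obtain K where K: "\<And>(V :: nat set) E. finite V \<Longrightarrow> 6 \<le> card V \<Longrightarrow> (\<forall>x y. E x y = E y x) \<Longrightarrow>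
     real (card (copies E V)) + real (card {S \<in> six_sets V. \<not> induces_blowup E S}) / 4942620
       \<le> 40 / 243 * real (card V choose 6) + K * real (card V) ^ 5"
    using flag_bound[where 'a = nat] unfolding copies_def by blast
  define x :: "nat \<Rightarrow> real" where "x = (\<lambda>_. 1 / 3)"
  have x: "x \<in> std_simplex (verts B12)" by (simp add: std_simplex_def B12_verts x_def)
  define k :: "nat \<Rightarrow> nat \<Rightarrow> nat" where "k i n = (if i < 2 then n div 3 else n - 2 * (n div 3))" for i n
  obtain V :: "nat \<Rightarrow> nat \<Rightarrow> nat set" where "\<forall>n. blowup_parts B12 (V n) \<and>
      (\<forall>i<3. card (V n i) = k i n) \<and> verts (blowup B12 (V n)) = {0..<k 0 n + k 1 n + k 2 n}"
    using exists_blowup_sequence[of k] ..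
  then have V: "\<And>n. blowup_parts B12 (V n)" "\<And>n i. i < 3 \<Longrightarrow> card (V n i) = k i n"
    "\<And>n. verts (blowup B12 (V n)) = {0..<k 0 n + k 1 n + k 2 n}"
    by simp_all
  have third: "(\<lambda>n. real (n div 3) / real n) \<longlonglongrightarrow> 1 / 3"
  proof -
    have "nat \<lfloor>1 / 3 * real n\<rfloor> = n div 3" for n
      by (simp add: floor_divide_of_nat_eq[of n 3, simplified])
    then show ?thesis using floor_ratio_limit[of "1 / 3"] by simp
  qed
  have klim: "(\<lambda>n. real (k i n) / real n) \<longlonglongrightarrow> 1 / 3" for i
  proof (cases "i < 2")
    case True
    then show ?thesis using third by (simp add: k_def)
  next
    case False
    have "(\<lambda>n. 1 - 2 * (real (n div 3) / real n)) \<longlonglongrightarrow> 1 - 2 * (1 / 3)"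
      by (intro tendsto_diff tendsto_mult tendsto_const third)
    moreover have "eventually (\<lambda>n. 1 - 2 * (real (n div 3) / real n) = real (k i n) / real n) sequentially"
      using eventually_gt_at_top[of 0]
    proof eventually_elim
      case (elim n)
      have "2 * (n div 3) \<le> n" by simp
      then show ?case using elim False by (simp add: k_def of_nat_diff diff_divide_distrib)
    qed
    ultimately show ?thesis by (auto intro: Lim_transform_eventually)
  qed
  have "(\<lambda>n. induced_density F12 (blowup B12 (V n))) \<longlonglongrightarrow> limit_density x"
    by (rule blowup_density_limit[OF V(1) x]) (use klim V(2) in \<open>auto simp: B12_verts x_def\<close>)
  moreover have "limit_density x = 40 / 243" by (simp add: limit_density_def x_def power2_eq_square)
  ultimately have lower: "(\<lambda>n. induced_density F12 (blowup B12 (V n))) \<longlonglongrightarrow> 40 / 243" by simp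
  have ge: "induced_density F12 (blowup B12 (V n)) \<le> max_density F12 n" for n
  proof -
    have "k 0 n + k 1 n + k 2 n = n" by (simp add: k_def)
    then have c: "card (verts (blowup B12 (V n))) = n" using V(3) by simp
    have "is_graph (blowup B12 (V n))"
      using blowup_eq_blowup_of[OF V(1)[of n]] blowup_of_graph[of "label_of (V n)"] by (simp add: label_of_def)
    then show ?thesis using max_density_ge c by metis
  qed
  have "(\<lambda>n. 40 / 243 + (\<bar>K\<bar> / real n) / (real (n choose 6) / real n ^ 6)) \<longlonglongrightarrow> 40 / 243 + 0 / (1 ^ 6 / fact 6)"
    by (rule tendsto_add[OF tendsto_const tendsto_divide[OF lim_const_over_n choose_6_limit]]) simp
  then have upper: "(\<lambda>n. 40 / 243 + (\<bar>K\<bar> / real n) / (real (n choose 6) / real n ^ 6)) \<longlonglongrightarrow> 40 / 243" by simp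
  have le: "max_density F12 n \<le> 40 / 243 + (\<bar>K\<bar> / real n) / (real (n choose 6) / real n ^ 6)" if n: "6 \<le> n" for n
  proof -
    obtain G :: "nat pattern" where G: "is_graph G" "card (verts G) = n" "max_density F12 n = induced_density F12 G"
      by (rule max_density_attained)
    have fin: "finite (verts G)" using G(1) by (auto simp: is_graph_def is_pattern_def)
    have C: "0 < real (n choose 6)" using n by simp
    have "real (card (copies (adjacency G) (verts G))) \<le> 40 / 243 * real (n choose 6) + K * real n ^ 5"
      using K[OF fin, of "adjacency G"] G(2) n adjacency_commute[of G] by (smt (verit) divide_nonneg_nonneg of_nat_0_le_iff)
    also have "\<dots> \<le> 40 / 243 * real (n choose 6) + \<bar>K\<bar> * real n ^ 5"
      by (intro add_left_mono mult_right_mono) auto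
    finally have "max_density F12 n \<le> (40 / 243 * real (n choose 6) + \<bar>K\<bar> * real n ^ 5) / real (n choose 6)"
      unfolding G(3) induced_density_eq[OF G(1)] G(2) using C by (intro divide_right_mono) auto
    also have "\<dots> = 40 / 243 + \<bar>K\<bar> * real n ^ 5 / real (n choose 6)" using C by (simp add: add_divide_distrib)
    also have "\<bar>K\<bar> * real n ^ 5 / real (n choose 6) = (\<bar>K\<bar> / real n) / (real (n choose 6) / real n ^ 6)"
      using n by (simp add: eval_nat_numeral)
    finally show ?thesis .
  qed
  show ?thesis
  proof (rule tendsto_sandwich[OF _ _ lower upper])
    show "eventually (\<lambda>n. max_density F12 n \<le> 40 / 243 + (\<bar>K\<bar> / real n) / (real (n choose 6) / real n ^ 6)) sequentially"
      using eventually_ge_at_top[of 6] by eventually_elim (rule le)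
  qed (simp add: ge)
qed

text \<open>
  The number \<open>720 (1 / 4374 - 1 / 10^78)\<close> is below \<open>40 / 243\<close> by \<open>720 / 10^78\<close>, which leaves room
  for lower order terms. So graphs that are not covered by \<open>wrong_pairs_le_deficit\<close> have a density
  well below the maximum.
\<close>

lemma density_gap:
  "eventually (\<lambda>n. (1 / 4374 - 1 / 10 ^ 78) * real n ^ 6 / real (n choose 6) + 1 / 10 ^ 78 \<le> max_density F12 n) sequentially"
proof -
  have "(\<lambda>n. max_density F12 n - (1 / 4374 - 1 / 10 ^ 78) / (real (n choose 6) / real n ^ 6))
      \<longlonglongrightarrow> 40 / 243 - (1 / 4374 - 1 / 10 ^ 78) / (1 ^ 6 / fact 6)"
    by (intro tendsto_diff max_density_limit tendsto_divide tendsto_const choose_6_limit) simp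
  moreover have "1 / 10 ^ 78 < 40 / 243 - (1 / 4374 - 1 / 10 ^ 78) / (1 ^ 6 / fact 6 :: real)"
    by (simp add: fact_numeral)
  ultimately have "eventually (\<lambda>n. 1 / 10 ^ 78 <
      max_density F12 n - (1 / 4374 - 1 / 10 ^ 78) / (real (n choose 6) / real n ^ 6)) sequentially"
    by (rule order_tendstoD)
  then show ?thesis
  proof eventually_elim
    case (elim n)
    have "(1 / 4374 - 1 / 10 ^ 78) / (real (n choose 6) / real n ^ 6) = (1 / 4374 - 1 / 10 ^ 78) * real n ^ 6 / real (n choose 6)"
      by (simp only: divide_divide_eq_right)
    then show ?case using elim by linarith
  qed
qed

text \<open>
  For graphs with many copies this is \<open>wrong_pairs_le_deficit\<close>: the blowup has at most the maximal
  density, and the edit distance is at most the number of wrong pairs. For the other graphs the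
  density is below the maximum by at least \<open>1 / 10^78\<close>, and \<open>n^2\<close> is a trivial bound for the edit
  distance.
\<close>

lemma perfectly_stable_F12: "perfectly_stable F12 B12"
proof -
  obtain n0 where n0: "\<And>(V :: nat set) E. (\<forall>x y. E x y = E y x) \<Longrightarrow> finite V \<Longrightarrow> n0 \<le> real (card V) \<Longrightarrow>
     (1 / 4374 - 1 / 10 ^ 78) * real (card V) ^ 6 \<le> real (card (copies E V)) \<Longrightarrow>
     (\<exists>p. (\<forall>x. p x < (3 :: nat)) \<and>
       real (card (wrong_pairs E p V)) * real (card V) ^ 4 / 10 ^ 12 \<le> real (card (copies (model p) V)) - real (card (copies E V)))"
    using wrong_pairs_le_deficit[where 'a = nat] by metis
  obtain n1 where n1: "\<And>n. n1 \<le> n \<Longrightarrow>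
      (1 / 4374 - 1 / 10 ^ 78) * real n ^ 6 / real (n choose 6) + 1 / 10 ^ 78 \<le> max_density F12 n"
    using density_gap unfolding eventually_sequentially by blast
  define C where "C = 10 ^ 78 + \<bar>n0\<bar> + real n1"
  have C: "0 < C" "10 ^ 78 \<le> C" "n0 \<le> C" "real n1 \<le> C" by (simp_all add: C_def add_pos_nonneg)
  have "real (edit_distance G B12) \<le> C * (max_density F12 (card (verts G)) - induced_density F12 G) * (real (card (verts G)))\<^sup>2"
    if G: "is_graph G" and large: "C \<le> real (card (verts G))" for G :: "nat pattern"
  proof -
    let ?V = "verts G" and ?n = "card (verts G)" and ?N = "real (card (copies (adjacency G) (verts G)))"
    let ?gap = "max_density F12 ?n - induced_density F12 G"
    have fin: "finite ?V" using G by (auto simp: is_graph_def is_pattern_def)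
    have "(10 :: real) \<le> 10 ^ 78" by simp
    then have n6: "6 \<le> ?n" using large C(2) by linarith
    have choose_pos: "0 < real (?n choose 6)" using n6 by simp
    have gap0: "0 \<le> ?gap" using max_density_ge[OF G] by simp
    show ?thesis
    proof (cases "(1 / 4374 - 1 / 10 ^ 78) * real ?n ^ 6 \<le> ?N")
      case True
      then obtain p where lab: "\<And>x. p x < (3 :: nat)" and p:
        "real (card (wrong_pairs (adjacency G) p ?V)) * real ?n ^ 4 / 10 ^ 12 \<le> real (card (copies (model p) ?V)) - ?N"
        using n0[of "adjacency G" ?V] adjacency_commute[of G] fin large C(3) by (meson order_trans)
      have "is_graph (blowup_of p ?V)" by (rule blowup_of_graph[of p, OF lab fin])
      then have "real (card (copies (model p) ?V)) / real (?n choose 6) \<le> max_density F12 ?n"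
        using max_density_ge[of "blowup_of p ?V"] density_blowup_of[of p ?V, OF lab fin]
        by (simp add: blowup_of_eq[of p ?V, OF lab])
      then have "(real (card (copies (model p) ?V)) - ?N) / real (?n choose 6) \<le> ?gap"
        by (simp add: induced_density_eq[OF G] diff_divide_distrib)
      then have "real (card (copies (model p) ?V)) - ?N \<le> ?gap * real (?n choose 6)"
        using choose_pos by (simp add: pos_divide_le_eq)
      also have "\<dots> \<le> ?gap * (real ?n ^ 6 / 720)" by (intro mult_left_mono gap0 real_choose_6_le)
      finally have "real (card (wrong_pairs (adjacency G) p ?V)) * real ?n ^ 4 / 10 ^ 12 \<le> ?gap * (real ?n ^ 6 / 720)"
        using p by linarith
      then have "real (card (wrong_pairs (adjacency G) p ?V)) * real ?n ^ 4 \<le> (10 ^ 12 / 720 * ?gap * (real ?n)\<^sup>2) * real ?n ^ 4"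
        by (simp add: field_simps flip: power_add)
      then have "real (card (wrong_pairs (adjacency G) p ?V)) \<le> 10 ^ 12 / 720 * ?gap * (real ?n)\<^sup>2"
        using n6 by (subst (asm) mult_le_cancel_right) auto
      also have "\<dots> \<le> C * ?gap * (real ?n)\<^sup>2"
        using gap0 C(2) by (intro mult_right_mono) (auto intro: order_trans[rotated])
      finally show ?thesis using edit_distance_le_wrong[of G p, OF G lab] by linarith
    next
      case False
      then have "induced_density F12 G \<le> (1 / 4374 - 1 / 10 ^ 78) * real ?n ^ 6 / real (?n choose 6)"
        unfolding induced_density_eq[OF G] using choose_pos by (intro divide_right_mono) auto
      then have "1 / 10 ^ 78 \<le> ?gap" using n1[of ?n] large C(4) by linarith
      then have "10 ^ 78 * (1 / 10 ^ 78) \<le> C * ?gap" using C by (intro mult_mono) auto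
      then have "1 \<le> C * ?gap" by simp
      then have "1 * (real ?n)\<^sup>2 \<le> C * ?gap * (real ?n)\<^sup>2" by (intro mult_right_mono) auto
      moreover have "real (edit_distance G B12) \<le> (real ?n)\<^sup>2"
        using edit_distance_le_square[OF G] by (simp only: of_nat_le_iff flip: of_nat_power)
      ultimately show ?thesis by linarith
    qed
  qed
  then show ?thesis unfolding perfectly_stable_def using C(1) by (intro exI[of _ C] conjI allI impI)
qed

lemma limit_density_le:
  assumes "y \<in> std_simplex (verts B12)"
  shows "limit_density y \<le> 40 / 243"
    and "limit_density y = 40 / 243 \<Longrightarrow> i \<in> verts B12 \<Longrightarrow> y i = 1 / 3"
proof -
  define f where "f = (y 0)\<^sup>2 * (y 1 * y 2 * ((y 1)\<^sup>2 + (y 2)\<^sup>2)) / 12"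
  have y: "0 \<le> y 0" "0 \<le> y 1" "0 \<le> y 2" "y 0 + y 1 + y 2 = 1"
    using assms by (auto simp: std_simplex_def B12_verts)
  have L: "limit_density y = 720 * f" by (simp add: limit_density_def f_def)
  note b = simplex_bound[OF y, folded f_def]
  have "0 \<le> (y 0 - 1 / 3)\<^sup>2" by simp
  then have "0 \<le> 1944 * (1 / 4374 - f)" using b(1) by (rule order_trans)
  then show "limit_density y \<le> 40 / 243" unfolding L by simp
  assume "limit_density y = 40 / 243" and i: "i \<in> verts B12"
  then have f: "f = 1 / 4374" unfolding L by simp
  have y0: "y 0 = 1 / 3" using b(1) unfolding f by simp
  have "(y 1 - y 2) ^ 4 \<le> 0" using b(2) unfolding f y0 by (simp add: power2_eq_square)
  then have "(y 1 - y 2) ^ 4 = 0" by (intro antisym) simp_all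
  then have "y 1 = y 2" by simp
  then have "y 1 = 1 / 3" "y 2 = 1 / 3" using y(4) y0 by linarith+
  then show "y i = 1 / 3" using i y0 by (auto simp: B12_verts)
qed

theorem theorem3p6:
  "convergent (max_density F12) \<and> inducibility F12 = 40 / 243 \<and>
   perfectly_stable F12 B12 \<and>
   density_maximiser F12 B12 (\<lambda>i. 1 / 3) \<and>
   (\<forall>x. density_maximiser F12 B12 x \<longrightarrow>
      (\<exists>f. automorphism f B12 \<and> (\<forall>i \<in> verts B12. x (f i) = 1 / 3)))"
proof (intro conjI allI impI)
  show "convergent (max_density F12)" using max_density_limit by (auto simp: convergent_def)
  show "inducibility F12 = 40 / 243" unfolding inducibility_def using max_density_limit by (rule limI)
  show "perfectly_stable F12 B12" by (rule perfectly_stable_F12)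
  have simplex: "(\<lambda>i. 1 / 3) \<in> std_simplex (verts B12)" by (simp add: std_simplex_def B12_verts)
  have centre: "limit_density (\<lambda>i. 1 / 3) = 40 / 243" by (simp add: limit_density_def power2_eq_square)
  have "blowup_density F12 B12 y \<le> blowup_density F12 B12 (\<lambda>i. 1 / 3)" if y: "y \<in> std_simplex (verts B12)" for y
    unfolding blowup_density_eq[OF y] blowup_density_eq[OF simplex] centre by (rule limit_density_le(1)[OF y])
  then show "density_maximiser F12 B12 (\<lambda>i. 1 / 3)"
    unfolding density_maximiser_def using simplex by (intro conjI ballI)
  fix x assume x: "density_maximiser F12 B12 x"
  then have xs: "x \<in> std_simplex (verts B12)" by (simp add: density_maximiser_def)
  have "limit_density (\<lambda>i. 1 / 3) \<le> limit_density x"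
    using x[unfolded density_maximiser_def, THEN conjunct2, THEN bspec, OF simplex]
    unfolding blowup_density_eq[OF xs] blowup_density_eq[OF simplex] .
  then have "limit_density x = 40 / 243" using limit_density_le(1)[OF xs] centre by simp
  then have "\<forall>i\<in>verts B12. x (id i) = 1 / 3" using limit_density_le(2)[OF xs] by simp
  moreover have "automorphism id B12" by (simp add: automorphism_def isomorphism_def)
  ultimately show "\<exists>f. automorphism f B12 \<and> (\<forall>i\<in>verts B12. x (f i) = 1 / 3)" by blast
qed

end
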